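(* Let $\mathbf{X}_1,\dots,\mathbf{X}_n$ be i.i.d. bivariate random vectors with continuous distribution function $F$, continuous marginals $F_1,F_2$ and copula $C$. Assume that $C$ is associative, i.e. $C(x,C(y,z))=C(C(x,y),z)$ for all $(x,y,z)\in[0,1]^3$, and that for $p=1,2$ the first order partial derivative $\dot C_p$ of $C$ with respect to the $p$-th coordinate exists and is continuous on $V_p=\{\mathbf{u}\in[0,1]^2: 0<u_p<1\}$. Let $$\mathbb{H}_n(x,y,z)=\sqrt{n}\,\{C_n(x,C_n(y,z))-C_n(C_n(x,y),z)\},\qquad (x,y,z)\in[0,1]^3,$$ where $C_n$ is the empirical copula. Then, as $n\to\infty$, $\mathbb{H}_n$ converges weakly in $l^\infty([0,1]^3)$ to $\mathbb{H}_C$, where $$\mathbb{H}_C(x,y,z)=\mathbb{G}_C(x,C(y,z))-\mathbb{G}_C(C(x,y),z)+\dot C_2(x,C(y,z))\,\mathbb{G}_C(y,z)-\dot C_1(C(x,y),z)\,\mathbb{G}_C(x,y).$$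
   Context: Empirical copula: $C_n(\mathbf{u})=F_n(F_{n1}^-(u_1),F_{n2}^-(u_2))$, $\mathbf{u}\in[0,1]^2$, where $F_n(\mathbf{x})=n^{-1}\sum_{i=1}^n\mathbb{I}\{X_{i1}\le x_1,X_{i2}\le x_2\}$, $F_{np}(x)=n^{-1}\sum_{i=1}^n\mathbb{I}\{X_{ip}\le x\}$ ($p=1,2$), and $G^-(u)=\inf\{x\in\mathbb{R}:G(x)\ge u\}$ is the generalized inverse (so $G^-(0)=-\infty$ and $C_n(\mathbf u)=0$ if $u_1=0$ or $u_2=0$). $\mathbb{B}_C$ is a centered Gaussian field on $[0,1]^2$ with continuous sample paths and $\mathrm{Cov}(\mathbb{B}_C(\mathbf{x}),\mathbb{B}_C(\mathbf{y}))=C(\mathbf{x}\wedge\mathbf{y})-C(\mathbf{x})C(\mathbf{y})$ (componentwise minimum), and $$\mathbb{G}_C(\mathbf{x})=\mathbb{B}_C(\mathbf{x})-\dot C_1(\mathbf{x})\mathbb{B}_C(x_1,1)-\dot C_2(\mathbf{x})\mathbb{B}_C(1,x_2).$$ Convention: $\dot C_p$ is set to $0$ at points with $u_p\in\{0,1\}$ (there it is only multiplied by quantities that vanish almost surely). $l^\infty(T)$ is the space of uniformly bounded real functions on $T$ with the supremum norm; weak convergence is in the sense of Hoffmann-Jørgensen (outer expectations), as in van der Vaart and Wellner. *)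

theory Defs
  imports "HOL-Probability.Probability"
begin

section \<open>Weak convergence in the sense of Hoffmann-Jorgensen\<close>

text \<open>The space of bounded real functions on \<open>T\<close> with the supremum metric. As usual for
  \<^const>\<open>funspace\<close>, its members are extensional (equal to \<^const>\<open>undefined\<close> off \<open>T\<close>).\<close>

definition linf :: "'t set \<Rightarrow> ('t \<Rightarrow> real) metric" where
  "linf T = funspace T euclidean_metric"

definition borel_of_metric :: "'d metric \<Rightarrow> 'd measure" where
  "borel_of_metric m = sigma (mspace m) {U. openin (mtopology_of m) U}"

text \<open>\<open>E\<^sup>* Z = inf {E U | U \<ge> Z}\<close>, over measurable extended-real \<open>U\<close> for which \<open>E U\<close> exists, that is,
  for which at least one of \<open>E U\<^sup>+\<close>, \<open>E U\<^sup>-\<close> is finite. Note that \<^const>\<open>e2ennreal\<close> truncates at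
  \<open>0\<close>, hence computes positive parts.\<close>

definition outer_expectation :: "'a measure \<Rightarrow> ('a \<Rightarrow> real) \<Rightarrow> ereal" where
  "outer_expectation M Z = Inf
     {enn2ereal (\<integral>\<^sup>+ \<omega>. e2ennreal (U \<omega>) \<partial>M) - enn2ereal (\<integral>\<^sup>+ \<omega>. e2ennreal (- U \<omega>) \<partial>M) | U.
        U \<in> borel_measurable M \<and> (\<forall>\<omega>\<in>space M. ereal (Z \<omega>) \<le> U \<omega>) \<and>
        ((\<integral>\<^sup>+ \<omega>. e2ennreal (U \<omega>) \<partial>M) < \<infinity> \<or> (\<integral>\<^sup>+ \<omega>. e2ennreal (- U \<omega>) \<partial>M) < \<infinity>)}"

text \<open>The maps \<open>Y n\<close> are arbitrary (possibly non-measurable) maps into the metric space; the limit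
  \<open>L\<close>, which may live on another probability space, is Borel measurable.\<close>

definition weakly_converges_HJ ::
  "'d metric \<Rightarrow> 'a measure \<Rightarrow> (nat \<Rightarrow> 'a \<Rightarrow> 'd) \<Rightarrow> 'b measure \<Rightarrow> ('b \<Rightarrow> 'd) \<Rightarrow> bool" where
  "weakly_converges_HJ m M Y N L \<longleftrightarrow>
     (\<forall>n. Y n \<in> space M \<rightarrow> mspace m) \<and>
     L \<in> N \<rightarrow>\<^sub>M borel_of_metric m \<and>
     (\<forall>f. continuous_map (mtopology_of m) euclideanreal f \<and> bounded (f ` mspace m) \<longrightarrow>
        (\<lambda>n. outer_expectation M (\<lambda>\<omega>. f (Y n \<omega>)))
          \<longlonglongrightarrow> ereal (\<integral>\<omega>. f (L \<omega>) \<partial>N))"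


section \<open>Copulas and distribution functions\<close>

abbreviation unit_square :: "(real \<times> real) set" where
  "unit_square \<equiv> {0..1} \<times> {0..1}"

abbreviation unit_cube :: "(real \<times> real \<times> real) set" where
  "unit_cube \<equiv> {0..1} \<times> {0..1} \<times> {0..1}"

definition copula :: "(real \<times> real \<Rightarrow> real) \<Rightarrow> bool" where
  "copula C \<longleftrightarrow>
     (\<forall>u\<in>{0..1}. C (u, 0) = 0 \<and> C (0, u) = 0 \<and> C (u, 1) = u \<and> C (1, u) = u) \<and>
     (\<forall>u u' v v'. 0 \<le> u \<and> u \<le> u' \<and> u' \<le> 1 \<and> 0 \<le> v \<and> v \<le> v' \<and> v' \<le> 1 \<longrightarrow>
        0 \<le> C (u', v') - C (u, v') - C (u', v) + C (u, v))"

definition joint_cdf :: "(real \<times> real) measure \<Rightarrow> real \<times> real \<Rightarrow> real" where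
  "joint_cdf D x = measure D ({..fst x} \<times> {..snd x})"

definition marginal_cdf1 :: "(real \<times> real) measure \<Rightarrow> real \<Rightarrow> real" where
  "marginal_cdf1 D = cdf (distr D borel fst)"

definition marginal_cdf2 :: "(real \<times> real) measure \<Rightarrow> real \<Rightarrow> real" where
  "marginal_cdf2 D = cdf (distr D borel snd)"

definition copula_of :: "(real \<times> real \<Rightarrow> real) \<Rightarrow> (real \<times> real) measure \<Rightarrow> bool" where
  "copula_of C D \<longleftrightarrow> copula C \<and>
     (\<forall>x y. joint_cdf D (x, y) = C (marginal_cdf1 D x, marginal_cdf2 D y))"

definition associative_copula :: "(real \<times> real \<Rightarrow> real) \<Rightarrow> bool" where
  "associative_copula C \<longleftrightarrow> (\<forall>(x, y, z)\<in>unit_cube. C (x, C (y, z)) = C (C (x, y), z))"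

definition V1 :: "(real \<times> real) set" where
  "V1 = {u \<in> unit_square. 0 < fst u \<and> fst u < 1}"

definition V2 :: "(real \<times> real) set" where
  "V2 = {u \<in> unit_square. 0 < snd u \<and> snd u < 1}"

text \<open>Partial derivatives, set to \<open>0\<close> where the differentiated coordinate is \<open>0\<close> or \<open>1\<close>.\<close>

definition partial1 :: "(real \<times> real \<Rightarrow> real) \<Rightarrow> real \<times> real \<Rightarrow> real" where
  "partial1 C u = (if 0 < fst u \<and> fst u < 1 then deriv (\<lambda>s. C (s, snd u)) (fst u) else 0)"

definition partial2 :: "(real \<times> real \<Rightarrow> real) \<Rightarrow> real \<times> real \<Rightarrow> real" where
  "partial2 C u = (if 0 < snd u \<and> snd u < 1 then deriv (\<lambda>t. C (fst u, t)) (snd u) else 0)"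

definition has_continuous_partials :: "(real \<times> real \<Rightarrow> real) \<Rightarrow> bool" where
  "has_continuous_partials C \<longleftrightarrow>
     (\<forall>u\<in>V1. (\<lambda>s. C (s, snd u)) field_differentiable (at (fst u))) \<and>
     continuous_on V1 (partial1 C) \<and>
     (\<forall>u\<in>V2. (\<lambda>t. C (fst u, t)) field_differentiable (at (snd u))) \<and>
     continuous_on V2 (partial2 C)"


section \<open>The empirical copula\<close>

text \<open>A sample is a sequence \<open>\<xi>\<close>, of which the entries \<open>\<xi> 1, \<dots>, \<xi> n\<close> are used. The joint empirical
  distribution function takes extended-real arguments, because generalized inverses may be
  infinite.\<close>

definition emp_cdf :: "nat \<Rightarrow> (nat \<Rightarrow> real \<times> real) \<Rightarrow> ereal \<times> ereal \<Rightarrow> real" where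
  "emp_cdf n \<xi> x =
     real (card {i \<in> {1..n}. ereal (fst (\<xi> i)) \<le> fst x \<and> ereal (snd (\<xi> i)) \<le> snd x}) / real n"

definition emp_marginal1 :: "nat \<Rightarrow> (nat \<Rightarrow> real \<times> real) \<Rightarrow> real \<Rightarrow> real" where
  "emp_marginal1 n \<xi> x = real (card {i \<in> {1..n}. fst (\<xi> i) \<le> x}) / real n"

definition emp_marginal2 :: "nat \<Rightarrow> (nat \<Rightarrow> real \<times> real) \<Rightarrow> real \<Rightarrow> real" where
  "emp_marginal2 n \<xi> x = real (card {i \<in> {1..n}. snd (\<xi> i) \<le> x}) / real n"

definition gen_inverse :: "(real \<Rightarrow> real) \<Rightarrow> real \<Rightarrow> ereal" where
  "gen_inverse G u = Inf (ereal ` {x. u \<le> G x})"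

definition emp_copula :: "nat \<Rightarrow> (nat \<Rightarrow> real \<times> real) \<Rightarrow> real \<times> real \<Rightarrow> real" where
  "emp_copula n \<xi> u =
     emp_cdf n \<xi> (gen_inverse (emp_marginal1 n \<xi>) (fst u), gen_inverse (emp_marginal2 n \<xi>) (snd u))"

definition assoc_process ::
  "(nat \<Rightarrow> 'a \<Rightarrow> real \<times> real) \<Rightarrow> nat \<Rightarrow> 'a \<Rightarrow> real \<times> real \<times> real \<Rightarrow> real" where
  "assoc_process X n \<omega> =
     (let Cn = emp_copula n (\<lambda>i. X i \<omega>) in
      restrict (\<lambda>(x, y, z). sqrt (real n) * (Cn (x, Cn (y, z)) - Cn (Cn (x, y), z))) unit_cube)"


section \<open>The limiting Gaussian process\<close>

text \<open>Normal random variables, including the degenerate ones: constants have to be treated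
  separately because \<^const>\<open>normal_density\<close> needs a positive standard deviation.\<close>

definition gaussian_rv :: "'b measure \<Rightarrow> ('b \<Rightarrow> real) \<Rightarrow> bool" where
  "gaussian_rv N Y \<longleftrightarrow> Y \<in> borel_measurable N \<and>
     ((\<exists>c. AE \<omega> in N. Y \<omega> = c) \<or>
      (\<exists>\<mu> \<sigma>. 0 < \<sigma> \<and> distributed N lborel Y (\<lambda>x. ennreal (normal_density \<mu> \<sigma> x))))"

definition gaussian_field :: "'b measure \<Rightarrow> 't set \<Rightarrow> ('b \<Rightarrow> 't \<Rightarrow> real) \<Rightarrow> bool" where
  "gaussian_field N T B \<longleftrightarrow>
     (\<forall>S a. finite S \<and> S \<subseteq> T \<longrightarrow> gaussian_rv N (\<lambda>\<omega>. \<Sum>t\<in>S. a t * B \<omega> t))"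

definition covariance :: "'b measure \<Rightarrow> ('b \<Rightarrow> real) \<Rightarrow> ('b \<Rightarrow> real) \<Rightarrow> real" where
  "covariance N Y Z =
     (\<integral>\<omega>. (Y \<omega> - (\<integral>\<omega>'. Y \<omega>' \<partial>N)) * (Z \<omega> - (\<integral>\<omega>'. Z \<omega>' \<partial>N)) \<partial>N)"

definition C_brownian_bridge ::
  "(real \<times> real \<Rightarrow> real) \<Rightarrow> 'b measure \<Rightarrow> ('b \<Rightarrow> real \<times> real \<Rightarrow> real) \<Rightarrow> bool" where
  "C_brownian_bridge C N B \<longleftrightarrow>
     gaussian_field N unit_square B \<and>
     (\<forall>u\<in>unit_square. (\<integral>\<omega>. B \<omega> u \<partial>N) = 0) \<and>
     (\<forall>u\<in>unit_square. \<forall>v\<in>unit_square.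
        covariance N (\<lambda>\<omega>. B \<omega> u) (\<lambda>\<omega>. B \<omega> v) =
          C (min (fst u) (fst v), min (snd u) (snd v)) - C u * C v) \<and>
     (\<forall>\<omega>\<in>space N. continuous_on unit_square (B \<omega>))"

text \<open>In the next two definitions \<open>b\<close> is a single path of the bridge.\<close>

definition G_path :: "(real \<times> real \<Rightarrow> real) \<Rightarrow> (real \<times> real \<Rightarrow> real) \<Rightarrow> real \<times> real \<Rightarrow> real" where
  "G_path C b u = b u - partial1 C u * b (fst u, 1) - partial2 C u * b (1, snd u)"

definition H_path ::
  "(real \<times> real \<Rightarrow> real) \<Rightarrow> (real \<times> real \<Rightarrow> real) \<Rightarrow> real \<times> real \<times> real \<Rightarrow> real" where
  "H_path C b =
     (let G = G_path C b in
      restrict (\<lambda>(x, y, z).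
        G (x, C (y, z)) - G (C (x, y), z)
        + partial2 C (x, C (y, z)) * G (y, z) - partial1 C (C (x, y), z) * G (x, y)) unit_cube)"

end

theory Submission
  imports Defs
begin

text \<open>Transform the margins to uniform ones; let \<open>a\<close> be the resulting empirical process \<open>sqrt n (G - C)\<close> and
  \<open>H_path C\<close> the bounded linear map taking a path \<open>b\<close> to the limit path. Two facts are combined.

  Deterministically, if \<open>a\<close> has a small modulus of continuity and nearly vanishes on \<open>{C = 0}\<close> and at \<open>(1, 1)\<close>,
  then the associativity process is uniformly close to \<open>H_path C a\<close> once \<open>n\<close> is large: the mean value theorem
  expands the empirical quantiles and the composition with \<open>C\<close>, and wherever a partial derivative is not uniformly
  continuous it is multiplied by a small quantity.

  Probabilistically, a Bernstein bound and dyadic chaining make \<open>a\<close> equicontinuous with high probability, so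
  \<open>a\<close> may be replaced by the step function through its values on a fixed dyadic grid. These finitely many values
  converge in law to those of the bridge, by the central limit theorem for linear combinations and
  approximation by trigonometric sums.\<close>

section \<open>Hoffmann-Jorgensen weak convergence\<close>

text \<open>The partial derivatives need not extend continuously to the edges where the
  differentiated coordinate is 0 or 1. Two facts compensate. Being derivatives of a copula, they lie
  in \<open>{0..1}\<close>, so \<open>H_path C\<close> is Lipschitz for the supremum norm (constant
  12) on all bounded paths, step functions included. And the factor beside a derivative is small
  where the derivative may oscillate: \<open>a (x, 1)\<close> for \<open>x\<close> near 0 or 1, and
  \<open>G_path C a (y, z)\<close> where \<open>C (y, z)\<close> is near 0 or 1. The latter is
  delicate near 0, since the zero set of \<open>C\<close> can have interior points, as for
  \<open>(max 0 (sqrt x + sqrt y - 1))\<^sup>2\<close>; but a zero of \<open>C\<close> is a minimum,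
  so the derivatives vanish there as well.

  The space of bounded functions is not separable and the process need not be Borel measurable. It
  is therefore only squeezed between integrable bounds, and measurability is reached through
  functionals of finitely many grid values and their limits.\<close>

lemma openin_mtopology_of_subset: "openin (mtopology_of m) U \<Longrightarrow> U \<subseteq> mspace m"
  using openin_subset by fastforce

lemma space_borel_of_metric [simp]: "space (borel_of_metric m) = mspace m"
  by (auto simp: borel_of_metric_def space_measure_of_conv)

lemma sets_borel_of_metric_open: "openin (mtopology_of m) U \<Longrightarrow> U \<in> sets (borel_of_metric m)"
  unfolding borel_of_metric_def
  by (subst sets_measure_of) (auto dest: openin_mtopology_of_subset)

lemma measurable_borel_of_metricI:
  assumes "L \<in> space N \<rightarrow> mspace m"
    and "\<And>U. openin (mtopology_of m) U \<Longrightarrow> L -` U \<inter> space N \<in> sets N"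
  shows "L \<in> N \<rightarrow>\<^sub>M borel_of_metric m"
  unfolding borel_of_metric_def
  by (rule measurable_measure_of) (use assms in \<open>auto dest: openin_mtopology_of_subset\<close>)

lemma continuous_map_measurable_borel_of_metric:
  assumes "continuous_map (mtopology_of m) euclideanreal f"
  shows "f \<in> borel_measurable (borel_of_metric m)"
proof (rule borel_measurableI)
  fix S :: "real set" assume "open S"
  then have "openin (mtopology_of m) {x \<in> topspace (mtopology_of m). f x \<in> S}"
    using assms by (auto simp: continuous_map_def)
  then show "f -` S \<inter> space (borel_of_metric m) \<in> sets (borel_of_metric m)"
    by (auto intro!: sets_borel_of_metric_open simp: vimage_def Collect_conj_eq Int_commute)
qed

lemma continuous_map_lipschitz_real:
  assumes "\<And>x y. x \<in> mspace m \<Longrightarrow> y \<in> mspace m \<Longrightarrow> \<bar>f x - f y\<bar> \<le> K * mdist m x y"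
  shows "continuous_map (mtopology_of m) euclideanreal f"
proof -
  have "Lipschitz_continuous_map m euclidean_metric f"
    unfolding Lipschitz_continuous_map_def
    using assms by (auto simp: dist_real_def intro!: exI[of _ K])
  then have "continuous_map (mtopology_of m) (mtopology_of euclidean_metric) f"
    by (intro uniformly_continuous_imp_continuous_map Lipschitz_imp_uniformly_continuous_map)
  then show ?thesis by simp
qed

text \<open>Take \<open>g k x\<close> as the supremum over \<open>y\<close> of
  \<open>f y - k * mdist m x y\<close>. The choice \<open>y = x\<close> puts it above
  \<open>f\<close>, the triangle inequality gives the Lipschitz constant, and for large
  \<open>k\<close> only points close to \<open>x\<close> can compete, where \<open>f\<close> is
  close to \<open>f x\<close>.\<close>

lemma lipschitz_upper_approximation:
  fixes f :: "'d \<Rightarrow> real"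
  assumes cont: "continuous_map (mtopology_of m) euclideanreal f"
    and bnd: "\<And>x. x \<in> mspace m \<Longrightarrow> \<bar>f x\<bar> \<le> b"
  obtains g :: "nat \<Rightarrow> 'd \<Rightarrow> real" where
    "\<And>k x. x \<in> mspace m \<Longrightarrow> f x \<le> g k x"
    "\<And>k x. x \<in> mspace m \<Longrightarrow> \<bar>g k x\<bar> \<le> b"
    "\<And>k x y. x \<in> mspace m \<Longrightarrow> y \<in> mspace m \<Longrightarrow> \<bar>g k x - g k y\<bar> \<le> real k * mdist m x y"
    "\<And>x. x \<in> mspace m \<Longrightarrow> (\<lambda>k. g k x) \<longlonglongrightarrow> f x"
proof
  interpret Metric_space "mspace m" "mdist m" by simp
  define h where "h k x y = f y - real k * mdist m x y" for k x y
  define g where "g k x = (SUP y\<in>mspace m. h k x y)" for k x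
  have h_le: "h k x y \<le> b" if "x \<in> mspace m" "y \<in> mspace m" for k x y
  proof -
    have "0 \<le> real k * mdist m x y" by simp
    then show ?thesis using bnd[OF that(2)] unfolding h_def by linarith
  qed
  have bdd: "bdd_above (h k x ` mspace m)" if "x \<in> mspace m" for k x
    using h_le[OF that] by (auto simp: bdd_above_def)
  have h_self: "h k x x = f x" if "x \<in> mspace m" for k x
    using that by (simp add: h_def)
  show 1: "f x \<le> g k x" if "x \<in> mspace m" for k x
    unfolding g_def using cSUP_upper[OF that bdd[OF that]] h_self[OF that] by metis
  have g_le: "g k x \<le> c" if "x \<in> mspace m" "\<And>y. y \<in> mspace m \<Longrightarrow> h k x y \<le> c" for k x c
    unfolding g_def using that by (intro cSUP_least) auto
  show "\<bar>g k x\<bar> \<le> b" if "x \<in> mspace m" for k x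
    using 1[OF that, of k] g_le[OF that, of k b] h_le[OF that] bnd[OF that] by (auto simp: abs_le_iff)
  have half: "g k x \<le> g k y + real k * mdist m x y" if "x \<in> mspace m" "y \<in> mspace m" for k x y
  proof (rule g_le[OF that(1)])
    fix w assume w: "w \<in> mspace m"
    have "h k y w \<le> g k y" unfolding g_def by (rule cSUP_upper[OF w bdd[OF that(2)]])
    moreover have "real k * mdist m y w \<le> real k * (mdist m x y + mdist m x w)"
      using triangle[of y x w] that w by (intro mult_left_mono) (auto simp: commute)
    ultimately show "h k x w \<le> g k y + real k * mdist m x y"
      by (simp add: h_def algebra_simps)
  qed
  show "\<bar>g k x - g k y\<bar> \<le> real k * mdist m x y" if "x \<in> mspace m" "y \<in> mspace m" for k x y
    using half[OF that, of k] half[OF that(2,1), of k] by (simp add: commute abs_le_iff)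
  show "(\<lambda>k. g k x) \<longlonglongrightarrow> f x" if x: "x \<in> mspace m" for x
  proof (rule LIMSEQ_I)
    fix e :: real assume e: "0 < e"
    have "continuous_map mtopology euclideanreal f"
      using cont by (simp add: mtopology_of_def)
    then have "openin mtopology {y \<in> topspace mtopology. f y \<in> ball (f x) (e/2)}"
      using open_ball by (simp only: continuous_map_def open_openin[symmetric]) blast
    then obtain r where r: "r > 0" "mball x r \<subseteq> {y \<in> topspace mtopology. f y \<in> ball (f x) (e/2)}"
      using x e unfolding openin_mtopology by (auto 0 3)
    \<comment> \<open>At distance at least \<open>r\<close> the penalty then exceeds
      \<open>2 * b\<close>, the largest possible oscillation of \<open>f\<close>.\<close>
    obtain k0 :: nat where k0: "2 * b / r < real k0" using reals_Archimedean2 by blast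
    show "\<exists>k0. \<forall>k\<ge>k0. norm (g k x - f x) < e"
    proof (intro exI allI impI)
      fix k assume k: "k \<ge> k0"
      have "g k x \<le> f x + e/2"
      proof (rule g_le[OF x])
        fix y assume y: "y \<in> mspace m"
        show "h k x y \<le> f x + e/2"
        proof (cases "mdist m x y < r")
          case True
          then have "f y \<in> ball (f x) (e/2)" using r(2) x y by auto
          then have "f y \<le> f x + e/2" by (auto simp: dist_real_def abs_if split: if_splits)
          moreover have "0 \<le> real k * mdist m x y" by simp
          ultimately show ?thesis unfolding h_def by linarith
        next
          case False
          have "2 * b < real k0 * r" using k0 r(1) by (simp add: field_simps)
          also have "\<dots> \<le> real k * mdist m x y" using False k r(1) by (intro mult_mono) auto
          finally show ?thesis using bnd[OF x] bnd[OF y] e unfolding h_def by linarith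
        qed
      qed
      then show "norm (g k x - f x) < e" using 1[OF x, of k] e by auto
    qed
  qed
qed

section \<open>Outer expectations between integrable bounds\<close>

lemma outer_expectation_mono:
  assumes "\<And>\<omega>. \<omega> \<in> space M \<Longrightarrow> Z \<omega> \<le> Z' \<omega>"
  shows "outer_expectation M Z \<le> outer_expectation M Z'"
  unfolding outer_expectation_def
proof (rule Inf_superset_mono, clarify)
  fix U :: "'a \<Rightarrow> ereal"
  assume U: "U \<in> borel_measurable M" "\<forall>\<omega>\<in>space M. ereal (Z' \<omega>) \<le> U \<omega>"
    "(\<integral>\<^sup>+ \<omega>. e2ennreal (U \<omega>) \<partial>M) < \<infinity> \<or> (\<integral>\<^sup>+ \<omega>. e2ennreal (- U \<omega>) \<partial>M) < \<infinity>"
  have "\<forall>\<omega>\<in>space M. ereal (Z \<omega>) \<le> U \<omega>"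
    using U(2) assms by (meson ereal_less_eq(3) order_trans)
  then show "\<exists>U'. enn2ereal (\<integral>\<^sup>+ \<omega>. e2ennreal (U \<omega>) \<partial>M) - enn2ereal (\<integral>\<^sup>+ \<omega>. e2ennreal (- U \<omega>) \<partial>M)
      = enn2ereal (\<integral>\<^sup>+ \<omega>. e2ennreal (U' \<omega>) \<partial>M) - enn2ereal (\<integral>\<^sup>+ \<omega>. e2ennreal (- U' \<omega>) \<partial>M) \<and>
      U' \<in> borel_measurable M \<and> (\<forall>\<omega>\<in>space M. ereal (Z \<omega>) \<le> U' \<omega>) \<and>
      ((\<integral>\<^sup>+ \<omega>. e2ennreal (U' \<omega>) \<partial>M) < \<infinity> \<or> (\<integral>\<^sup>+ \<omega>. e2ennreal (- U' \<omega>) \<partial>M) < \<infinity>)"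
    using U by blast
qed

text \<open>Brings the Bochner integral into the form used in \<open>outer_expectation\<close>. Both
  parts are finite, so the extended-real difference is an honest one.\<close>

lemma integral_eq_parts:
  fixes V :: "'a \<Rightarrow> real"
  assumes "integrable M V"
  shows "ereal (\<integral>\<omega>. V \<omega> \<partial>M) =
    enn2ereal (\<integral>\<^sup>+ \<omega>. e2ennreal (ereal (V \<omega>)) \<partial>M) - enn2ereal (\<integral>\<^sup>+ \<omega>. e2ennreal (- ereal (V \<omega>)) \<partial>M)"
    "(\<integral>\<^sup>+ \<omega>. e2ennreal (ereal (V \<omega>)) \<partial>M) < \<infinity>"
    "(\<integral>\<^sup>+ \<omega>. e2ennreal (- ereal (V \<omega>)) \<partial>M) < \<infinity>"
proof -
  have eq: "e2ennreal (ereal (V \<omega>)) = ennreal (V \<omega>)" "e2ennreal (- ereal (V \<omega>)) = ennreal (- V \<omega>)" for \<omega>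
    by (simp_all add: ennreal.abs_eq)
  have *: "(\<integral>\<^sup>+ \<omega>. ennreal (V \<omega>) \<partial>M) < \<infinity>" "(\<integral>\<^sup>+ \<omega>. ennreal (- V \<omega>) \<partial>M) < \<infinity>"
    using integrableD[OF assms] by (auto simp: less_top)
  then show "(\<integral>\<^sup>+ \<omega>. e2ennreal (ereal (V \<omega>)) \<partial>M) < \<infinity>"
    "(\<integral>\<^sup>+ \<omega>. e2ennreal (- ereal (V \<omega>)) \<partial>M) < \<infinity>"
    unfolding eq by auto
  have conv: "enn2ereal a = ereal (enn2real a)" if "a < \<infinity>" for a
    using that by (cases a) (auto simp: enn2ereal_ennreal)
  show "ereal (\<integral>\<omega>. V \<omega> \<partial>M) =
    enn2ereal (\<integral>\<^sup>+ \<omega>. e2ennreal (ereal (V \<omega>)) \<partial>M) - enn2ereal (\<integral>\<^sup>+ \<omega>. e2ennreal (- ereal (V \<omega>)) \<partial>M)"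
    unfolding eq conv[OF *(1)] conv[OF *(2)] real_lebesgue_integral_def[OF assms] by simp
qed

lemma outer_expectation_le_integral:
  fixes V :: "'a \<Rightarrow> real"
  assumes "integrable M V" "\<And>\<omega>. \<omega> \<in> space M \<Longrightarrow> Z \<omega> \<le> V \<omega>"
  shows "outer_expectation M Z \<le> ereal (\<integral>\<omega>. V \<omega> \<partial>M)"
  unfolding outer_expectation_def
  apply (rule Inf_lower)
  apply (rule CollectI)
  apply (rule exI[of _ "\<lambda>\<omega>. ereal (V \<omega>)"])
  using integral_eq_parts[OF assms(1)] assms by auto

text \<open>Every admissible \<open>U\<close> dominates \<open>V\<close>, so its positive part is
  larger and its negative part smaller. Together with the upper bound this replaces measurability:
  an arbitrary \<open>Z\<close> trapped between two integrable functions has its outer expectation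
  trapped between their integrals.\<close>

lemma integral_le_outer_expectation:
  fixes V :: "'a \<Rightarrow> real"
  assumes "integrable M V" "\<And>\<omega>. \<omega> \<in> space M \<Longrightarrow> V \<omega> \<le> Z \<omega>"
  shows "ereal (\<integral>\<omega>. V \<omega> \<partial>M) \<le> outer_expectation M Z"
  unfolding outer_expectation_def
proof (rule Inf_greatest, clarify)
  fix U :: "'a \<Rightarrow> ereal"
  assume U: "\<forall>\<omega>\<in>space M. ereal (Z \<omega>) \<le> U \<omega>"
  have le: "ereal (V \<omega>) \<le> U \<omega>" if "\<omega> \<in> space M" for \<omega>
    using U assms(2)[OF that] that by (meson ereal_less_eq(3) order_trans)
  have "(\<integral>\<^sup>+ \<omega>. e2ennreal (ereal (V \<omega>)) \<partial>M) \<le> (\<integral>\<^sup>+ \<omega>. e2ennreal (U \<omega>) \<partial>M)"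
    by (intro nn_integral_mono e2ennreal_mono le)
  moreover have "(\<integral>\<^sup>+ \<omega>. e2ennreal (- U \<omega>) \<partial>M) \<le> (\<integral>\<^sup>+ \<omega>. e2ennreal (- ereal (V \<omega>)) \<partial>M)"
    by (intro nn_integral_mono e2ennreal_mono) (simp only: ereal_minus_le_minus le)
  ultimately show "ereal (\<integral>\<omega>. V \<omega> \<partial>M) \<le>
      enn2ereal (\<integral>\<^sup>+ \<omega>. e2ennreal (U \<omega>) \<partial>M) - enn2ereal (\<integral>\<^sup>+ \<omega>. e2ennreal (- U \<omega>) \<partial>M)"
    unfolding integral_eq_parts(1)[OF assms(1)]
    by (intro ereal_minus_mono) (simp_all add: less_eq_ennreal.rep_eq)
qed

lemma ereal_LIMSEQ_sandwich:
  assumes "\<And>e. e > 0 \<Longrightarrow> \<forall>\<^sub>F n in sequentially. ereal (a - e) \<le> x n"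
    and "\<And>e. e > 0 \<Longrightarrow> \<forall>\<^sub>F n in sequentially. x n \<le> ereal (a + e)"
  shows "x \<longlonglongrightarrow> ereal a"
proof (rule order_tendstoI)
  fix l assume "l < ereal a"
  then obtain r where r: "l < ereal r" "ereal r < ereal a" using ereal_dense2 by blast
  have "\<forall>\<^sub>F n in sequentially. ereal (a - (a - r)) \<le> x n" using r by (intro assms(1)) auto
  then show "\<forall>\<^sub>F n in sequentially. l < x n" by eventually_elim (use r in auto)
next
  fix u assume "ereal a < u"
  then obtain r where r: "ereal a < ereal r" "ereal r < u" using ereal_dense2 by blast
  have "\<forall>\<^sub>F n in sequentially. x n \<le> ereal (a + (r - a))" using r by (intro assms(2)) auto
  then show "\<forall>\<^sub>F n in sequentially. x n < u" by eventually_elim (use r in auto)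
qed

text \<open>The sup-convolution of \<open>f\<close> with a cone decreases to \<open>f\<close>, and symmetrically from below; hence
  bounded Lipschitz test functions suffice, without any tightness of \<open>Y\<close>.\<close>

lemma weakly_converges_HJ_lipschitzI:
  fixes m :: "'d metric"
  assumes N: "prob_space N"
    and Y: "\<And>n. Y n \<in> space M \<rightarrow> mspace m"
    and L: "L \<in> N \<rightarrow>\<^sub>M borel_of_metric m"
    and lip: "\<And>f K. (\<And>x. x \<in> mspace m \<Longrightarrow> \<bar>f x\<bar> \<le> K) \<Longrightarrow>
      (\<And>x y. x \<in> mspace m \<Longrightarrow> y \<in> mspace m \<Longrightarrow> \<bar>f x - f y\<bar> \<le> K * mdist m x y) \<Longrightarrow>
      (\<lambda>n. outer_expectation M (\<lambda>\<omega>. f (Y n \<omega>))) \<longlonglongrightarrow> ereal (\<integral>\<omega>. f (L \<omega>) \<partial>N)"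
  shows "weakly_converges_HJ m M Y N L"
  unfolding weakly_converges_HJ_def
proof (intro conjI allI impI)
  interpret N: prob_space N by fact
  fix f assume "continuous_map (mtopology_of m) euclideanreal f \<and> bounded (f ` mspace m)"
  then have f: "continuous_map (mtopology_of m) euclideanreal f" and "bounded (f ` mspace m)" by auto
  then obtain b where b: "\<And>x. x \<in> mspace m \<Longrightarrow> \<bar>f x\<bar> \<le> b" by (auto simp: bounded_iff)
  have Lsp: "L \<omega> \<in> mspace m" if "\<omega> \<in> space N" for \<omega>
    using measurable_space[OF L that] by simp
  have lip': "(\<lambda>n. outer_expectation M (\<lambda>\<omega>. g (Y n \<omega>))) \<longlonglongrightarrow> ereal (\<integral>\<omega>. g (L \<omega>) \<partial>N)"
    if "\<And>x. x \<in> mspace m \<Longrightarrow> \<bar>g x\<bar> \<le> b"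
      "\<And>x y. x \<in> mspace m \<Longrightarrow> y \<in> mspace m \<Longrightarrow> \<bar>g x - g y\<bar> \<le> real k * mdist m x y" for g k
  \<comment> \<open>In \<open>lip\<close> a single constant is both the bound and the Lipschitz
    constant.\<close>
  proof (rule lip[of _ "max b (real k)"])
    fix x y assume "x \<in> mspace m" "y \<in> mspace m"
    from that(2)[OF this] show "\<bar>g x - g y\<bar> \<le> max b (real k) * mdist m x y"
      by (rule order_trans) (auto intro: mult_right_mono)
  qed (use that(1) in force)
  have conv: "(\<lambda>k. \<integral>\<omega>. g k (L \<omega>) \<partial>N) \<longlonglongrightarrow> (\<integral>\<omega>. h (L \<omega>) \<partial>N)"
    if g: "\<And>k x. x \<in> mspace m \<Longrightarrow> \<bar>g k x\<bar> \<le> b"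
      "\<And>k x y. x \<in> mspace m \<Longrightarrow> y \<in> mspace m \<Longrightarrow> \<bar>g k x - g k y\<bar> \<le> real k * mdist m x y"
      "\<And>x. x \<in> mspace m \<Longrightarrow> (\<lambda>k. g k x) \<longlonglongrightarrow> h x"
      and h: "continuous_map (mtopology_of m) euclideanreal h" for g :: "nat \<Rightarrow> _ \<Rightarrow> real" and h
  proof (rule integral_dominated_convergence[where w="\<lambda>_. b"])
    show "(\<lambda>\<omega>. h (L \<omega>)) \<in> borel_measurable N"
      by (rule measurable_compose[OF L continuous_map_measurable_borel_of_metric[OF h]])
    show "(\<lambda>\<omega>. g k (L \<omega>)) \<in> borel_measurable N" for k
      by (rule measurable_compose[OF L continuous_map_measurable_borel_of_metric])
        (rule continuous_map_lipschitz_real[OF g(2)])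
  qed (auto intro!: AE_I2 g Lsp)
  show "(\<lambda>n. outer_expectation M (\<lambda>\<omega>. f (Y n \<omega>))) \<longlonglongrightarrow> ereal (\<integral>\<omega>. f (L \<omega>) \<partial>N)"
  proof (rule ereal_LIMSEQ_sandwich)
    fix e :: real assume e: "e > 0"
    obtain g :: "nat \<Rightarrow> 'd \<Rightarrow> real" where g: "\<And>k x. x \<in> mspace m \<Longrightarrow> f x \<le> g k x"
      "\<And>k x. x \<in> mspace m \<Longrightarrow> \<bar>g k x\<bar> \<le> b"
      "\<And>k x y. x \<in> mspace m \<Longrightarrow> y \<in> mspace m \<Longrightarrow> \<bar>g k x - g k y\<bar> \<le> real k * mdist m x y"
      "\<And>x. x \<in> mspace m \<Longrightarrow> (\<lambda>k. g k x) \<longlonglongrightarrow> f x"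
      using lipschitz_upper_approximation[OF f b] by blast
    have "\<forall>\<^sub>F k in sequentially. (\<integral>\<omega>. g k (L \<omega>) \<partial>N) < (\<integral>\<omega>. f (L \<omega>) \<partial>N) + e"
      by (rule order_tendstoD(2)[OF conv[OF g(2-4) f]]) (use e in auto)
    then obtain k where k: "(\<integral>\<omega>. g k (L \<omega>) \<partial>N) < (\<integral>\<omega>. f (L \<omega>) \<partial>N) + e"
      by (auto simp: eventually_sequentially)
    have "\<forall>\<^sub>F n in sequentially. outer_expectation M (\<lambda>\<omega>. g k (Y n \<omega>)) < ereal ((\<integral>\<omega>. f (L \<omega>) \<partial>N) + e)"
      by (rule order_tendstoD(2)[OF lip'[OF g(2,3)]]) (use k in auto)
    then show "\<forall>\<^sub>F n in sequentially. outer_expectation M (\<lambda>\<omega>. f (Y n \<omega>)) \<le> ereal ((\<integral>\<omega>. f (L \<omega>) \<partial>N) + e)"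
    proof eventually_elim
      case (elim n)
      have "outer_expectation M (\<lambda>\<omega>. f (Y n \<omega>)) \<le> outer_expectation M (\<lambda>\<omega>. g k (Y n \<omega>))"
        by (rule outer_expectation_mono) (use Y g(1) in blast)
      then show ?case using elim by auto
    qed
    have nf: "continuous_map (mtopology_of m) euclideanreal (\<lambda>x. - f x)"
      using f by (rule continuous_map_minus)
    obtain g' :: "nat \<Rightarrow> 'd \<Rightarrow> real" where g': "\<And>k x. x \<in> mspace m \<Longrightarrow> - f x \<le> g' k x"
      "\<And>k x. x \<in> mspace m \<Longrightarrow> \<bar>g' k x\<bar> \<le> b"
      "\<And>k x y. x \<in> mspace m \<Longrightarrow> y \<in> mspace m \<Longrightarrow> \<bar>g' k x - g' k y\<bar> \<le> real k * mdist m x y"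
      "\<And>x. x \<in> mspace m \<Longrightarrow> (\<lambda>k. g' k x) \<longlonglongrightarrow> - f x"
      using lipschitz_upper_approximation[OF nf, of b] b by auto
    define l where "l k x = - g' k x" for k x
    have l: "\<And>k x. x \<in> mspace m \<Longrightarrow> l k x \<le> f x"
      "\<And>k x. x \<in> mspace m \<Longrightarrow> \<bar>l k x\<bar> \<le> b"
      "\<And>k x y. x \<in> mspace m \<Longrightarrow> y \<in> mspace m \<Longrightarrow> \<bar>l k x - l k y\<bar> \<le> real k * mdist m x y"
      "\<And>x. x \<in> mspace m \<Longrightarrow> (\<lambda>k. l k x) \<longlonglongrightarrow> f x"
      unfolding l_def using g' tendsto_minus[OF g'(4)]
      by (auto simp: minus_le_iff abs_minus_commute)
    have "\<forall>\<^sub>F k in sequentially. (\<integral>\<omega>. l k (L \<omega>) \<partial>N) > (\<integral>\<omega>. f (L \<omega>) \<partial>N) - e"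
      by (rule order_tendstoD(1)[OF conv[OF l(2-4) f]]) (use e in auto)
    then obtain k where k: "(\<integral>\<omega>. l k (L \<omega>) \<partial>N) > (\<integral>\<omega>. f (L \<omega>) \<partial>N) - e"
      by (auto simp: eventually_sequentially)
    have "\<forall>\<^sub>F n in sequentially. outer_expectation M (\<lambda>\<omega>. l k (Y n \<omega>)) > ereal ((\<integral>\<omega>. f (L \<omega>) \<partial>N) - e)"
      by (rule order_tendstoD(1)[OF lip'[OF l(2,3)]]) (use k in auto)
    then show "\<forall>\<^sub>F n in sequentially. ereal ((\<integral>\<omega>. f (L \<omega>) \<partial>N) - e) \<le> outer_expectation M (\<lambda>\<omega>. f (Y n \<omega>))"
    proof eventually_elim
      case (elim n)
      have "outer_expectation M (\<lambda>\<omega>. l k (Y n \<omega>)) \<le> outer_expectation M (\<lambda>\<omega>. f (Y n \<omega>))"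
        by (rule outer_expectation_mono) (use Y l(1) in blast)
      then show ?case using elim by auto
    qed
  qed
qed (use Y L in auto)

section \<open>Copulas with continuous partial derivatives\<close>

text \<open>The modulus of continuity at one scale, written as a bound instead of a supremum. The
  scale stays fixed because empirical paths jump, so the modulus does not tend to 0 for a fixed
  sample.\<close>

definition modulus_le :: "real \<Rightarrow> real \<Rightarrow> (real \<times> real \<Rightarrow> real) \<Rightarrow> bool" where
  "modulus_le \<delta> \<eta> a \<longleftrightarrow> (\<forall>x\<in>{0..1}. \<forall>y\<in>{0..1}. \<forall>x'\<in>{0..1}. \<forall>y'\<in>{0..1}.
     \<bar>x - x'\<bar> \<le> \<delta> \<and> \<bar>y - y'\<bar> \<le> \<delta> \<longrightarrow> \<bar>a (x, y) - a (x', y')\<bar> \<le> \<eta>)"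

lemma modulus_leD:
  "\<lbrakk>modulus_le \<delta> \<eta> a; x \<in> {0..1}; y \<in> {0..1}; x' \<in> {0..1}; y' \<in> {0..1};
    \<bar>x - x'\<bar> \<le> \<delta>; \<bar>y - y'\<bar> \<le> \<delta>\<rbrakk> \<Longrightarrow> \<bar>a (x, y) - a (x', y')\<bar> \<le> \<eta>"
  unfolding modulus_le_def by blast

text \<open>Walk from the edge \<open>x = 0\<close> in steps of length at most
  \<open>\<delta>\<close>: at most \<open>1 / \<delta> + 1\<close> steps, each costing
  \<open>\<eta>\<close>, on top of the initial \<open>\<eta>\<close>.\<close>

lemma modulus_le_bounded:
  assumes mod: "modulus_le \<delta> \<eta> a" and \<delta>: "0 < \<delta>" and \<eta>: "0 \<le> \<eta>" and zero: "\<And>y. y \<in> {0..1} \<Longrightarrow> \<bar>a (0, y)\<bar> \<le> \<eta>"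
    and xy: "x \<in> {0..1}" "y \<in> {0..1}"
  shows "\<bar>a (x, y)\<bar> \<le> (1 / \<delta> + 2) * \<eta>"
proof -
  have step: "\<forall>x\<in>{0..1}. x \<le> real k * \<delta> \<longrightarrow> \<bar>a (x, y)\<bar> \<le> (real k + 1) * \<eta>" for k
  proof (induction k)
    case 0
    then show ?case using zero[OF xy(2)] by (metis atLeastAtMost_iff dual_order.antisym mult_1 mult_zero_left of_nat_0 add_0)
  next
    case (Suc k)
    show ?case
    proof (intro ballI impI)
      fix x :: real assume x: "x \<in> {0..1}" "x \<le> real (Suc k) * \<delta>"
      define x' where "x' = max 0 (x - \<delta>)"
      have x': "x' \<in> {0..1}" "x' \<le> real k * \<delta>" "\<bar>x - x'\<bar> \<le> \<delta>"
        using x \<delta> by (auto simp: x'_def algebra_simps)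
      have "\<bar>a (x', y)\<bar> \<le> (real k + 1) * \<eta>" using Suc x' by blast
      moreover have "\<bar>a (x, y) - a (x', y)\<bar> \<le> \<eta>"
        using x x' xy \<delta> by (intro modulus_leD[OF mod]) auto
      moreover have "(real (Suc k) + 1) * \<eta> = (real k + 1) * \<eta> + \<eta>" by (simp add: algebra_simps)
      ultimately show "\<bar>a (x, y)\<bar> \<le> (real (Suc k) + 1) * \<eta>"
        by linarith
    qed
  qed
  define k where "k = nat \<lceil>1 / \<delta>\<rceil>"
  have k: "1 / \<delta> \<le> real k" "real k \<le> 1 / \<delta> + 1"
    using \<delta> by (auto simp: k_def of_nat_nat)
  have "x \<le> real k * \<delta>" using xy k(1) \<delta> by (simp add: field_simps)
  then have "\<bar>a (x, y)\<bar> \<le> (real k + 1) * \<eta>" using step xy by blast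
  also have "\<dots> \<le> (1 / \<delta> + 2) * \<eta>" using k(2) \<eta> by (intro mult_right_mono) auto
  finally show ?thesis .
qed

text \<open>\<open>p\<close> need not be continuous at \<open>u\<^sub>1 \<in> {0, 1}\<close>; there the factor \<open>r\<close> has to be small.\<close>

lemma oscillation_times_small:
  fixes p :: "real \<times> real \<Rightarrow> real"
  assumes cont: "continuous_on V1 p" and p01: "\<And>u. u \<in> unit_square \<Longrightarrow> p u \<in> {0..1}"
    and pos: "0 < \<delta>" "0 < \<eta>" "0 < K"
  obtains d where "0 < d"
    "\<And>x y x' y' r. \<lbrakk>x \<in> {0..1}; y \<in> {0..1}; x' \<in> {0..1}; y' \<in> {0..1}; \<bar>x - x'\<bar> \<le> d; \<bar>y - y'\<bar> \<le> d;
       \<bar>r\<bar> \<le> K; x \<le> \<delta> \<or> 1 - \<delta> \<le> x \<Longrightarrow> \<bar>r\<bar> \<le> \<eta>\<rbrakk> \<Longrightarrow> \<bar>(p (x, y) - p (x', y')) * r\<bar> \<le> \<eta>"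
proof -
  \<comment> \<open>The margin \<open>\<delta> / 2\<close> leaves room for the second point: if
    \<open>x\<close> is more than \<open>\<delta>\<close> away from 0 and 1, then \<open>x'\<close>
    still lies in the compact strip.\<close>
  define S :: "(real \<times> real) set" where "S = {\<delta>/2..1-\<delta>/2} \<times> {0..1}"
  have "compact S" unfolding S_def by (intro compact_Times compact_Icc)
  moreover have "S \<subseteq> V1" using pos by (auto simp: S_def V1_def)
  ultimately have "uniformly_continuous_on S p"
    using cont continuous_on_subset compact_uniformly_continuous by blast
  moreover have "\<eta> / K > 0" using pos by simp
  ultimately obtain d0 where d0: "d0 > 0"
    "\<And>u u'. u \<in> S \<Longrightarrow> u' \<in> S \<Longrightarrow> dist u' u < d0 \<Longrightarrow> dist (p u') (p u) < \<eta> / K"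
    unfolding uniformly_continuous_on_def by meson
  show thesis
  proof (rule that[of "min (\<delta>/2) (d0/3)"])
    show "0 < min (\<delta>/2) (d0/3)" using pos d0 by simp
    fix x y x' y' r :: real
    assume u: "x \<in> {0..1}" "y \<in> {0..1}" "x' \<in> {0..1}" "y' \<in> {0..1}"
      and d: "\<bar>x - x'\<bar> \<le> min (\<delta>/2) (d0/3)" "\<bar>y - y'\<bar> \<le> min (\<delta>/2) (d0/3)"
      and r: "\<bar>r\<bar> \<le> K" "x \<le> \<delta> \<or> 1 - \<delta> \<le> x \<Longrightarrow> \<bar>r\<bar> \<le> \<eta>"
    show "\<bar>(p (x, y) - p (x', y')) * r\<bar> \<le> \<eta>"
    proof (cases "x \<le> \<delta> \<or> 1 - \<delta> \<le> x")
      case True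
      have "\<bar>p (x, y) - p (x', y')\<bar> \<le> 1" using p01[of "(x,y)"] p01[of "(x',y')"] u by auto
      then have "\<bar>p (x, y) - p (x', y')\<bar> * \<bar>r\<bar> \<le> 1 * \<eta>"
        using r(2)[OF True] by (intro mult_mono) auto
      then show ?thesis by (simp add: abs_mult)
    next
      case False
      have "\<bar>x - x'\<bar> \<le> \<delta> / 2" using d by simp
      then have S: "(x, y) \<in> S" "(x', y') \<in> S" using False u pos unfolding S_def abs_le_iff by auto
      have "dist (x, y) (x', y') \<le> \<bar>x - x'\<bar> + \<bar>y - y'\<bar>"
        using sqrt_sum_squares_le_sum_abs[of "x - x'" "y - y'"] by (simp add: dist_Pair_Pair dist_real_def)
      also have "\<dots> < d0" using d d0 by auto
      finally have "\<bar>p (x, y) - p (x', y')\<bar> \<le> \<eta> / K"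
        using d0(2)[OF S(2,1)] by (auto simp: dist_real_def)
      then have "\<bar>p (x, y) - p (x', y')\<bar> * \<bar>r\<bar> \<le> \<eta> / K * K"
        using r(1) pos by (intro mult_mono) auto
      then show ?thesis using pos by (simp add: abs_mult)
    qed
  qed
qed

text \<open>Exchanging the coordinates turns every statement about the first partial derivative into
  one about the second, so the analytic arguments are made for the first only.\<close>

lemma copula_swap: "copula C \<Longrightarrow> copula (C \<circ> prod.swap)"
  unfolding copula_def comp_apply swap_simp
  apply (intro conjI)
   apply blast
  apply (intro allI impI)
  subgoal for u u' v v' by (drule conjunct2, drule spec[of _ v], drule spec[of _ v'], drule spec[of _ u], drule spec[of _ u']) linarith
  done

lemma partial1_swap: "partial1 (C \<circ> prod.swap) u = partial2 C (prod.swap u)"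
  and partial2_swap: "partial2 (C \<circ> prod.swap) u = partial1 C (prod.swap u)"
  by (simp_all add: partial1_def partial2_def)

lemma has_continuous_partials_swap:
  assumes "has_continuous_partials C"
  shows "has_continuous_partials (C \<circ> prod.swap)"
proof -
  have V: "prod.swap ` V1 = V2" "prod.swap ` V2 = V1"
    by (auto simp: V1_def V2_def image_iff)
  have eq: "partial1 (C \<circ> prod.swap) = partial2 C \<circ> prod.swap" "partial2 (C \<circ> prod.swap) = partial1 C \<circ> prod.swap"
    by (auto simp: partial1_swap partial2_swap)
  have "continuous_on V1 (partial1 (C \<circ> prod.swap))"
    unfolding eq using assms V
    by (intro continuous_on_compose continuous_on_swap) (auto simp: has_continuous_partials_def)
  moreover have "continuous_on V2 (partial2 (C \<circ> prod.swap))"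
    unfolding eq using assms V
    by (intro continuous_on_compose continuous_on_swap) (auto simp: has_continuous_partials_def)
  ultimately show ?thesis
    using assms unfolding has_continuous_partials_def V1_def V2_def by simp
qed

section \<open>Monotonicity, Lipschitz bounds and zero set of a copula\<close>

locale copula_fun =
  fixes C :: "real \<times> real \<Rightarrow> real"
  assumes copula: "copula C"
begin

lemma margins [simp]:
  assumes "u \<in> {0..1}"
  shows "C (u, 0) = 0" "C (0, u) = 0" "C (u, 1) = u" "C (1, u) = u"
  using copula assms unfolding copula_def by blast+

lemma rect_nonneg:
  "\<lbrakk>0 \<le> u; u \<le> u'; u' \<le> 1; 0 \<le> v; v \<le> v'; v' \<le> 1\<rbrakk> \<Longrightarrow> 0 \<le> C (u', v') - C (u, v') - C (u', v) + C (u, v)"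
  using copula unfolding copula_def by blast

text \<open>Rectangles that reach down to height 0 give monotonicity; those that reach up to height
  1 give the Lipschitz bound. The same is done below for the second coordinate.\<close>

lemma mono1: "\<lbrakk>0 \<le> u; u \<le> u'; u' \<le> 1; v \<in> {0..1}\<rbrakk> \<Longrightarrow> C (u, v) \<le> C (u', v)"
  using rect_nonneg[of u u' 0 v] by simp

lemma lip1: "\<lbrakk>0 \<le> u; u \<le> u'; u' \<le> 1; v \<in> {0..1}\<rbrakk> \<Longrightarrow> C (u', v) - C (u, v) \<le> u' - u"
  using rect_nonneg[of u u' v 1] by simp

lemma mono2: "\<lbrakk>0 \<le> v; v \<le> v'; v' \<le> 1; u \<in> {0..1}\<rbrakk> \<Longrightarrow> C (u, v) \<le> C (u, v')"
  using rect_nonneg[of 0 u v v'] by simp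

lemma lip2: "\<lbrakk>0 \<le> v; v \<le> v'; v' \<le> 1; u \<in> {0..1}\<rbrakk> \<Longrightarrow> C (u, v') - C (u, v) \<le> v' - v"
  using rect_nonneg[of u 1 v v'] by simp

lemma range01: "u \<in> {0..1} \<Longrightarrow> v \<in> {0..1} \<Longrightarrow> C (u, v) \<in> {0..1}"
  using mono1[of 0 u v] mono1[of u 1 v] by auto

lemma le_min: "u \<in> {0..1} \<Longrightarrow> v \<in> {0..1} \<Longrightarrow> C (u, v) \<le> u \<and> C (u, v) \<le> v"
  using mono1[of u 1 v] mono2[of v 1 u] by auto

lemma lipschitz1:
  assumes "u \<in> {0..1}" "u' \<in> {0..1}" "v \<in> {0..1}"
  shows "\<bar>C (u, v) - C (u', v)\<bar> \<le> \<bar>u - u'\<bar>"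
  using assms mono1[of u u' v] mono1[of u' u v] lip1[of u u' v] lip1[of u' u v] by (cases "u \<le> u'") auto

lemma lipschitz2:
  assumes "u \<in> {0..1}" "v \<in> {0..1}" "v' \<in> {0..1}"
  shows "\<bar>C (u, v) - C (u, v')\<bar> \<le> \<bar>v - v'\<bar>"
  using assms mono2[of v v' u] mono2[of v' v u] lip2[of v v' u] lip2[of v' v u] by (cases "v \<le> v'") auto

lemma lipschitz:
  assumes "u \<in> {0..1}" "u' \<in> {0..1}" "v \<in> {0..1}" "v' \<in> {0..1}"
  shows "\<bar>C (u, v) - C (u', v')\<bar> \<le> \<bar>u - u'\<bar> + \<bar>v - v'\<bar>"
  using lipschitz1[of u u' v] lipschitz2[of u' v v'] assms by auto

lemma continuous: "continuous_on unit_square C"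
proof -
  have "2-lipschitz_on unit_square C"
  proof (rule lipschitz_onI)
    fix u v assume "u \<in> unit_square" "v \<in> unit_square"
    then have "\<bar>C u - C v\<bar> \<le> dist (fst u) (fst v) + dist (snd u) (snd v)"
      using lipschitz[of "fst u" "fst v" "snd u" "snd v"] by (auto simp: dist_real_def)
    also have "\<dots> \<le> 2 * dist u v" using dist_fst_le[of u v] dist_snd_le[of u v] by simp
    finally show "dist (C u) (C v) \<le> 2 * dist u v" by (simp add: dist_real_def)
  qed simp
  then show ?thesis by (rule lipschitz_on_continuous_on)
qed

text \<open>Compactness: on the set of points at distance at least \<open>\<delta>\<close> from the
  zero set, the continuous function \<open>C\<close> has a positive minimum.\<close>

lemma near_zero_set:
  assumes "\<delta> > 0"
  obtains \<kappa> where "\<kappa> > 0" "\<And>x y. \<lbrakk>x \<in> {0..1}; y \<in> {0..1}; C (x, y) \<le> \<kappa>\<rbrakk> \<Longrightarrow>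
    \<exists>x'\<in>{0..1}. \<exists>y'\<in>{0..1}. C (x', y') = 0 \<and> \<bar>x - x'\<bar> \<le> \<delta> \<and> \<bar>y - y'\<bar> \<le> \<delta>"
proof -
  define Z where "Z = {q \<in> unit_square. C q = 0}"
  have Z0: "(0, 0) \<in> Z" by (simp add: Z_def)
  have clos: "closed Z" unfolding Z_def
    using continuous_closed_preimage_constant[OF continuous] by (simp add: closed_Times)
  have near: "\<exists>x'\<in>{0..1}. \<exists>y'\<in>{0..1}. C (x', y') = 0 \<and> \<bar>x - x'\<bar> \<le> \<delta> \<and> \<bar>y - y'\<bar> \<le> \<delta>"
    if "infdist (x, y) Z < \<delta>" for x y
  proof -
    obtain q where q: "q \<in> Z" "infdist (x, y) Z = dist (x, y) q"
      using infdist_attains_inf[OF clos] Z0 by blast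
    obtain x' y' where [simp]: "q = (x', y')" by (cases q)
    have "\<bar>x - x'\<bar> \<le> \<delta>" "\<bar>y - y'\<bar> \<le> \<delta>"
      using that q(2) dist_fst_le[of "(x,y)" q] dist_snd_le[of "(x,y)" q] by (simp_all add: dist_real_def)
    then show ?thesis using q(1) unfolding Z_def by (intro bexI[of _ x'] bexI[of _ y']) auto
  qed
  define S where "S = unit_square \<inter> {u. \<delta> \<le> infdist u Z}"
  have compS: "compact S" unfolding S_def
    by (intro compact_Int_closed compact_Times compact_Icc closed_Collect_le continuous_intros)
  show thesis
  proof (cases "S = {}")
    case True
    show ?thesis
    proof (rule that[of 1])
      fix x y :: real assume "x \<in> {0..1}" "y \<in> {0..1}"
      then have "infdist (x, y) Z < \<delta>" using True unfolding S_def by (intro not_le_imp_less notI) blast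
      then show "\<exists>x'\<in>{0..1}. \<exists>y'\<in>{0..1}. C (x', y') = 0 \<and> \<bar>x - x'\<bar> \<le> \<delta> \<and> \<bar>y - y'\<bar> \<le> \<delta>"
        by (rule near)
    qed simp
  next
    case False
    obtain u0 where u0: "u0 \<in> S" "\<And>u. u \<in> S \<Longrightarrow> C u0 \<le> C u"
      using continuous_attains_inf[OF compS False continuous_on_subset[OF continuous]] S_def by blast
    have "C u0 \<noteq> 0" using u0(1) assms by (auto simp: S_def Z_def)
    then have pos: "C u0 > 0" using u0(1) range01[of "fst u0" "snd u0"] by (auto simp: S_def)
    show ?thesis
    \<comment> \<open>Half the minimum, so that even \<open>C (x, y) = \<kappa>\<close> excludes
      \<open>S\<close>.\<close>
    proof (rule that[of "C u0 / 2"])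
      fix x y :: real assume xy: "x \<in> {0..1}" "y \<in> {0..1}" "C (x, y) \<le> C u0 / 2"
      then have "(x, y) \<notin> S" using u0(2)[of "(x, y)"] pos by auto
      then show "\<exists>x'\<in>{0..1}. \<exists>y'\<in>{0..1}. C (x', y') = 0 \<and> \<bar>x - x'\<bar> \<le> \<delta> \<and> \<bar>y - y'\<bar> \<le> \<delta>"
        using xy by (intro near) (auto simp: S_def)
    qed (use pos in simp)
  qed
qed

end

section \<open>Partial derivatives of a copula\<close>

locale smooth_copula = copula_fun +
  assumes smooth: "has_continuous_partials C"
begin

lemma has_partial1:
  assumes "0 < x" "x < 1" "y \<in> {0..1}"
  shows "((\<lambda>s. C (s, y)) has_real_derivative partial1 C (x, y)) (at x)"
proof -
  have "(x, y) \<in> V1" using assms by (auto simp: V1_def)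
  then have "(\<lambda>s. C (s, y)) field_differentiable (at x)"
    using smooth unfolding has_continuous_partials_def by force
  then show ?thesis using assms by (simp add: partial1_def field_differentiable_derivI)
qed

text \<open>Difference quotients lie in \<open>{0..1}\<close> by monotonicity and the Lipschitz
  bound; on the two excluded edges the value is the default 0. Hence products with a derivative
  never enlarge an error, wherever they are taken.\<close>

lemma partial1_range:
  assumes "u \<in> unit_square"
  shows "partial1 C u \<in> {0..1}"
proof -
  obtain x y where u: "u = (x, y)" "x \<in> {0..1}" "y \<in> {0..1}" using assms by (cases u) auto
  show ?thesis
  proof (cases "0 < x \<and> x < 1")
    case True
    have d: "((\<lambda>s. (C (s, y) - C (x, y)) / (s - x)) \<longlongrightarrow> partial1 C (x, y)) (at x)"
      using has_partial1[of x y] True u by (simp add: has_field_derivative_iff)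
    have "\<forall>\<^sub>F s in at x. s \<in> {0<..<1}"
      using True by (intro eventually_at_in_open') auto
    moreover have "\<forall>\<^sub>F s in at x. s \<noteq> x" by (simp add: eventually_at_filter)
    ultimately have ev: "\<forall>\<^sub>F s in at x. 0 \<le> (C (s, y) - C (x, y)) / (s - x) \<and> (C (s, y) - C (x, y)) / (s - x) \<le> 1"
    proof eventually_elim
      case (elim s)
      show ?case
      proof (cases "x < s")
        case True
        then show ?thesis using mono1[of x s y] lip1[of x s y] u elim
          by (simp add: pos_le_divide_eq pos_divide_le_eq)
      next
        case False
        then have "s < x" using elim by simp
        then show ?thesis using mono1[of s x y] lip1[of s x y] u elim
          by (simp add: neg_le_divide_eq neg_divide_le_eq)
      qed
    qed
    have "0 \<le> partial1 C (x, y)"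
      by (rule tendsto_lowerbound[OF d]) (use ev in \<open>auto elim: eventually_mono\<close>)
    moreover have "partial1 C (x, y) \<le> 1"
      by (rule tendsto_upperbound[OF d]) (use ev in \<open>auto elim: eventually_mono\<close>)
    ultimately show ?thesis using u by simp
  next
    case False
    then show ?thesis by (auto simp: u partial1_def)
  qed
qed

lemma partial1_continuous: "continuous_on V1 (partial1 C)"
  using smooth by (simp add: has_continuous_partials_def)

text \<open>The mean value theorem needs the derivative only strictly between the end points, so
  these may be 0 or 1. The bound on \<open>t\<close> covers both orders of \<open>a\<close> and
  \<open>b\<close>.\<close>

lemma mvt1:
  assumes "a \<in> {0..1}" "b \<in> {0..1}" "y \<in> {0..1}"
  obtains t where "t \<in> {0..1}" "\<bar>t - a\<bar> \<le> \<bar>b - a\<bar>" "C (b, y) - C (a, y) = partial1 C (t, y) * (b - a)"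
proof -
  have cont: "continuous_on {c..d} (\<lambda>s. C (s, y))" if "0 \<le> c" "d \<le> 1" for c d
    using assms(3) that by (intro continuous_on_compose2[OF continuous] continuous_intros) force+
  have *: "\<exists>t. c < t \<and> t < d \<and> C (d, y) - C (c, y) = partial1 C (t, y) * (d - c)" if cd: "0 \<le> c" "c < d" "d \<le> 1" for c d
  proof -
    obtain l z where z: "c < z" "z < d" "((\<lambda>s. C (s, y)) has_real_derivative l) (at z)" "C (d, y) - C (c, y) = (d - c) * l"
      using MVT[OF cd(2) cont[OF cd(1,3)]] has_partial1[OF _ _ assms(3)] cd
      by (meson order.strict_trans1 order.strict_trans2 real_differentiable_def)
    have "l = partial1 C (z, y)" using DERIV_unique[OF z(3) has_partial1] z cd assms(3) by auto
    then show ?thesis using z by (auto simp: mult.commute)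
  qed
  consider "a = b" | "a < b" | "b < a" by linarith
  then show thesis
  proof cases
    case 1
    then show ?thesis using that[of a] assms by auto
  next
    case 2
    then obtain t where "a < t" "t < b" "C (b, y) - C (a, y) = partial1 C (t, y) * (b - a)"
      using *[of a b] assms by auto
    then show ?thesis using that[of t] assms by auto
  next
    case 3
    then obtain t where "b < t" "t < a" "C (a, y) - C (b, y) = partial1 C (t, y) * (a - b)"
      using *[of b a] assms by auto
    then show ?thesis using that[of t] assms by (auto simp: algebra_simps)
  qed
qed

text \<open>As \<open>C\<close> is nonnegative, a zero is a minimum, and \<open>0 < x < 1\<close>
  makes it an interior one along the first coordinate.\<close>

lemma partial1_zero:
  assumes "0 < x" "x < 1" "y \<in> {0..1}" "C (x, y) = 0"
  shows "partial1 C (x, y) = 0"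
proof (rule DERIV_local_min[OF has_partial1[OF assms(1-3)]])
  show "0 < min x (1 - x)" using assms by simp
  show "\<forall>s. \<bar>x - s\<bar> < min x (1 - x) \<longrightarrow> C (x, y) \<le> C (s, y)"
  proof (intro allI impI)
    fix s assume "\<bar>x - s\<bar> < min x (1 - x)"
    then have "s \<in> {0..1}" by (auto simp: abs_less_iff)
    then show "C (x, y) \<le> C (s, y)" using range01[of s y] assms by simp
  qed
qed

text \<open>The quantitative form of \<open>partial1_zero\<close>: the part of the strip where the
  derivative is at least \<open>\<theta>\<close> is compact and misses the zero set, so
  \<open>C\<close> is bounded below there.\<close>

lemma partial1_small:
  assumes "0 < \<delta>" "0 < \<theta>"
  obtains \<kappa> where "\<kappa> > 0"
    "\<And>x y. \<lbrakk>\<delta> \<le> x; x \<le> 1 - \<delta>; y \<in> {0..1}; C (x, y) \<le> \<kappa>\<rbrakk> \<Longrightarrow> partial1 C (x, y) \<le> \<theta>"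
proof -
  define S where "S = {\<delta>..1-\<delta>} \<times> {0..1::real}"
  define S' where "S' = {u \<in> S. partial1 C u \<in> {\<theta>..}}"
  have SV: "S \<subseteq> V1" and Ssq: "S \<subseteq> unit_square" using assms by (auto simp: S_def V1_def)
  have compS: "compact S" unfolding S_def by (intro compact_Times compact_Icc)
  have "closed (S \<inter> partial1 C -` {\<theta>..})"
    by (intro continuous_closed_preimage continuous_on_subset[OF partial1_continuous SV] compact_imp_closed[OF compS] closed_atLeast)
  moreover have "S' = S \<inter> (S \<inter> partial1 C -` {\<theta>..})" by (auto simp: S'_def)
  ultimately have comp: "compact S'" using compact_Int_closed[OF compS] by metis
  show thesis
  proof (cases "S' = {}")
    case True
    show ?thesis
    proof (rule that[of 1])
      fix x y :: real assume "\<delta> \<le> x" "x \<le> 1 - \<delta>" "y \<in> {0..1}"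
      then have "(x, y) \<in> S" by (simp add: S_def)
      then have "partial1 C (x, y) \<notin> {\<theta>..}" using True unfolding S'_def by blast
      then show "partial1 C (x, y) \<le> \<theta>" by simp
    qed simp
  next
    case False
    have S'sq: "S' \<subseteq> unit_square" using Ssq S'_def by blast
    obtain u0 where u0: "u0 \<in> S'" "\<And>u. u \<in> S' \<Longrightarrow> C u0 \<le> C u"
      using continuous_attains_inf[OF comp False continuous_on_subset[OF continuous S'sq]] by blast
    obtain x0 y0 where xy0: "u0 = (x0, y0)" by force
    have "C u0 \<noteq> 0"
      using partial1_zero[of x0 y0] u0(1) assms xy0 by (auto simp: S'_def S_def)
    then have pos: "C u0 > 0" using u0(1) Ssq xy0 range01[of x0 y0] by (auto simp: S'_def)
    show ?thesis
    proof (rule that[of "C u0 / 2"])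
      fix x y :: real assume xy: "\<delta> \<le> x" "x \<le> 1 - \<delta>" "y \<in> {0..1}" "C (x, y) \<le> C u0 / 2"
      then have "(x, y) \<notin> S'" using u0(2)[of "(x, y)"] pos by auto
      then show "partial1 C (x, y) \<le> \<theta>" using xy by (auto simp: S'_def S_def)
    qed (use pos in simp)
  qed
qed

lemma swapped: "smooth_copula (C \<circ> prod.swap)"
  using copula smooth by unfold_locales (auto intro: copula_swap has_continuous_partials_swap)

lemma partial2_range:
  assumes "u \<in> unit_square"
  shows "partial2 C u \<in> {0..1}"
  using smooth_copula.partial1_range[OF swapped, of "prod.swap u"] assms by (auto simp: partial1_swap)

lemma mvt2:
  assumes "a \<in> {0..1}" "b \<in> {0..1}" "x \<in> {0..1}"
  obtains t where "t \<in> {0..1}" "\<bar>t - a\<bar> \<le> \<bar>b - a\<bar>" "C (x, b) - C (x, a) = partial2 C (x, t) * (b - a)"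
proof -
  obtain t where "t \<in> {0..1}" "\<bar>t - a\<bar> \<le> \<bar>b - a\<bar>" "C (x, b) - C (x, a) = partial2 C (x, t) * (b - a)"
    using smooth_copula.mvt1[OF swapped assms] by (auto simp: partial1_swap)
  then show thesis by (rule that)
qed

lemma partial2_small:
  assumes "0 < \<delta>" "0 < \<theta>"
  obtains \<kappa> where "\<kappa> > 0"
    "\<And>x y. \<lbrakk>\<delta> \<le> y; y \<le> 1 - \<delta>; x \<in> {0..1}; C (x, y) \<le> \<kappa>\<rbrakk> \<Longrightarrow> partial2 C (x, y) \<le> \<theta>"
proof -
  obtain \<kappa> where \<kappa>: "\<kappa> > 0"
    "\<And>x y. \<lbrakk>\<delta> \<le> x; x \<le> 1 - \<delta>; y \<in> {0..1}; C (y, x) \<le> \<kappa>\<rbrakk> \<Longrightarrow> partial2 C (y, x) \<le> \<theta>"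
    using smooth_copula.partial1_small[OF swapped assms] by (auto simp: partial1_swap)
  show thesis by (rule that[OF \<kappa>(1)]) (rule \<kappa>(2); assumption)
qed

lemma oscillation1:
  assumes "0 < \<delta>" "0 < \<eta>" "0 < K"
  obtains d where "0 < d"
    "\<And>x y x' y' r. \<lbrakk>x \<in> {0..1}; y \<in> {0..1}; x' \<in> {0..1}; y' \<in> {0..1}; \<bar>x - x'\<bar> \<le> d; \<bar>y - y'\<bar> \<le> d;
       \<bar>r\<bar> \<le> K; x \<le> \<delta> \<or> 1 - \<delta> \<le> x \<Longrightarrow> \<bar>r\<bar> \<le> \<eta>\<rbrakk> \<Longrightarrow> \<bar>(partial1 C (x, y) - partial1 C (x', y')) * r\<bar> \<le> \<eta>"
proof (rule oscillation_times_small[OF partial1_continuous partial1_range assms])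
  fix d assume "0 < d"
    "\<And>x y x' y' r. \<lbrakk>x \<in> {0..1}; y \<in> {0..1}; x' \<in> {0..1}; y' \<in> {0..1}; \<bar>x - x'\<bar> \<le> d; \<bar>y - y'\<bar> \<le> d;
       \<bar>r\<bar> \<le> K; x \<le> \<delta> \<or> 1 - \<delta> \<le> x \<Longrightarrow> \<bar>r\<bar> \<le> \<eta>\<rbrakk> \<Longrightarrow> \<bar>(partial1 C (x, y) - partial1 C (x', y')) * r\<bar> \<le> \<eta>"
  then show thesis by (rule that)
qed

lemma oscillation2:
  assumes "0 < \<delta>" "0 < \<eta>" "0 < K"
  obtains d where "0 < d"
    "\<And>x y x' y' r. \<lbrakk>x \<in> {0..1}; y \<in> {0..1}; x' \<in> {0..1}; y' \<in> {0..1}; \<bar>x - x'\<bar> \<le> d; \<bar>y - y'\<bar> \<le> d;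
       \<bar>r\<bar> \<le> K; y \<le> \<delta> \<or> 1 - \<delta> \<le> y \<Longrightarrow> \<bar>r\<bar> \<le> \<eta>\<rbrakk> \<Longrightarrow> \<bar>(partial2 C (x, y) - partial2 C (x', y')) * r\<bar> \<le> \<eta>"
proof (rule smooth_copula.oscillation1[OF swapped assms, unfolded partial1_swap swap_simp])
  fix d assume d: "0 < d"
    "\<And>x y x' y' r. \<lbrakk>x \<in> {0..1}; y \<in> {0..1}; x' \<in> {0..1}; y' \<in> {0..1}; \<bar>x - x'\<bar> \<le> d; \<bar>y - y'\<bar> \<le> d;
       \<bar>r\<bar> \<le> K; x \<le> \<delta> \<or> 1 - \<delta> \<le> x \<Longrightarrow> \<bar>r\<bar> \<le> \<eta>\<rbrakk> \<Longrightarrow> \<bar>(partial2 C (y, x) - partial2 C (y', x')) * r\<bar> \<le> \<eta>"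
  show thesis by (rule that[OF d(1)]) (rule d(2); assumption)
qed

end

section \<open>Deterministic expansion of the empirical copula and of the associativity
  process\<close>

context smooth_copula
begin

text \<open>Properties that the empirical process has with high probability, with constants
  independent of \<open>n\<close>; thresholds derived from them are therefore uniform over paths. On
  the zero set of \<open>C\<close> only smallness is required: vanishing is known almost surely on a
  countable dense subset, and the modulus carries it over.\<close>

definition regular_path :: "real \<Rightarrow> real \<Rightarrow> real \<Rightarrow> (real \<times> real \<Rightarrow> real) \<Rightarrow> bool" where
  "regular_path \<delta> \<eta> K a \<longleftrightarrow> modulus_le \<delta> \<eta> a \<and> (\<forall>x\<in>{0..1}. \<forall>y\<in>{0..1}. \<bar>a (x, y)\<bar> \<le> K) \<and>
     (\<forall>x\<in>{0..1}. \<forall>y\<in>{0..1}. C (x, y) = 0 \<longrightarrow> \<bar>a (x, y)\<bar> \<le> \<eta>) \<and> a (0, 1) = 0 \<and> a (1, 0) = 0 \<and> a (1, 1) = 0"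

text \<open>Here \<open>c\<close> plays the empirical copula, \<open>a\<close> the empirical process with known margins, \<open>R = sqrt n\<close>,
  and \<open>v\<close> the image of the pair of empirical quantiles at \<open>u\<close> under the true margins.\<close>

definition empirical_approx :: "real \<Rightarrow> real \<Rightarrow> (real \<times> real \<Rightarrow> real) \<Rightarrow> (real \<times> real \<Rightarrow> real) \<Rightarrow> bool" where
  "empirical_approx R \<eta> a c \<longleftrightarrow> (\<forall>x\<in>{0..1}. \<forall>y\<in>{0..1}. c (x, y) \<in> {0..1} \<and> (x = 0 \<or> y = 0 \<longrightarrow> c (x, y) = 0) \<and>
     (0 < x \<and> 0 < y \<longrightarrow> (\<exists>v\<in>{0..1}. \<exists>w\<in>{0..1}. \<bar>R * (v - x) + a (v, 1)\<bar> \<le> \<eta> \<and>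
       \<bar>R * (w - y) + a (1, w)\<bar> \<le> \<eta> \<and> \<bar>R * (c (x, y) - C (v, w)) - a (v, w)\<bar> \<le> \<eta>)))"

lemma regular_pathD:
  assumes "regular_path \<delta> \<eta> K a"
  shows "modulus_le \<delta> \<eta> a"
    "\<And>x y. x \<in> {0..1} \<Longrightarrow> y \<in> {0..1} \<Longrightarrow> \<bar>a (x, y)\<bar> \<le> K"
    "\<And>x y. x \<in> {0..1} \<Longrightarrow> y \<in> {0..1} \<Longrightarrow> C (x, y) = 0 \<Longrightarrow> \<bar>a (x, y)\<bar> \<le> \<eta>"
    "a (0, 1) = 0" "a (1, 0) = 0" "a (1, 1) = 0"
  using assms unfolding regular_path_def by blast+

text \<open>Comparison with the exact zeros at \<open>(0, 1)\<close> and \<open>(1, 1)\<close>. This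
  is the smallness that \<open>oscillation1\<close> requires of its factor \<open>r\<close>.\<close>

lemma regular_path_edge1:
  assumes "regular_path \<delta> \<eta> K a" "x \<in> {0..1}" "x \<le> \<delta> \<or> 1 - \<delta> \<le> x"
  shows "\<bar>a (x, 1)\<bar> \<le> \<eta>"
proof -
  note r = regular_pathD[OF assms(1)]
  show ?thesis
  proof (cases "x \<le> \<delta>")
    case True
    then have "\<bar>a (x, 1) - a (0, 1)\<bar> \<le> \<eta>" using assms by (intro modulus_leD[OF r(1)]) auto
    then show ?thesis using r by simp
  next
    case False
    then have "\<bar>a (x, 1) - a (1, 1)\<bar> \<le> \<eta>" using assms by (intro modulus_leD[OF r(1)]) auto
    then show ?thesis using r by simp
  qed
qed

lemma regular_path_edge2:
  assumes "regular_path \<delta> \<eta> K a" "y \<in> {0..1}" "y \<le> \<delta> \<or> 1 - \<delta> \<le> y"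
  shows "\<bar>a (1, y)\<bar> \<le> \<eta>"
proof -
  note r = regular_pathD[OF assms(1)]
  show ?thesis
  proof (cases "y \<le> \<delta>")
    case True
    then have "\<bar>a (1, y) - a (1, 0)\<bar> \<le> \<eta>" using assms by (intro modulus_leD[OF r(1)]) auto
    then show ?thesis using r by simp
  next
    case False
    then have "\<bar>a (1, y) - a (1, 1)\<bar> \<le> \<eta>" using assms by (intro modulus_leD[OF r(1)]) auto
    then show ?thesis using r by simp
  qed
qed

lemma mult_partial_le:
  "u \<in> unit_square \<Longrightarrow> \<bar>partial1 C u * r\<bar> \<le> \<bar>r\<bar>"
  "u \<in> unit_square \<Longrightarrow> \<bar>partial2 C u * r\<bar> \<le> \<bar>r\<bar>"
  using partial1_range[of u] partial2_range[of u] by (auto simp: abs_mult intro!: mult_left_le_one_le)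

text \<open>Read \<open>b = a (v, 1)\<close>, \<open>r = a (x, 1)\<close>, \<open>p'\<close> as the
  derivative at the mean value point and \<open>p\<close> as the one at the target. The three errors
  are those of the quantile equation, of moving from \<open>v\<close> to \<open>x\<close>, and of
  the derivative's oscillation.\<close>

lemma quantile_term_bound:
  fixes R v x b r p p' \<eta> :: real
  assumes "\<bar>R * (v - x) + b\<bar> \<le> \<eta>" "\<bar>b - r\<bar> \<le> \<eta>" "p' \<in> {0..1}" "\<bar>(p - p') * r\<bar> \<le> \<eta>"
  shows "\<bar>R * (p' * (v - x)) + p * r\<bar> \<le> 3 * \<eta>"
proof -
  have "\<bar>R * (v - x) + r\<bar> \<le> 2 * \<eta>" using assms(1,2) by linarith
  then have "\<bar>p' * (R * (v - x) + r)\<bar> \<le> 2 * \<eta>"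
    using assms(3) mult_left_le_one_le[of "\<bar>R * (v - x) + r\<bar>" p'] by (auto simp: abs_mult)
  moreover have "R * (p' * (v - x)) + p * r = p' * (R * (v - x) + r) + (p - p') * r"
    by (simp add: algebra_simps)
  ultimately show ?thesis using assms(4) by linarith
qed

text \<open>The quantile equation says that \<open>R * (v - x)\<close> is close to
  \<open>- a (v, 1)\<close>, so moving \<open>C\<close> from \<open>(v, w)\<close> back to
  \<open>(x, y)\<close> along the two axes produces the derivative terms of \<open>G_path\<close>.
  Of the \<open>8 * \<eta>\<close>, one comes from \<open>c\<close>, one from the modulus of
  \<open>a\<close> and three from each axis.\<close>

lemma empirical_copula_expansion:
  assumes pos: "0 < \<delta>" "0 < \<eta>" "0 < K"
  obtains R0 where "0 < R0"
    "\<And>R a c x y. \<lbrakk>R0 \<le> R; regular_path \<delta> \<eta> K a; empirical_approx R \<eta> a c; x \<in> {0..1}; y \<in> {0..1}\<rbrakk> \<Longrightarrow>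
       \<bar>R * (c (x, y) - C (x, y)) - G_path C a (x, y)\<bar> \<le> 8 * \<eta>"
proof (rule oscillation1[OF pos])
  fix d1 assume d1: "0 < d1"
    "\<And>x y x' y' r. \<lbrakk>x \<in> {0..1}; y \<in> {0..1}; x' \<in> {0..1}; y' \<in> {0..1}; \<bar>x - x'\<bar> \<le> d1; \<bar>y - y'\<bar> \<le> d1;
       \<bar>r\<bar> \<le> K; x \<le> \<delta> \<or> 1 - \<delta> \<le> x \<Longrightarrow> \<bar>r\<bar> \<le> \<eta>\<rbrakk> \<Longrightarrow> \<bar>(partial1 C (x, y) - partial1 C (x', y')) * r\<bar> \<le> \<eta>"
  show thesis
  proof (rule oscillation2[OF pos])
    fix d2 assume d2: "0 < d2"
      "\<And>x y x' y' r. \<lbrakk>x \<in> {0..1}; y \<in> {0..1}; x' \<in> {0..1}; y' \<in> {0..1}; \<bar>x - x'\<bar> \<le> d2; \<bar>y - y'\<bar> \<le> d2;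
         \<bar>r\<bar> \<le> K; y \<le> \<delta> \<or> 1 - \<delta> \<le> y \<Longrightarrow> \<bar>r\<bar> \<le> \<eta>\<rbrakk> \<Longrightarrow> \<bar>(partial2 C (x, y) - partial2 C (x', y')) * r\<bar> \<le> \<eta>"
    define d where "d = min \<delta> (min d1 d2)"
    have d: "0 < d" "d \<le> \<delta>" "d \<le> d1" "d \<le> d2" using pos d1(1) d2(1) by (auto simp: d_def)
    show thesis
    \<comment> \<open>The quantile equation bounds \<open>R * \<bar>v - x\<bar>\<close> by
      \<open>K + \<eta>\<close>; this threshold turns that into a distance of at most
      \<open>d\<close>.\<close>
    proof (rule that[of "(K + \<eta>) / d"])
      show "0 < (K + \<eta>) / d" using pos d by simp
      fix R a c and x y :: real
      assume R: "(K + \<eta>) / d \<le> R" and reg: "regular_path \<delta> \<eta> K a" and emp: "empirical_approx R \<eta> a c"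
        and xy: "x \<in> {0..1}" "y \<in> {0..1}"
      note r = regular_pathD[OF reg]
      have R0: "R > 0" using less_le_trans[OF _ R, of 0] pos d(1) by (simp add: divide_pos_pos)
      show "\<bar>R * (c (x, y) - C (x, y)) - G_path C a (x, y)\<bar> \<le> 8 * \<eta>"
      proof (cases "x = 0 \<or> y = 0")
        case True
        have "c (x, y) = 0" using emp True xy unfolding empirical_approx_def by blast
        have C0: "C (x, y) = 0" using True xy by auto
        have "\<bar>a (x, y)\<bar> \<le> \<eta>" using r(3)[OF xy C0] .
        \<comment> \<open>Either \<open>0 < x < 1\<close>, and the derivative vanishes at a zero of
          \<open>C\<close>, or the derivative has its default value 0.\<close>
        have "partial1 C (x, y) * a (x, 1) = 0"
        proof (cases "0 < x \<and> x < 1")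
          case True
          then show ?thesis using partial1_zero[of x y] xy C0 by simp
        qed (auto simp: partial1_def)
        moreover have "partial2 C (x, y) * a (1, y) = 0"
        proof (cases "0 < y \<and> y < 1")
          case True
          then show ?thesis using smooth_copula.partial1_zero[OF swapped, of y x] xy C0 by (simp add: partial1_swap)
        qed (auto simp: partial2_def)
        ultimately have "G_path C a (x, y) = a (x, y)"
          by (simp only: G_path_def fst_conv snd_conv diff_zero)
        with \<open>c (x, y) = 0\<close> C0 \<open>\<bar>a (x, y)\<bar> \<le> \<eta>\<close> show ?thesis using pos by simp
      next
        case False
        then have "0 < x" "0 < y" using xy by auto
        then obtain v w where vw: "v \<in> {0..1}" "w \<in> {0..1}" "\<bar>R * (v - x) + a (v, 1)\<bar> \<le> \<eta>"
          "\<bar>R * (w - y) + a (1, w)\<bar> \<le> \<eta>" "\<bar>R * (c (x, y) - C (v, w)) - a (v, w)\<bar> \<le> \<eta>"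
          using emp xy unfolding empirical_approx_def by blast
        have close: "\<bar>s\<bar> \<le> d" if "\<bar>R * s + b\<bar> \<le> \<eta>" "\<bar>b\<bar> \<le> K" for s b
        proof -
          have "R * \<bar>s\<bar> = \<bar>R * s\<bar>" using R0 by (simp add: abs_mult)
          also have "\<dots> \<le> K + \<eta>" using that by linarith
          also have "\<dots> \<le> R * d" using R d(1) by (simp add: field_simps)
          finally show ?thesis using R0 by simp
        qed
        have vx: "\<bar>v - x\<bar> \<le> d" by (rule close[OF vw(3)]) (use r(2) vw in auto)
        have wy: "\<bar>w - y\<bar> \<le> d" by (rule close[OF vw(4)]) (use r(2) vw in auto)
        obtain s where s: "s \<in> {0..1}" "\<bar>s - x\<bar> \<le> \<bar>v - x\<bar>" "C (v, w) - C (x, w) = partial1 C (s, w) * (v - x)"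
          using mvt1[OF xy(1) vw(1,2)] by blast
        obtain t where t: "t \<in> {0..1}" "\<bar>t - y\<bar> \<le> \<bar>w - y\<bar>" "C (x, w) - C (x, y) = partial2 C (x, t) * (w - y)"
          using mvt2[OF xy(2) vw(2) xy(1)] by blast
        have 1: "\<bar>R * (partial1 C (s, w) * (v - x)) + partial1 C (x, y) * a (x, 1)\<bar> \<le> 3 * \<eta>"
        proof (rule quantile_term_bound[OF vw(3)])
          show "\<bar>a (v, 1) - a (x, 1)\<bar> \<le> \<eta>"
            using vw(1) xy vx d(2) pos by (intro modulus_leD[OF r(1)]) auto
          show "partial1 C (s, w) \<in> {0..1}" using s(1) vw(2) by (intro partial1_range) simp
          show "\<bar>(partial1 C (x, y) - partial1 C (s, w)) * a (x, 1)\<bar> \<le> \<eta>"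
          proof (rule d1(2)[OF xy s(1) vw(2)])
            show "\<bar>x - s\<bar> \<le> d1" "\<bar>y - w\<bar> \<le> d1" using s(2) vx wy d by (simp_all add: abs_minus_commute)
            show "\<bar>a (x, 1)\<bar> \<le> K" using r(2)[OF xy(1)] by simp
          qed (rule regular_path_edge1[OF reg xy(1)])
        qed
        have 2: "\<bar>R * (partial2 C (x, t) * (w - y)) + partial2 C (x, y) * a (1, y)\<bar> \<le> 3 * \<eta>"
        proof (rule quantile_term_bound[OF vw(4)])
          show "\<bar>a (1, w) - a (1, y)\<bar> \<le> \<eta>"
            using vw(2) xy wy d(2) pos by (intro modulus_leD[OF r(1)]) auto
          show "partial2 C (x, t) \<in> {0..1}" using t(1) xy(1) by (intro partial2_range) simp
          show "\<bar>(partial2 C (x, y) - partial2 C (x, t)) * a (1, y)\<bar> \<le> \<eta>"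
          proof (rule d2(2)[OF xy xy(1) t(1)])
            show "\<bar>x - x\<bar> \<le> d2" "\<bar>y - t\<bar> \<le> d2" using t(2) wy d by (simp_all add: abs_minus_commute)
            show "\<bar>a (1, y)\<bar> \<le> K" using r(2)[OF _ xy(2)] by simp
          qed (rule regular_path_edge2[OF reg xy(2)])
        qed
        have 3: "\<bar>a (v, w) - a (x, y)\<bar> \<le> \<eta>"
          using vw xy vx wy d(2) by (intro modulus_leD[OF r(1)]) auto
        have "R * (c (x, y) - C (x, y)) - G_path C a (x, y)
          = (R * (c (x, y) - C (v, w)) - a (v, w)) + (a (v, w) - a (x, y))
            + (R * (C (v, w) - C (x, w)) + partial1 C (x, y) * a (x, 1))
            + (R * (C (x, w) - C (x, y)) + partial2 C (x, y) * a (1, y))"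
          by (simp add: G_path_def algebra_simps)
        then show ?thesis using vw(5) 1 2 3 unfolding s(3) t(3) by linarith
      qed
    qed
  qed
qed

lemma G_path_bounded:
  assumes "regular_path \<delta> \<eta> K a" "x \<in> {0..1}" "y \<in> {0..1}"
  shows "\<bar>G_path C a (x, y)\<bar> \<le> 3 * K"
proof -
  note r = regular_pathD[OF assms(1)]
  have "\<bar>partial1 C (x, y) * a (x, 1)\<bar> \<le> K" "\<bar>partial2 C (x, y) * a (1, y)\<bar> \<le> K"
    by (rule order_trans[OF mult_partial_le(1)], use assms r(2) in auto)
      (rule order_trans[OF mult_partial_le(2)], use assms r(2) in auto)
  moreover have "\<bar>a (x, y)\<bar> \<le> K" using r(2) assms by blast
  ultimately show ?thesis by (simp add: G_path_def)
qed

text \<open>An increment of \<open>G_path\<close> splits into five terms of size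
  \<open>\<eta>\<close>: the increment of \<open>a\<close>, two oscillations of a derivative times
  an edge value, and two derivatives times an edge increment.\<close>

lemma G_path_modulus:
  assumes pos: "0 < \<delta>" "0 < \<eta>" "0 < K"
  obtains d where "0 < d" "\<And>a. regular_path \<delta> \<eta> K a \<Longrightarrow> modulus_le d (5 * \<eta>) (G_path C a)"
proof (rule oscillation1[OF pos])
  fix d1 assume d1: "0 < d1"
    "\<And>x y x' y' r. \<lbrakk>x \<in> {0..1}; y \<in> {0..1}; x' \<in> {0..1}; y' \<in> {0..1}; \<bar>x - x'\<bar> \<le> d1; \<bar>y - y'\<bar> \<le> d1;
       \<bar>r\<bar> \<le> K; x \<le> \<delta> \<or> 1 - \<delta> \<le> x \<Longrightarrow> \<bar>r\<bar> \<le> \<eta>\<rbrakk> \<Longrightarrow> \<bar>(partial1 C (x, y) - partial1 C (x', y')) * r\<bar> \<le> \<eta>"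
  show thesis
  proof (rule oscillation2[OF pos])
    fix d2 assume d2: "0 < d2"
      "\<And>x y x' y' r. \<lbrakk>x \<in> {0..1}; y \<in> {0..1}; x' \<in> {0..1}; y' \<in> {0..1}; \<bar>x - x'\<bar> \<le> d2; \<bar>y - y'\<bar> \<le> d2;
         \<bar>r\<bar> \<le> K; y \<le> \<delta> \<or> 1 - \<delta> \<le> y \<Longrightarrow> \<bar>r\<bar> \<le> \<eta>\<rbrakk> \<Longrightarrow> \<bar>(partial2 C (x, y) - partial2 C (x', y')) * r\<bar> \<le> \<eta>"
    define d where "d = min \<delta> (min d1 d2)"
    have d: "0 < d" "d \<le> \<delta>" "d \<le> d1" "d \<le> d2" using pos d1(1) d2(1) by (auto simp: d_def)
    show thesis
    proof (rule that[OF d(1)])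
      fix a assume reg: "regular_path \<delta> \<eta> K a"
      note r = regular_pathD[OF reg]
      show "modulus_le d (5 * \<eta>) (G_path C a)"
        unfolding modulus_le_def
      proof (intro ballI impI)
        fix x y x' y' :: real
        assume xy: "x \<in> {0..1}" "y \<in> {0..1}" and xy': "x' \<in> {0..1}" "y' \<in> {0..1}"
          and cl: "\<bar>x - x'\<bar> \<le> d \<and> \<bar>y - y'\<bar> \<le> d"
        have 0: "\<bar>a (x, y) - a (x', y')\<bar> \<le> \<eta>"
          using cl d by (intro modulus_leD[OF r(1) xy xy']) auto
        have 1: "\<bar>(partial1 C (x, y) - partial1 C (x', y')) * a (x, 1)\<bar> \<le> \<eta>"
        proof (rule d1(2)[OF xy xy'])
          show "\<bar>a (x, 1)\<bar> \<le> K" using r(2)[OF xy(1)] by simp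
        qed (use cl d regular_path_edge1[OF reg xy(1)] in auto)
        have 2: "\<bar>(partial2 C (x, y) - partial2 C (x', y')) * a (1, y)\<bar> \<le> \<eta>"
        proof (rule d2(2)[OF xy xy'])
          show "\<bar>a (1, y)\<bar> \<le> K" using r(2)[OF _ xy(2)] by simp
        qed (use cl d regular_path_edge2[OF reg xy(2)] in auto)
        have 3: "\<bar>partial1 C (x', y') * (a (x, 1) - a (x', 1))\<bar> \<le> \<eta>"
        proof (rule order_trans[OF mult_partial_le(1)])
          show "\<bar>a (x, 1) - a (x', 1)\<bar> \<le> \<eta>" using cl d pos xy xy' by (intro modulus_leD[OF r(1)]) auto
        qed (use xy' in simp)
        have 4: "\<bar>partial2 C (x', y') * (a (1, y) - a (1, y'))\<bar> \<le> \<eta>"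
        proof (rule order_trans[OF mult_partial_le(2)])
          show "\<bar>a (1, y) - a (1, y')\<bar> \<le> \<eta>" using cl d pos xy xy' by (intro modulus_leD[OF r(1)]) auto
        qed (use xy' in simp)
        have "G_path C a (x, y) - G_path C a (x', y') = (a (x, y) - a (x', y'))
            - (partial1 C (x, y) - partial1 C (x', y')) * a (x, 1)
            - (partial2 C (x, y) - partial2 C (x', y')) * a (1, y)
            - partial1 C (x', y') * (a (x, 1) - a (x', 1)) - partial2 C (x', y') * (a (1, y) - a (1, y'))"
          by (simp add: G_path_def algebra_simps)
        then show "\<bar>G_path C a (x, y) - G_path C a (x', y')\<bar> \<le> 5 * \<eta>"
          using 0 1 2 3 4 by linarith
      qed
    qed
  qed
qed

text \<open>The limit process vanishes where \<open>C\<close> is \<open>0\<close> or \<open>1\<close>; this tames the partial derivatives of the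
  outer copula at the boundary values of the inner one.\<close>

lemma G_path_small:
  assumes pos: "0 < \<delta>" "0 < \<eta>" "0 < K"
  obtains \<kappa> where "0 < \<kappa>"
    "\<And>a x y. \<lbrakk>regular_path \<delta> \<eta> K a; x \<in> {0..1}; y \<in> {0..1}; C (x, y) \<le> \<kappa> \<or> 1 - \<kappa> \<le> C (x, y)\<rbrakk> \<Longrightarrow>
       \<bar>G_path C a (x, y)\<bar> \<le> 4 * \<eta>"
proof -
  \<comment> \<open>A derivative of size \<open>\<eta> / K\<close> times an edge value of size
    \<open>K\<close> costs \<open>\<eta>\<close>.\<close>
  have \<theta>: "0 < \<eta> / K" using pos by simp
  obtain \<kappa>1 where \<kappa>1: "0 < \<kappa>1"
    "\<And>x y. \<lbrakk>\<delta> \<le> x; x \<le> 1 - \<delta>; y \<in> {0..1}; C (x, y) \<le> \<kappa>1\<rbrakk> \<Longrightarrow> partial1 C (x, y) \<le> \<eta> / K"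
    by (rule partial1_small[OF pos(1) \<theta>]) (rule that; blast)
  obtain \<kappa>2 where \<kappa>2: "0 < \<kappa>2"
    "\<And>x y. \<lbrakk>\<delta> \<le> y; y \<le> 1 - \<delta>; x \<in> {0..1}; C (x, y) \<le> \<kappa>2\<rbrakk> \<Longrightarrow> partial2 C (x, y) \<le> \<eta> / K"
    by (rule partial2_small[OF pos(1) \<theta>]) (rule that; blast)
  obtain \<kappa>3 where \<kappa>3: "0 < \<kappa>3" "\<And>x y. \<lbrakk>x \<in> {0..1}; y \<in> {0..1}; C (x, y) \<le> \<kappa>3\<rbrakk> \<Longrightarrow>
    \<exists>x'\<in>{0..1}. \<exists>y'\<in>{0..1}. C (x', y') = 0 \<and> \<bar>x - x'\<bar> \<le> \<delta> \<and> \<bar>y - y'\<bar> \<le> \<delta>"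
    by (rule near_zero_set[OF pos(1)]) (rule that; blast)
  define \<kappa> where "\<kappa> = min \<delta> (min \<kappa>1 (min \<kappa>2 \<kappa>3))"
  have \<kappa>: "0 < \<kappa>" "\<kappa> \<le> \<delta>" "\<kappa> \<le> \<kappa>1" "\<kappa> \<le> \<kappa>2" "\<kappa> \<le> \<kappa>3"
    using pos \<kappa>1(1) \<kappa>2(1) \<kappa>3(1) by (auto simp: \<kappa>_def)
  have prod: "\<bar>p * r\<bar> \<le> \<eta>" if "0 \<le> p" "p \<le> \<eta> / K" "\<bar>r\<bar> \<le> K" for p r
  proof -
    have "\<bar>p * r\<bar> \<le> \<eta> / K * K" unfolding abs_mult using that pos by (intro mult_mono) auto
    then show ?thesis using pos by simp
  qed
  show thesis
  proof (rule that[OF \<kappa>(1)])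
    fix a and x y :: real
    assume reg: "regular_path \<delta> \<eta> K a" and xy: "x \<in> {0..1}" "y \<in> {0..1}"
      and or: "C (x, y) \<le> \<kappa> \<or> 1 - \<kappa> \<le> C (x, y)"
    note r = regular_pathD[OF reg]
    have "\<bar>a (x, y)\<bar> \<le> 2 * \<eta> \<and> \<bar>partial1 C (x, y) * a (x, 1)\<bar> \<le> \<eta> \<and> \<bar>partial2 C (x, y) * a (1, y)\<bar> \<le> \<eta>"
    proof (cases "C (x, y) \<le> \<kappa>")
      case True
      obtain x' y' where z: "x' \<in> {0..1}" "y' \<in> {0..1}" "C (x', y') = 0" "\<bar>x - x'\<bar> \<le> \<delta>" "\<bar>y - y'\<bar> \<le> \<delta>"
        using \<kappa>3(2)[OF xy] True \<kappa>(5) by (meson order_trans)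
      have "\<bar>a (x, y)\<bar> \<le> 2 * \<eta>"
        using r(3)[OF z(1-3)] modulus_leD[OF r(1) xy z(1,2,4,5)] by linarith
      moreover have "\<bar>partial1 C (x, y) * a (x, 1)\<bar> \<le> \<eta>"
      proof (cases "x \<le> \<delta> \<or> 1 - \<delta> \<le> x")
        case True
        show ?thesis
          by (rule order_trans[OF mult_partial_le(1) regular_path_edge1[OF reg xy(1) True]]) (use xy in simp)
      next
        case False
        have "partial1 C (x, y) \<le> \<eta> / K"
          by (rule \<kappa>1(2)) (use False True xy \<kappa> in auto)
        then show ?thesis
          using partial1_range[of "(x, y)"] xy r(2)[OF xy(1), of 1] by (intro prod) auto
      qed
      moreover have "\<bar>partial2 C (x, y) * a (1, y)\<bar> \<le> \<eta>"
      proof (cases "y \<le> \<delta> \<or> 1 - \<delta> \<le> y")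
        case True
        show ?thesis
          by (rule order_trans[OF mult_partial_le(2) regular_path_edge2[OF reg xy(2) True]]) (use xy in simp)
      next
        case False
        have "partial2 C (x, y) \<le> \<eta> / K"
          by (rule \<kappa>2(2)) (use False True xy \<kappa> in auto)
        then show ?thesis
          using partial2_range[of "(x, y)"] xy r(2)[OF _ xy(2), of 1] by (intro prod) auto
      qed
      ultimately show ?thesis by blast
    next
      case False
      \<comment> \<open>Since \<open>C\<close> is below both coordinates, a value near 1 forces the
        point near the corner \<open>(1, 1)\<close>.\<close>
      then have big: "1 - \<delta> \<le> x" "1 - \<delta> \<le> y" using or le_min[OF xy] \<kappa>(2) by auto
      have "\<bar>a (x, y) - a (1, 1)\<bar> \<le> \<eta>"
        using big xy by (intro modulus_leD[OF r(1)]) auto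
      then have "\<bar>a (x, y)\<bar> \<le> 2 * \<eta>" using r(6) pos by simp
      moreover have "\<bar>partial1 C (x, y) * a (x, 1)\<bar> \<le> \<eta>"
        by (rule order_trans[OF mult_partial_le(1) regular_path_edge1[OF reg xy(1)]]) (use xy big in auto)
      moreover have "\<bar>partial2 C (x, y) * a (1, y)\<bar> \<le> \<eta>"
        by (rule order_trans[OF mult_partial_le(2) regular_path_edge2[OF reg xy(2)]]) (use xy big in auto)
      ultimately show ?thesis by blast
    qed
    then show "\<bar>G_path C a (x, y)\<bar> \<le> 4 * \<eta>" by (simp add: G_path_def) linarith
  qed
qed

text \<open>\<open>g'\<close> and \<open>G'\<close> are the scaled error and its limit at the
  perturbed argument, \<open>G\<close> the limit at the true one, \<open>g\<close> and
  \<open>F\<close> the scaled error and limit of the inner copula. The sum is 8 + 5 + 8 + 4: outer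
  expansion, modulus of \<open>G_path\<close>, inner expansion, oscillation of the outer
  derivative.\<close>

lemma composition_term_bound:
  fixes g g' G G' F p p' \<eta> :: real
  assumes "\<bar>g' - G'\<bar> \<le> 8 * \<eta>" "\<bar>G' - G\<bar> \<le> 5 * \<eta>" "\<bar>g - F\<bar> \<le> 8 * \<eta>" "p' \<in> {0..1}" "\<bar>(p - p') * F\<bar> \<le> 4 * \<eta>"
  shows "\<bar>(g' + p' * g) - (G + p * F)\<bar> \<le> 25 * \<eta>"
proof -
  have "\<bar>p' * (g - F)\<bar> \<le> 8 * \<eta>"
    using assms(3,4) mult_left_le_one_le[of "\<bar>g - F\<bar>" p'] by (auto simp: abs_mult)
  moreover have "(g' + p' * g) - (G + p * F) = (g' - G') + (G' - G) + p' * (g - F) - (p - p') * F"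
    by (simp add: algebra_simps)
  ultimately show ?thesis using assms(1,2,5) by linarith
qed

text \<open>Each side is telescoped through \<open>C (x, c (y, z))\<close> or
  \<open>C (c (x, y), z)\<close>, and the mean value theorem linearises the outer \<open>C\<close>
  around the true inner value. Associativity cancels the two leading terms, which \<open>R\<close>
  would otherwise blow up; either side leaves \<open>25 * \<eta>\<close>.\<close>

lemma associativity_expansion:
  assumes assoc: "associative_copula C" and pos: "0 < \<delta>" "0 < \<eta>" "0 < K"
  obtains R0 where "0 < R0"
    "\<And>R a c u. \<lbrakk>R0 \<le> R; regular_path \<delta> \<eta> K a; empirical_approx R \<eta> a c; u \<in> unit_cube\<rbrakk> \<Longrightarrow>
       \<bar>(case u of (x, y, z) \<Rightarrow> R * (c (x, c (y, z)) - c (c (x, y), z))) - H_path C a u\<bar> \<le> 50 * \<eta>"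
proof -
  obtain R1 where R1: "0 < R1"
    "\<And>R a c x y. \<lbrakk>R1 \<le> R; regular_path \<delta> \<eta> K a; empirical_approx R \<eta> a c; x \<in> {0..1}; y \<in> {0..1}\<rbrakk> \<Longrightarrow>
       \<bar>R * (c (x, y) - C (x, y)) - G_path C a (x, y)\<bar> \<le> 8 * \<eta>"
    by (rule empirical_copula_expansion[OF pos]) (rule that; blast)
  obtain d1 where d1: "0 < d1" "\<And>a. regular_path \<delta> \<eta> K a \<Longrightarrow> modulus_le d1 (5 * \<eta>) (G_path C a)"
    by (rule G_path_modulus[OF pos]) (rule that; blast)
  obtain \<kappa> where \<kappa>: "0 < \<kappa>"
    "\<And>a x y. \<lbrakk>regular_path \<delta> \<eta> K a; x \<in> {0..1}; y \<in> {0..1}; C (x, y) \<le> \<kappa> \<or> 1 - \<kappa> \<le> C (x, y)\<rbrakk> \<Longrightarrow>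
       \<bar>G_path C a (x, y)\<bar> \<le> 4 * \<eta>"
    by (rule G_path_small[OF pos]) (rule that; blast)
  \<comment> \<open>The differentiated coordinate is now the inner value of \<open>C\<close>, and
    the factor is \<open>G_path\<close> at the inner point: bounded by \<open>3 * K\<close>, and by
    \<open>4 * \<eta>\<close> when the inner value is within \<open>\<kappa>\<close> of 0 or
    1.\<close>
  have pos': "0 < \<kappa>" "0 < 4 * \<eta>" "0 < 3 * K" using pos \<kappa> by auto
  obtain d2 where d2: "0 < d2"
    "\<And>x y x' y' r. \<lbrakk>x \<in> {0..1}; y \<in> {0..1}; x' \<in> {0..1}; y' \<in> {0..1}; \<bar>x - x'\<bar> \<le> d2; \<bar>y - y'\<bar> \<le> d2;
       \<bar>r\<bar> \<le> 3 * K; x \<le> \<kappa> \<or> 1 - \<kappa> \<le> x \<Longrightarrow> \<bar>r\<bar> \<le> 4 * \<eta>\<rbrakk> \<Longrightarrow> \<bar>(partial1 C (x, y) - partial1 C (x', y')) * r\<bar> \<le> 4 * \<eta>"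
    by (rule oscillation1[OF pos']) (rule that; blast)
  obtain d3 where d3: "0 < d3"
    "\<And>x y x' y' r. \<lbrakk>x \<in> {0..1}; y \<in> {0..1}; x' \<in> {0..1}; y' \<in> {0..1}; \<bar>x - x'\<bar> \<le> d3; \<bar>y - y'\<bar> \<le> d3;
       \<bar>r\<bar> \<le> 3 * K; y \<le> \<kappa> \<or> 1 - \<kappa> \<le> y \<Longrightarrow> \<bar>r\<bar> \<le> 4 * \<eta>\<rbrakk> \<Longrightarrow> \<bar>(partial2 C (x, y) - partial2 C (x', y')) * r\<bar> \<le> 4 * \<eta>"
    by (rule oscillation2[OF pos']) (rule that; blast)
  define d where "d = min d1 (min d2 d3)"
  have d: "0 < d" "d \<le> d1" "d \<le> d2" "d \<le> d3" using d1(1) d2(1) d3(1) by (auto simp: d_def)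
  \<comment> \<open>The second entry forces the inner \<open>c\<close> within \<open>d\<close> of
    \<open>C\<close>, since the scaled error is at most \<open>3 * K + 8 * \<eta>\<close>.\<close>
  define R0 where "R0 = max R1 ((3 * K + 8 * \<eta>) / d)"
  show thesis
  proof (rule that[of R0])
    show "0 < R0" using R1(1) by (simp add: R0_def)
    fix R a c and u :: "real \<times> real \<times> real"
    assume R: "R0 \<le> R" and reg: "regular_path \<delta> \<eta> K a" and emp: "empirical_approx R \<eta> a c" and u: "u \<in> unit_cube"
    have RR: "R1 \<le> R" "(3 * K + 8 * \<eta>) / d \<le> R" "0 < R" using R R1(1) by (auto simp: R0_def)
    define G where "G = G_path C a"
    have gG: "\<bar>R * (c (x, y) - C (x, y)) - G (x, y)\<bar> \<le> 8 * \<eta>" if "x \<in> {0..1}" "y \<in> {0..1}" for x y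
      unfolding G_def by (rule R1(2)[OF RR(1) reg emp that])
    have GK: "\<bar>G (x, y)\<bar> \<le> 3 * K" if "x \<in> {0..1}" "y \<in> {0..1}" for x y
      unfolding G_def by (rule G_path_bounded[OF reg that])
    have Gs: "\<bar>G (x, y)\<bar> \<le> 4 * \<eta>" if "x \<in> {0..1}" "y \<in> {0..1}" "C (x, y) \<le> \<kappa> \<or> 1 - \<kappa> \<le> C (x, y)" for x y
      unfolding G_def by (rule \<kappa>(2)[OF reg that])
    have Gm: "modulus_le d1 (5 * \<eta>) G" unfolding G_def by (rule d1(2)[OF reg])
    have c01: "c (x, y) \<in> {0..1}" if "x \<in> {0..1}" "y \<in> {0..1}" for x y
      using emp that unfolding empirical_approx_def by blast
    have close: "\<bar>c (x, y) - C (x, y)\<bar> \<le> d" if "x \<in> {0..1}" "y \<in> {0..1}" for x y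
    proof -
      have "R * \<bar>c (x, y) - C (x, y)\<bar> = \<bar>R * (c (x, y) - C (x, y))\<bar>" using RR(3) by (simp add: abs_mult)
      also have "\<dots> \<le> 3 * K + 8 * \<eta>" using gG[OF that] GK[OF that] by linarith
      also have "\<dots> \<le> R * d" using RR(2) d(1) by (simp add: field_simps)
      finally show ?thesis using RR(3) by simp
    qed
    obtain x y z where xyz: "u = (x, y, z)" "x \<in> {0..1}" "y \<in> {0..1}" "z \<in> {0..1}" using u by (cases u) auto
    note yz = xyz(3,4) and xy = xyz(2,3)
    obtain t where t: "t \<in> {0..1}" "\<bar>t - C (y, z)\<bar> \<le> \<bar>c (y, z) - C (y, z)\<bar>"
      "C (x, c (y, z)) - C (x, C (y, z)) = partial2 C (x, t) * (c (y, z) - C (y, z))"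
      by (rule mvt2[OF range01[OF yz] c01[OF yz] xyz(2)]) (rule that; blast)
    have A: "\<bar>(R * (c (x, c (y, z)) - C (x, c (y, z))) + partial2 C (x, t) * (R * (c (y, z) - C (y, z))))
        - (G (x, C (y, z)) + partial2 C (x, C (y, z)) * G (y, z))\<bar> \<le> 25 * \<eta>"
    proof (rule composition_term_bound[OF gG[OF xyz(2) c01[OF yz]] _ gG[OF yz]])
      show "\<bar>G (x, c (y, z)) - G (x, C (y, z))\<bar> \<le> 5 * \<eta>"
        using close[OF yz] d d1(1) by (intro modulus_leD[OF Gm] xyz(2) c01 yz range01) auto
      show "partial2 C (x, t) \<in> {0..1}" using t(1) xyz(2) by (intro partial2_range) simp
      show "\<bar>(partial2 C (x, C (y, z)) - partial2 C (x, t)) * G (y, z)\<bar> \<le> 4 * \<eta>"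
      proof (rule d3(2)[OF xyz(2) range01[OF yz] xyz(2) t(1)])
        show "\<bar>x - x\<bar> \<le> d3" using d3(1) by simp
        show "\<bar>C (y, z) - t\<bar> \<le> d3" using t(2) close[OF yz] d(4) by (simp add: abs_minus_commute)
      qed (use GK[OF yz] Gs[OF yz] in auto)
    qed
    obtain s where s: "s \<in> {0..1}" "\<bar>s - C (x, y)\<bar> \<le> \<bar>c (x, y) - C (x, y)\<bar>"
      "C (c (x, y), z) - C (C (x, y), z) = partial1 C (s, z) * (c (x, y) - C (x, y))"
      by (rule mvt1[OF range01[OF xy] c01[OF xy] xyz(4)]) (rule that; blast)
    have B: "\<bar>(R * (c (c (x, y), z) - C (c (x, y), z)) + partial1 C (s, z) * (R * (c (x, y) - C (x, y))))
        - (G (C (x, y), z) + partial1 C (C (x, y), z) * G (x, y))\<bar> \<le> 25 * \<eta>"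
    proof (rule composition_term_bound[OF gG[OF c01[OF xy] xyz(4)] _ gG[OF xy]])
      show "\<bar>G (c (x, y), z) - G (C (x, y), z)\<bar> \<le> 5 * \<eta>"
        using close[OF xy] d d1(1) by (intro modulus_leD[OF Gm] xyz(4) c01 xy range01) auto
      show "partial1 C (s, z) \<in> {0..1}" using s(1) xyz(4) by (intro partial1_range) simp
      show "\<bar>(partial1 C (C (x, y), z) - partial1 C (s, z)) * G (x, y)\<bar> \<le> 4 * \<eta>"
      proof (rule d2(2)[OF range01[OF xy] xyz(4) s(1) xyz(4)])
        show "\<bar>z - z\<bar> \<le> d2" using d2(1) by simp
        show "\<bar>C (x, y) - s\<bar> \<le> d2" using s(2) close[OF xy] d(3) by (simp add: abs_minus_commute)
      qed (use GK[OF xy] Gs[OF xy] in auto)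
    qed
    have as: "C (x, C (y, z)) = C (C (x, y), z)"
      using assoc u unfolding associative_copula_def xyz(1) by blast
    have "(case u of (x, y, z) \<Rightarrow> R * (c (x, c (y, z)) - c (c (x, y), z)))
       = (R * (c (x, c (y, z)) - C (x, c (y, z))) + R * (C (x, c (y, z)) - C (x, C (y, z))))
       - (R * (c (c (x, y), z) - C (c (x, y), z)) + R * (C (c (x, y), z) - C (C (x, y), z)))"
      by (simp add: xyz(1) as algebra_simps)
    also have "\<dots> = (R * (c (x, c (y, z)) - C (x, c (y, z))) + partial2 C (x, t) * (R * (c (y, z) - C (y, z))))
       - (R * (c (c (x, y), z) - C (c (x, y), z)) + partial1 C (s, z) * (R * (c (x, y) - C (x, y))))"
      unfolding t(3) s(3) by (simp add: algebra_simps)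
    moreover have "H_path C a u = (G (x, C (y, z)) + partial2 C (x, C (y, z)) * G (y, z))
       - (G (C (x, y), z) + partial1 C (C (x, y), z) * G (x, y))"
      using u by (simp add: H_path_def Let_def G_def xyz(1))
    ultimately show "\<bar>(case u of (x, y, z) \<Rightarrow> R * (c (x, c (y, z)) - c (c (x, y), z))) - H_path C a u\<bar> \<le> 50 * \<eta>"
      using A B by linarith
  qed
qed

end

section \<open>Chaining on dyadic grids\<close>

definition dyadic :: "nat \<Rightarrow> nat \<Rightarrow> real" where "dyadic j k = real k / 2 ^ j"

lemma dyadic_in [simp]: "k \<le> 2 ^ j \<Longrightarrow> dyadic j k \<in> {0..1}"
proof -
  assume "k \<le> 2 ^ j"
  then have "real k \<le> 2 ^ j" by (metis of_nat_le_iff of_nat_numeral of_nat_power)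
  then show ?thesis by (simp add: dyadic_def)
qed

lemma dyadic_Suc_double: "dyadic (Suc j) (2 * k) = dyadic j k"
  by (simp add: dyadic_def)

definition dyadic_index :: "nat \<Rightarrow> real \<Rightarrow> nat" where "dyadic_index j x = nat \<lfloor>x * 2 ^ j\<rfloor>"

lemma dyadic_index_bounds:
  assumes "x \<in> {0..1}"
  shows "dyadic_index j x \<le> 2 ^ j" "dyadic j (dyadic_index j x) \<le> x" "x < dyadic j (Suc (dyadic_index j x))"
proof -
  have 0: "0 \<le> x * 2 ^ j" using assms by simp
  have le: "x * 2 ^ j \<le> 2 ^ j" using assms by (simp add: mult_left_le_one_le)
  then have "\<lfloor>x * 2 ^ j\<rfloor> \<le> 2 ^ j" by (metis floor_mono floor_of_int of_int_numeral of_int_power)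
  then show "dyadic_index j x \<le> 2 ^ j"
    unfolding dyadic_index_def by (simp add: nat_le_iff)
  have "real (dyadic_index j x) = of_int \<lfloor>x * 2 ^ j\<rfloor>" using 0 by (simp add: dyadic_index_def)
  then have "real (dyadic_index j x) \<le> x * 2 ^ j" "x * 2 ^ j < real (dyadic_index j x) + 1" by linarith+
  then show "dyadic j (dyadic_index j x) \<le> x" "x < dyadic j (Suc (dyadic_index j x))"
    by (simp_all add: dyadic_def field_simps)
qed

lemma dyadic_index_close:
  assumes "x \<in> {0..1}" "\<bar>x - y\<bar> \<le> 1 / 2 ^ j"
  shows "dyadic_index j y \<le> Suc (dyadic_index j x)"
proof -
  have "y \<le> x + 1 / 2 ^ j" using assms by linarith
  then have "y * 2 ^ j \<le> (x + 1 / 2 ^ j) * 2 ^ j" by (rule mult_right_mono) simp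
  then have "y * 2 ^ j \<le> x * 2 ^ j + 1" by (simp add: algebra_simps)
  then have "\<lfloor>y * 2 ^ j\<rfloor> \<le> \<lfloor>x * 2 ^ j + 1\<rfloor>" by (rule floor_mono)
  then have "\<lfloor>y * 2 ^ j\<rfloor> \<le> \<lfloor>x * 2 ^ j\<rfloor> + 1" by simp
  moreover have "0 \<le> \<lfloor>x * 2 ^ j\<rfloor>" using assms by simp
  ultimately show ?thesis unfolding dyadic_index_def by linarith
qed

lemma dyadic_index_half: "dyadic_index j x = dyadic_index (Suc j) x div 2"
proof -
  have "\<lfloor>x * 2 ^ Suc j\<rfloor> div 2 = \<lfloor>x * 2 ^ Suc j / 2\<rfloor>"
    using floor_divide_real_eq_div[of 2 "x * 2 ^ Suc j"] by simp
  then have "\<lfloor>x * 2 ^ j\<rfloor> = \<lfloor>x * 2 ^ Suc j\<rfloor> div 2" by simp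
  then show ?thesis unfolding dyadic_index_def by (simp add: nat_div_distrib)
qed

text \<open>Only axis-parallel steps are recorded, so a level has
  \<open>2 * 2 ^ j * (2 ^ j + 1)\<close> of them, few enough for a union bound.\<close>

definition grid_step_le :: "nat \<Rightarrow> real \<Rightarrow> (real \<times> real \<Rightarrow> real) \<Rightarrow> bool" where
  "grid_step_le j l a \<longleftrightarrow> (\<forall>k<2^j. \<forall>i\<le>2^j.
     \<bar>a (dyadic j (Suc k), dyadic j i) - a (dyadic j k, dyadic j i)\<bar> \<le> l \<and>
     \<bar>a (dyadic j i, dyadic j (Suc k)) - a (dyadic j i, dyadic j k)\<bar> \<le> l)"

lemma grid_step_le_nonneg: "grid_step_le j l a \<Longrightarrow> 0 \<le> l"
  unfolding grid_step_le_def by (metis abs_ge_zero order_trans pos2 zero_le zero_less_power)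

lemma grid_neighbours:
  assumes g: "grid_step_le j l a"
    and k: "k \<le> 2 ^ j" "k' \<le> 2 ^ j" "k \<le> Suc k'" "k' \<le> Suc k"
    and i: "i \<le> 2 ^ j" "i' \<le> 2 ^ j" "i \<le> Suc i'" "i' \<le> Suc i"
  shows "\<bar>a (dyadic j k, dyadic j i) - a (dyadic j k', dyadic j i')\<bar> \<le> 2 * l"
proof -
  have l: "0 \<le> l" by (rule grid_step_le_nonneg[OF g])
  have 1: "\<bar>a (dyadic j k, dyadic j i) - a (dyadic j k', dyadic j i)\<bar> \<le> l"
  proof -
    consider "k = k'" | "k = Suc k'" | "k' = Suc k" using k by linarith
    then show ?thesis
    proof cases
      case 1 then show ?thesis using l by simp
    next
      case 2 then show ?thesis using g k i unfolding grid_step_le_def by (simp add: Suc_le_eq)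
    next
      case 3 then show ?thesis using g k i unfolding grid_step_le_def by (simp add: Suc_le_eq abs_minus_commute)
    qed
  qed
  have 2: "\<bar>a (dyadic j k', dyadic j i) - a (dyadic j k', dyadic j i')\<bar> \<le> l"
  proof -
    consider "i = i'" | "i = Suc i'" | "i' = Suc i" using i by linarith
    then show ?thesis
    proof cases
      case 1 then show ?thesis using l by simp
    next
      case 2 then show ?thesis using g k i unfolding grid_step_le_def by (simp add: Suc_le_eq)
    next
      case 3 then show ?thesis using g k i unfolding grid_step_le_def by (simp add: Suc_le_eq abs_minus_commute)
    qed
  qed
  show ?thesis using 1 2 by linarith
qed

abbreviation dyadic_round :: "nat \<Rightarrow> real \<Rightarrow> real" where
  "dyadic_round j x \<equiv> dyadic j (dyadic_index j x)"

text \<open>Telescoping over the levels: by \<open>dyadic_index_half\<close> the coarse rounding is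
  the parent of the fine one, hence at most one fine step away in each coordinate.\<close>

lemma chaining_grid:
  assumes xy: "x \<in> {0..1}" "y \<in> {0..1}" and "m \<le> J"
    and g: "\<And>j. m < j \<Longrightarrow> j \<le> J \<Longrightarrow> grid_step_le j (l j) a"
  shows "\<bar>a (dyadic_round J x, dyadic_round J y) - a (dyadic_round m x, dyadic_round m y)\<bar>
    \<le> (\<Sum>j\<in>{m<..J}. 2 * l j)"
  using \<open>m \<le> J\<close> g
proof (induction J rule: dec_induct)
  case base
  then show ?case by simp
next
  case (step J)
  have IH: "\<bar>a (dyadic_round J x, dyadic_round J y) - a (dyadic_round m x, dyadic_round m y)\<bar> \<le> (\<Sum>j\<in>{m<..J}. 2 * l j)"
    using step by simp
  \<comment> \<open>The coarse point seen on the finer grid: its index there is the fine index with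
    the last bit cleared.\<close>
  have half: "dyadic J (dyadic_index J s) = dyadic (Suc J) (2 * (dyadic_index (Suc J) s div 2))" for s
    by (simp only: dyadic_Suc_double dyadic_index_half[of J s])
  have "\<bar>a (dyadic_round (Suc J) x, dyadic_round (Suc J) y) - a (dyadic_round J x, dyadic_round J y)\<bar> \<le> 2 * l (Suc J)"
    unfolding half
    using dyadic_index_bounds(1)[OF xy(1), of "Suc J"] dyadic_index_bounds(1)[OF xy(2), of "Suc J"]
    by (intro grid_neighbours[of "Suc J"] step.prems) (use step.hyps in linarith)+
  moreover have "{m<..Suc J} = insert (Suc J) {m<..J}" using step.hyps by auto
  ultimately show ?case using IH by simp
qed

text \<open>Between the points of the finest grid only monotonicity of the empirical distribution function
  is used: \<open>a s \<le> a t + R (t - s)\<close> for \<open>s \<le> t\<close>.\<close>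

lemma modulus_le_chaining:
  fixes a :: "real \<times> real \<Rightarrow> real"
  assumes mono: "\<And>x y x' y'. \<lbrakk>x \<in> {0..1}; y \<in> {0..1}; x' \<in> {0..1}; y' \<in> {0..1}; x \<le> x'; y \<le> y'\<rbrakk> \<Longrightarrow>
      a (x, y) \<le> a (x', y') + R * ((x' - x) + (y' - y))"
    and R: "0 \<le> R" and "m \<le> J"
    and g: "\<And>j. m \<le> j \<Longrightarrow> j \<le> J \<Longrightarrow> grid_step_le j (l j) a"
  shows "modulus_le (1 / 2 ^ m) (8 * (\<Sum>j\<in>{m..J}. l j) + 4 * R / 2 ^ J) a"
proof -
  define S where "S = (\<Sum>j\<in>{m<..J}. l j)"
  have lJ: "0 \<le> l J" "0 \<le> l m" using grid_step_le_nonneg[OF g] \<open>m \<le> J\<close> by auto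
  have Sl: "(\<Sum>j\<in>{m..J}. l j) = l m + S"
    using \<open>m \<le> J\<close> by (simp add: S_def sum.head)
  have S0: "0 \<le> S" unfolding S_def by (intro sum_nonneg) (use grid_step_le_nonneg[OF g] in auto)
  have lJS: "l J \<le> l m + S"
    unfolding Sl[symmetric] using \<open>m \<le> J\<close> by (intro member_le_sum) (use grid_step_le_nonneg[OF g] in auto)
  have to_grid: "\<bar>a (x, y) - a (dyadic_round J x, dyadic_round J y)\<bar> \<le> 2 * l J + 2 * R / 2 ^ J"
    if xy: "x \<in> {0..1}" "y \<in> {0..1}" for x y
  proof -
    define k i where "k = dyadic_index J x" and "i = dyadic_index J y"
    \<comment> \<open>The upper corner of the cell, capped for points on the far edge, where the
      rounded index is already \<open>2 ^ J\<close>.\<close>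
    define k' i' where "k' = min (Suc k) (2 ^ J)" and "i' = min (Suc i) (2 ^ J)"
    have ki: "k \<le> 2 ^ J" "i \<le> 2 ^ J" "k' \<le> 2 ^ J" "i' \<le> 2 ^ J"
      using dyadic_index_bounds(1) xy by (auto simp: k_def i_def k'_def i'_def)
    have one: "dyadic J (2 ^ J) = 1" by (simp add: dyadic_def)
    have up: "x \<le> dyadic J k'" "y \<le> dyadic J i'"
      using dyadic_index_bounds(3)[OF xy(1), of J] dyadic_index_bounds(3)[OF xy(2), of J] xy one
      by (auto simp: k'_def i'_def min_def k_def i_def)
    have lo: "dyadic J k \<le> x" "dyadic J i \<le> y"
      using dyadic_index_bounds(2) xy by (auto simp: k_def i_def)
    have gap: "dyadic J k' - dyadic J k \<le> 1 / 2 ^ J" "dyadic J i' - dyadic J i \<le> 1 / 2 ^ J"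
    proof -
      have "real k' \<le> real k + 1" "real i' \<le> real i + 1" by (auto simp: k'_def i'_def)
      then show "dyadic J k' - dyadic J k \<le> 1 / 2 ^ J" "dyadic J i' - dyadic J i \<le> 1 / 2 ^ J"
        unfolding dyadic_def diff_divide_distrib[symmetric] by (auto intro!: divide_right_mono)
    qed
    have Rb: "R * (s + t) \<le> 2 * R / 2 ^ J" if "s \<le> 1 / 2 ^ J" "t \<le> 1 / 2 ^ J" for s t
    proof -
      have "R * (s + t) \<le> R * (2 / 2 ^ J)" using that R by (intro mult_left_mono) auto
      then show ?thesis by (simp add: mult.commute)
    qed
    \<comment> \<open>The value at a point is squeezed between those at the two opposite corners of
      its cell, which are grid neighbours.\<close>
    have "a (x, y) \<le> a (dyadic J k', dyadic J i') + R * ((dyadic J k' - x) + (dyadic J i' - y))"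
      by (intro mono xy dyadic_in ki up)
    also have "R * ((dyadic J k' - x) + (dyadic J i' - y)) \<le> 2 * R / 2 ^ J"
      using gap lo by (intro Rb) linarith+
    finally have 1: "a (x, y) \<le> a (dyadic J k', dyadic J i') + 2 * R / 2 ^ J" by simp
    have "a (dyadic J k, dyadic J i) \<le> a (x, y) + R * ((x - dyadic J k) + (y - dyadic J i))"
      by (intro mono xy dyadic_in ki lo)
    also have "R * ((x - dyadic J k) + (y - dyadic J i)) \<le> 2 * R / 2 ^ J"
      using gap up by (intro Rb) linarith+
    finally have 2: "a (dyadic J k, dyadic J i) \<le> a (x, y) + 2 * R / 2 ^ J" by simp
    have 3: "\<bar>a (dyadic J k', dyadic J i') - a (dyadic J k, dyadic J i)\<bar> \<le> 2 * l J"
      by (intro grid_neighbours[OF g[OF \<open>m \<le> J\<close>]] ki) (use ki in \<open>auto simp: k'_def i'_def\<close>)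
    show ?thesis using 1 2 3 lJ(1) unfolding k_def[symmetric] i_def[symmetric] by linarith
  qed
  have to_coarse: "\<bar>a (x, y) - a (dyadic_round m x, dyadic_round m y)\<bar> \<le> 2 * l J + 2 * R / 2 ^ J + 2 * S"
    if xy: "x \<in> {0..1}" "y \<in> {0..1}" for x y
    using to_grid[OF xy] chaining_grid[OF xy \<open>m \<le> J\<close>, of l a] g by (auto simp: S_def sum_distrib_left[symmetric])
  show ?thesis
    unfolding modulus_le_def
  proof (intro ballI impI)
    fix x y x' y' :: real
    assume xy: "x \<in> {0..1}" "y \<in> {0..1}" and xy': "x' \<in> {0..1}" "y' \<in> {0..1}"
      and cl: "\<bar>x - x'\<bar> \<le> 1 / 2 ^ m \<and> \<bar>y - y'\<bar> \<le> 1 / 2 ^ m"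
    have "\<bar>a (dyadic_round m x, dyadic_round m y) - a (dyadic_round m x', dyadic_round m y')\<bar> \<le> 2 * l m"
      using cl by (intro grid_neighbours[OF g[OF order_refl \<open>m \<le> J\<close>]] dyadic_index_bounds dyadic_index_close xy xy')
        (simp_all add: abs_minus_commute)
    moreover have "\<bar>p - q\<bar> \<le> B + 2 * E" if "\<bar>p - p'\<bar> \<le> E" "\<bar>q - q'\<bar> \<le> E" "\<bar>p' - q'\<bar> \<le> B" for p q p' q' E B :: real
      using that by linarith
    ultimately have "\<bar>a (x, y) - a (x', y')\<bar> \<le> 2 * l m + 2 * (2 * l J + 2 * R / 2 ^ J + 2 * S)"
      using to_coarse[OF xy] to_coarse[OF xy'] by blast
    also have "\<dots> = 2 * l m + 4 * l J + 4 * S + 4 * R / 2 ^ J" by simp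
    \<comment> \<open>As \<open>l J\<close> is itself one of the summands, \<open>4 * l J\<close> is
      at most \<open>4 * (l m + S)\<close>.\<close>
    also have "\<dots> \<le> 8 * (l m + S) + 4 * R / 2 ^ J"
      using lJ lJS S0 by argo
    finally show "\<bar>a (x, y) - a (x', y')\<bar> \<le> 8 * (\<Sum>j\<in>{m..J}. l j) + 4 * R / 2 ^ J"
      unfolding Sl .
  qed
qed

section \<open>Equicontinuity of the empirical process\<close>

lemma exp_le_quadratic:
  fixes y :: real
  assumes "\<bar>y\<bar> \<le> 1"
  shows "exp y \<le> 1 + y + y\<^sup>2"
proof (cases "0 \<le> y")
  case True
  then show ?thesis using exp_bound[of y] assms by simp
next
  case False
  have pos: "0 < 1 - y" using False by simp
  \<comment> \<open>The product equals \<open>1 - y ^ 3\<close>, and \<open>y\<close> is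
    negative.\<close>
  have "1 \<le> (1 + y + y\<^sup>2) * (1 - y)"
    using False mult_nonpos_nonneg[of y "y * y"] by (simp add: algebra_simps power2_eq_square)
  moreover have "1 - y \<le> exp (- y)" using exp_ge_add_one_self[of "- y"] by simp
  moreover have "0 \<le> 1 + y + y\<^sup>2" using assms by (auto intro: add_nonneg_nonneg)
  ultimately have "1 \<le> (1 + y + y\<^sup>2) * exp (- y)"
    by (meson mult_left_mono order_trans)
  then have "1 * exp y \<le> (1 + y + y\<^sup>2) * exp (- y) * exp y" by (intro mult_right_mono) auto
  then show ?thesis by (simp add: mult.assoc exp_minus_inverse[symmetric] flip: exp_add)
qed

text \<open>Unlike Hoeffding's, this bound sees the variance \<open>h\<close>, as chaining requires.\<close>

lemma (in prob_space) bernstein_tail: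
  fixes X :: "'i \<Rightarrow> 'a \<Rightarrow> real"
  assumes indep: "indep_vars (\<lambda>_. borel) X I" and fin: "finite I"
    and bnd: "\<And>i \<omega>. i \<in> I \<Longrightarrow> \<bar>X i \<omega>\<bar> \<le> 1"
    and mean: "\<And>i. i \<in> I \<Longrightarrow> expectation (X i) = 0"
    and var: "\<And>i. i \<in> I \<Longrightarrow> expectation (\<lambda>\<omega>. (X i \<omega>)\<^sup>2) \<le> h"
    and \<theta>: "0 < \<theta>" "\<theta> \<le> 1"
  shows "prob {\<omega> \<in> space M. t \<le> (\<Sum>i\<in>I. X i \<omega>)} \<le> exp (real (card I) * (\<theta>\<^sup>2 * h) - \<theta> * t)"
proof -
  have rv [measurable]: "X i \<in> borel_measurable M" if "i \<in> I" for i
    using indep that unfolding indep_vars_def2 by auto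
  have sum_rv [measurable]: "(\<lambda>\<omega>. \<Sum>i\<in>I. X i \<omega>) \<in> borel_measurable M"
    by (rule borel_measurable_sum) (rule rv)
  have exp_le: "\<bar>exp (\<theta> * X i \<omega>)\<bar> \<le> exp 1" if "i \<in> I" for i \<omega>
  proof -
    have "\<theta> * X i \<omega> \<le> \<theta> * 1" using bnd[OF that, of \<omega>] \<theta> by (intro mult_left_mono) auto
    also have "\<dots> \<le> 1" using \<theta> by simp
    finally show ?thesis by simp
  qed
  have int_exp: "integrable M (\<lambda>\<omega>. exp (\<theta> * X i \<omega>))" if "i \<in> I" for i
    using rv[OF that] exp_le[OF that] by (intro integrable_const_bound[where B="exp 1"]) auto
  have int: "integrable M (X i)" if "i \<in> I" for i
    using rv[OF that] bnd[OF that] by (intro integrable_const_bound[where B=1]) auto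
  have int2: "integrable M (\<lambda>\<omega>. (X i \<omega>)\<^sup>2)" if "i \<in> I" for i
    using rv[OF that] bnd[OF that] by (intro integrable_const_bound[where B=1]) (auto simp: abs_square_le_1)
  \<comment> \<open>In the quadratic bound for \<open>exp\<close> the linear term has mean 0, which
    leaves only the variance.\<close>
  have one: "expectation (\<lambda>\<omega>. exp (\<theta> * X i \<omega>)) \<le> exp (\<theta>\<^sup>2 * h)" if i: "i \<in> I" for i
  proof -
    have "expectation (\<lambda>\<omega>. exp (\<theta> * X i \<omega>)) \<le> expectation (\<lambda>\<omega>. 1 + \<theta> * X i \<omega> + \<theta>\<^sup>2 * (X i \<omega>)\<^sup>2)"
    proof (rule integral_mono[OF int_exp[OF i]])
      show "integrable M (\<lambda>\<omega>. 1 + \<theta> * X i \<omega> + \<theta>\<^sup>2 * (X i \<omega>)\<^sup>2)"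
        using int[OF i] int2[OF i] by simp
      fix \<omega> assume "\<omega> \<in> space M"
      have "\<bar>\<theta> * X i \<omega>\<bar> \<le> 1" unfolding abs_mult using bnd[OF i, of \<omega>] \<theta> by (intro mult_le_one) auto
      from exp_le_quadratic[OF this] show "exp (\<theta> * X i \<omega>) \<le> 1 + \<theta> * X i \<omega> + \<theta>\<^sup>2 * (X i \<omega>)\<^sup>2"
        by (simp add: power_mult_distrib)
    qed
    also have "\<dots> = 1 + \<theta>\<^sup>2 * expectation (\<lambda>\<omega>. (X i \<omega>)\<^sup>2)"
      using int[OF i] int2[OF i] mean[OF i] by (simp add: prob_space)
    also have "\<dots> \<le> 1 + \<theta>\<^sup>2 * h" using var[OF i] by (simp add: mult_left_mono)
    also have "\<dots> \<le> exp (\<theta>\<^sup>2 * h)" by (rule exp_ge_add_one_self)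
    finally show ?thesis .
  qed
  have ind_exp: "indep_vars (\<lambda>_. borel) (\<lambda>i \<omega>. exp (\<theta> * X i \<omega>)) I"
    by (rule indep_vars_compose2[OF indep]) auto
  have exp_sum: "exp (\<theta> * (\<Sum>i\<in>I. X i \<omega>)) = (\<Prod>i\<in>I. exp (\<theta> * X i \<omega>))" for \<omega>
    by (simp add: sum_distrib_left exp_sum fin)
  have "expectation (\<lambda>\<omega>. exp (\<theta> * (\<Sum>i\<in>I. X i \<omega>))) = (\<Prod>i\<in>I. expectation (\<lambda>\<omega>. exp (\<theta> * X i \<omega>)))"
    unfolding exp_sum by (rule indep_vars_lebesgue_integral[OF fin ind_exp int_exp])
  also have "\<dots> \<le> (\<Prod>i\<in>I. exp (\<theta>\<^sup>2 * h))"
    by (intro prod_mono conjI one integral_nonneg_AE) auto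
  also have "\<dots> = exp (real (card I) * (\<theta>\<^sup>2 * h))" by (simp add: exp_of_nat_mult)
  finally have mgf: "expectation (\<lambda>\<omega>. exp (\<theta> * (\<Sum>i\<in>I. X i \<omega>))) \<le> exp (real (card I) * (\<theta>\<^sup>2 * h))" .
  have int_all: "integrable M (\<lambda>\<omega>. exp (\<theta> * (\<Sum>i\<in>I. X i \<omega>)))"
    unfolding exp_sum by (rule indep_vars_integrable[OF fin ind_exp int_exp])
  have "prob {\<omega> \<in> space M. t \<le> (\<Sum>i\<in>I. X i \<omega>)}
      \<le> exp (- \<theta> * t) * (\<integral>\<omega>\<in>space M. exp (\<theta> * (\<Sum>i\<in>I. X i \<omega>)) \<partial>M)"
    using \<theta>(1) integrable_mult_indicator[OF sets.top int_all]
    by (intro Chernoff_ineq_ge) (auto simp: set_integrable_def)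
  also have "(\<integral>\<omega>\<in>space M. exp (\<theta> * (\<Sum>i\<in>I. X i \<omega>)) \<partial>M) = expectation (\<lambda>\<omega>. exp (\<theta> * (\<Sum>i\<in>I. X i \<omega>)))"
    using int_all by (intro set_integral_space)
  also have "exp (- \<theta> * t) * \<dots> \<le> exp (- \<theta> * t) * exp (real (card I) * (\<theta>\<^sup>2 * h))"
    using mgf by (intro mult_left_mono) auto
  finally show ?thesis by (simp flip: exp_add add: algebra_simps)
qed

definition below :: "real \<times> real \<Rightarrow> real \<times> real \<Rightarrow> real" where
  "below u p = (if fst p \<le> fst u \<and> snd p \<le> snd u then 1 else 0)"

text \<open>This is \<open>sqrt n\<close> times the difference of the empirical distribution
  function of \<open>\<xi>\<close> and \<open>C\<close>, that is, the empirical process with known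
  margins. For \<open>n = 0\<close> its value is 0.\<close>

definition empirical_process ::
  "(real \<times> real \<Rightarrow> real) \<Rightarrow> nat \<Rightarrow> (nat \<Rightarrow> real \<times> real) \<Rightarrow> real \<times> real \<Rightarrow> real" where
  "empirical_process C n \<xi> u = (\<Sum>i\<in>{1..n}. below u (\<xi> i) - C u) / sqrt (real n)"

locale copula_sample = prob_space M + copula_fun C
  for M :: "'a measure" and C +
  fixes U :: "nat \<Rightarrow> 'a \<Rightarrow> real \<times> real"
  assumes indep: "indep_vars (\<lambda>_. borel) U {1..}"
    and cdf: "\<And>i v w. 1 \<le> i \<Longrightarrow> v \<in> {0..1} \<Longrightarrow> w \<in> {0..1} \<Longrightarrow>
      prob {\<omega> \<in> space M. fst (U i \<omega>) \<le> v \<and> snd (U i \<omega>) \<le> w} = C (v, w)"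
begin

abbreviation emp_process :: "nat \<Rightarrow> 'a \<Rightarrow> real \<times> real \<Rightarrow> real" where
  "emp_process n \<omega> \<equiv> empirical_process C n (\<lambda>i. U i \<omega>)"

lemma below_measurable [measurable]: "below u \<in> borel_measurable borel"
proof -
  have "below u = (indicator ({..fst u} \<times> {..snd u}) :: _ \<Rightarrow> real)"
    by (auto simp: below_def fun_eq_iff indicator_def)
  moreover have "({..fst u} \<times> {..snd u}) \<in> sets (borel :: (real \<times> real) measure)"
    by (intro borel_closed closed_Times) auto
  ultimately show ?thesis by simp
qed

lemma U_measurable [measurable]: "1 \<le> i \<Longrightarrow> U i \<in> borel_measurable M"
  using indep unfolding indep_vars_def2 by auto

lemma below_rv: "1 \<le> i \<Longrightarrow> (\<lambda>\<omega>. below u (U i \<omega>)) \<in> borel_measurable M"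
  by (rule measurable_compose[OF U_measurable below_measurable])

lemma below_integrable: "1 \<le> i \<Longrightarrow> integrable M (\<lambda>\<omega>. below u (U i \<omega>))"
  by (intro integrable_const_bound[where B=1] below_rv) (auto simp: below_def)

lemma expectation_below:
  assumes "1 \<le> i" "u \<in> unit_square"
  shows "expectation (\<lambda>\<omega>. below u (U i \<omega>)) = C u"
proof -
  let ?A = "{\<omega> \<in> space M. fst (U i \<omega>) \<le> fst u \<and> snd (U i \<omega>) \<le> snd u}"
  have "?A = (\<lambda>\<omega>. below u (U i \<omega>)) -` {1} \<inter> space M" by (auto simp: below_def split: if_splits)
  then have A: "?A \<in> sets M" using measurable_sets[OF below_rv[OF assms(1)], of "{1}"] by simp
  have "expectation (\<lambda>\<omega>. below u (U i \<omega>)) = expectation (indicator ?A)"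
    by (intro Bochner_Integration.integral_cong) (auto simp: below_def)
  also have "\<dots> = prob ?A" using A by simp
  also have "\<dots> = C u" using cdf[of i "fst u" "snd u"] assms by auto
  finally show ?thesis .
qed

lemma emp_process_measurable [measurable]: "(\<lambda>\<omega>. emp_process n \<omega> u) \<in> borel_measurable M"
  unfolding empirical_process_def by (intro borel_measurable_divide borel_measurable_sum borel_measurable_diff below_rv) auto

text \<open>For nested quadrants the difference of indicators takes the values 0 and 1 with mean
  \<open>C u' - C u\<close>, so its variance is at most \<open>h\<close>. The bound is
  \<open>bernstein_tail\<close> at \<open>\<theta> = r / sqrt n\<close>, where
  \<open>r \<le> sqrt n\<close> is the requirement \<open>\<theta> \<le> 1\<close>; the factor 2
  accounts for both signs.\<close>

lemma emp_process_increment_tail: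
  assumes u: "u \<in> unit_square" "u' \<in> unit_square" "fst u \<le> fst u'" "snd u \<le> snd u'"
    and h: "C u' - C u \<le> h" and r: "0 < r" "r \<le> sqrt (real n)" and n: "1 \<le> n"
  shows "prob {\<omega> \<in> space M. l \<le> \<bar>emp_process n \<omega> u' - emp_process n \<omega> u\<bar>} \<le> 2 * exp (r\<^sup>2 * h - r * l)"
proof -
  define Y where "Y p = below u' p - below u p - (C u' - C u)" for p
  have Cu: "0 \<le> C u" "C u' \<le> 1" using u range01[of "fst u" "snd u"] range01[of "fst u'" "snd u'"] by auto
  have Cle: "0 \<le> C u' - C u"
    using u mono1[of "fst u" "fst u'" "snd u"] mono2[of "snd u" "snd u'" "fst u'"] by auto
  have b01: "below u' p - below u p \<in> {0, 1}" for p
    using u(3,4) by (auto simp: below_def)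
  have Ybnd: "\<bar>Y p\<bar> \<le> 1" for p using b01[of p] Cu Cle by (auto simp: Y_def)
  have Ym [measurable]: "Y \<in> borel_measurable borel" unfolding Y_def by measurable
  have mean: "expectation (\<lambda>\<omega>. Y (U i \<omega>)) = 0" if "1 \<le> i" for i
    unfolding Y_def using below_integrable[OF that] expectation_below[OF that] u(1,2) by (simp add: prob_space)
  have var: "expectation (\<lambda>\<omega>. (Y (U i \<omega>))\<^sup>2) \<le> h" if "1 \<le> i" for i
  proof -
    let ?Z = "\<lambda>\<omega>. below u' (U i \<omega>) - below u (U i \<omega>)"
    \<comment> \<open>A variable with values 0 and 1 is its own square.\<close>
    have eq: "(Y (U i \<omega>))\<^sup>2 = ?Z \<omega> - 2 * (C u' - C u) * ?Z \<omega> + (C u' - C u)\<^sup>2" for \<omega>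
      using b01[of "U i \<omega>"] by (auto simp: Y_def power2_eq_square algebra_simps)
    have "expectation (\<lambda>\<omega>. (Y (U i \<omega>))\<^sup>2) = (C u' - C u) - 2 * (C u' - C u) * (C u' - C u) + (C u' - C u)\<^sup>2"
      unfolding eq using below_integrable[OF that] expectation_below[OF that] u(1,2) by (simp add: prob_space)
    also have "\<dots> \<le> C u' - C u" using zero_le_power2[of "C u' - C u"] by (simp add: power2_eq_square algebra_simps)
    finally show ?thesis using h by simp
  qed
  define \<theta> where "\<theta> = r / sqrt (real n)"
  have \<theta>: "0 < \<theta>" "\<theta> \<le> 1" "\<theta>\<^sup>2 * real n = r\<^sup>2" using r n by (auto simp: \<theta>_def power_divide)
  have exponent: "real (card {1..n}) * (\<theta>\<^sup>2 * h) - \<theta> * (l * sqrt (real n)) = r\<^sup>2 * h - r * l"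
    using \<theta>(3) n by (simp add: \<theta>_def field_simps)
  have ind: "indep_vars (\<lambda>_. borel) (\<lambda>i \<omega>. c * Y (U i \<omega>)) {1..n}" for c
    by (rule indep_vars_compose2[OF indep_vars_subset[OF indep]]) auto
  have tail: "prob {\<omega> \<in> space M. l * sqrt (real n) \<le> (\<Sum>i\<in>{1..n}. c * Y (U i \<omega>))} \<le> exp (r\<^sup>2 * h - r * l)"
    if c: "c = 1 \<or> c = -1" for c
    unfolding exponent[symmetric]
  proof (rule bernstein_tail[OF ind])
    show "\<bar>c * Y (U i \<omega>)\<bar> \<le> 1" for i \<omega> using Ybnd[of "U i \<omega>"] c by auto
    show "expectation (\<lambda>\<omega>. c * Y (U i \<omega>)) = 0" if "i \<in> {1..n}" for i using mean[of i] that by simp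
    show "expectation (\<lambda>\<omega>. (c * Y (U i \<omega>))\<^sup>2) \<le> h" if "i \<in> {1..n}" for i
      using var[of i] that c by (auto simp: power_mult_distrib)
  qed (use \<theta> in auto)
  have diff: "emp_process n \<omega> u' - emp_process n \<omega> u = (\<Sum>i\<in>{1..n}. Y (U i \<omega>)) / sqrt (real n)" for \<omega>
    unfolding empirical_process_def Y_def diff_divide_distrib[symmetric] sum_subtractf[symmetric]
    by (intro arg_cong2[where f="(/)"] sum.cong) auto
  define A where "A c = {\<omega> \<in> space M. l * sqrt (real n) \<le> (\<Sum>i\<in>{1..n}. c * Y (U i \<omega>))}" for c :: real
  have Am: "A c \<in> events" for c
  proof -
    have [measurable]: "(\<lambda>\<omega>. \<Sum>i\<in>{1..n}. c * Y (U i \<omega>)) \<in> borel_measurable M"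
      by (intro borel_measurable_sum borel_measurable_times borel_measurable_const measurable_compose[OF U_measurable Ym]) auto
    show ?thesis unfolding A_def by measurable
  qed
  have "{\<omega> \<in> space M. l \<le> \<bar>emp_process n \<omega> u' - emp_process n \<omega> u\<bar>} \<subseteq> A 1 \<union> A (-1)"
    unfolding diff A_def using n by (auto simp: abs_if sum_negf field_simps split: if_splits)
  then have "prob {\<omega> \<in> space M. l \<le> \<bar>emp_process n \<omega> u' - emp_process n \<omega> u\<bar>} \<le> prob (A 1 \<union> A (-1))"
    using Am by (intro finite_measure_mono) auto
  also have "\<dots> \<le> prob (A 1) + prob (A (-1))" using Am by (intro measure_subadditive) auto
  also have "\<dots> \<le> 2 * exp (r\<^sup>2 * h - r * l)" using tail[of 1] tail[of "-1"] by (simp add: A_def)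
  finally show ?thesis .
qed

end

text \<open>At level \<open>j\<close> there are about \<open>4 ^ j\<close> grid steps, and \<open>emp_process_increment_tail\<close> with \<open>r = sqrt (2 ^ j)\<close> bounds the
  probability that a given one exceeds this value by a multiple of \<open>exp (- 3 j)\<close>.\<close>

definition chain_level :: "nat \<Rightarrow> real" where
  "chain_level j = 3 * real j / sqrt (2 ^ j)"

lemma summable_chain_level: "summable chain_level"
proof -
  define z where "z = 1 / sqrt 2"
  have z: "norm z < 1" by (simp add: z_def)
  have "summable (\<lambda>n. real (Suc n) * z ^ n)"
    using geometric_deriv_sums[OF z] by (simp add: sums_iff)
  then have "summable (\<lambda>n. 3 * (real (Suc n) * z ^ n))" by (rule summable_mult)
  then show ?thesis
  proof (rule summable_comparison_test'[where N=0])
    fix n :: nat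
    have "chain_level n = 3 * (real n * z ^ n)"
      by (simp add: chain_level_def z_def real_sqrt_power power_divide)
    then show "norm (chain_level n) \<le> 3 * (real (Suc n) * z ^ n)"
      by (auto intro!: mult_right_mono simp: z_def abs_mult)
  qed
qed

text \<open>Uses \<open>2 \<le> exp 1 \<le> 3\<close>. The factor 3 in \<open>chain_level\<close> is
  there for the rate \<open>8 ^ j\<close>, which beats the order of \<open>4 ^ j\<close> grid steps
  with a summable rest.\<close>

lemma exp_minus_three_le: "exp (1 - 3 * real j) \<le> 3 / 8 ^ j"
proof -
  have "(8::real) ^ j = (2 ^ 3) ^ j" by simp
  also have "\<dots> \<le> ((exp 1) ^ 3) ^ j"
    using exp_ge_add_one_self[of 1] by (intro power_mono) auto
  also have "\<dots> = exp (3 * real j)" by (simp flip: exp_of_nat_mult add: mult.commute exp_of_nat2_mult)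
  finally have "8 ^ j \<le> exp (3 * real j)" .
  then have "exp 1 / exp (3 * real j) \<le> 3 / 8 ^ j" using exp_le by (intro frac_le) auto
  then show ?thesis by (simp add: exp_diff)
qed

context copula_sample
begin

text \<open>The counting part increases; the centring \<open>C\<close> grows by at most the sum of
  the coordinate increments, and \<open>n / sqrt n = sqrt n\<close>.\<close>

lemma emp_process_mono:
  assumes "x \<in> {0..1}" "y \<in> {0..1}" "x' \<in> {0..1}" "y' \<in> {0..1}" "x \<le> x'" "y \<le> y'"
  shows "emp_process n \<omega> (x, y) \<le> emp_process n \<omega> (x', y') + sqrt (real n) * ((x' - x) + (y' - y))"
proof (cases "n = 0")
  case True
  then show ?thesis by (simp add: empirical_process_def)
next
  case False
  have C: "C (x', y') - C (x, y) \<le> (x' - x) + (y' - y)"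
    using lipschitz[of x' x y' y] assms by auto
  have "(\<Sum>i\<in>{1..n}. below (x, y) (U i \<omega>) - C (x, y)) \<le>
      (\<Sum>i\<in>{1..n}. (below (x', y') (U i \<omega>) - C (x', y')) + ((x' - x) + (y' - y)))"
  proof (rule sum_mono)
    fix i
    have "below (x, y) (U i \<omega>) \<le> below (x', y') (U i \<omega>)" using assms by (auto simp: below_def)
    then show "below (x, y) (U i \<omega>) - C (x, y) \<le> (below (x', y') (U i \<omega>) - C (x', y')) + ((x' - x) + (y' - y))"
      using C by linarith
  qed
  also have "\<dots> = (\<Sum>i\<in>{1..n}. below (x', y') (U i \<omega>) - C (x', y')) + real n * ((x' - x) + (y' - y))"
    by (simp add: sum.distrib)
  finally have "emp_process n \<omega> (x, y) \<le>
      ((\<Sum>i\<in>{1..n}. below (x', y') (U i \<omega>) - C (x', y')) + real n * ((x' - x) + (y' - y))) / sqrt (real n)"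
    unfolding empirical_process_def by (rule divide_right_mono) simp
  also have "\<dots> = emp_process n \<omega> (x', y') + sqrt (real n) * ((x' - x) + (y' - y))"
    unfolding empirical_process_def add_divide_distrib using False by (simp add: real_div_sqrt flip: times_divide_eq_left)
  finally show ?thesis .
qed

text \<open>Union bound: each step fails with probability at most \<open>6 / 8 ^ j\<close>, there
  are two directions and at most \<open>2 * 4 ^ j\<close> positions. The hypothesis
  \<open>2 ^ j \<le> n\<close> is what the tail bound asks of
  \<open>r = sqrt (2 ^ j)\<close>.\<close>

lemma grid_step_event:
  assumes n: "2 ^ j \<le> n"
  defines "A \<equiv> {\<omega> \<in> space M. grid_step_le j (chain_level j) (emp_process n \<omega>)}"
  shows "A \<in> events" "prob (space M - A) \<le> 24 / 2 ^ j"
proof -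
  \<comment> \<open>\<open>p\<close> selects the direction of the step. \<open>H\<close> collects
    the bad events and \<open>H'\<close> the good ones; they overlap at equality, which is harmless
    because only a covering is required.\<close>
  define H where "H p = (\<lambda>(k, i). {\<omega> \<in> space M. chain_level j \<le>
     \<bar>emp_process n \<omega> (if p then (dyadic j (Suc k), dyadic j i) else (dyadic j i, dyadic j (Suc k)))
       - emp_process n \<omega> (if p then (dyadic j k, dyadic j i) else (dyadic j i, dyadic j k))\<bar>})" for p :: bool
  define H' where "H' p = (\<lambda>(k, i). {\<omega> \<in> space M.
     \<bar>emp_process n \<omega> (if p then (dyadic j (Suc k), dyadic j i) else (dyadic j i, dyadic j (Suc k)))
       - emp_process n \<omega> (if p then (dyadic j k, dyadic j i) else (dyadic j i, dyadic j k))\<bar> \<le> chain_level j})" for p :: bool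
  define T where "T = {..<(2::nat)^j} \<times> {..(2::nat)^j}"
  have finT: "finite T" "T \<noteq> {}" by (auto simp: T_def lessThan_empty_iff)
  have Hm: "H p t \<in> events" "H' p t \<in> events" for p t by (cases t; cases p; simp add: H_def H'_def; measurable)+
  have A_eq: "A = (\<Inter>t\<in>T. H' True t \<inter> H' False t)"
    using finT by (auto simp: A_def H'_def T_def grid_step_le_def)
  show Aev: "A \<in> events"
    unfolding A_eq using finT Hm by (intro sets.finite_INT) auto
  have pH: "prob (H p t) \<le> 6 / 8 ^ j" if "t \<in> T" for p t
  proof -
    obtain k i where t: "t = (k, i)" "k < 2 ^ j" "i \<le> 2 ^ j" using \<open>t \<in> T\<close> by (auto simp: T_def)
    have mem: "dyadic j k \<in> {0..1}" "dyadic j (Suc k) \<in> {0..1}" "dyadic j i \<in> {0..1}"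
      using t by (intro dyadic_in; simp)+
    have gap: "dyadic j (Suc k) - dyadic j k = 1 / 2 ^ j" by (simp add: dyadic_def diff_divide_distrib[symmetric])
    then have le: "dyadic j k \<le> dyadic j (Suc k)" by (metis diff_ge_0_iff_ge zero_le_divide_1_iff zero_le_numeral zero_le_power)
    have sq: "sqrt (2 ^ j) \<le> sqrt (real n)"
      using n by (metis of_nat_le_iff of_nat_numeral of_nat_power real_sqrt_le_iff)
    have n1: "1 \<le> n" using n by (metis One_nat_def Suc_leI le_trans pos2 zero_less_power)
    \<comment> \<open>A grid step has \<open>C\<close>-mass at most \<open>1 / 2 ^ j\<close>, so
      with \<open>r = sqrt (2 ^ j)\<close> the variance term is 1 and the linear term
      \<open>3 * j\<close>.\<close>
    have expo: "(sqrt (2 ^ j))\<^sup>2 * (1 / 2 ^ j) - sqrt (2 ^ j) * chain_level j = 1 - 3 * real j"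
      by (simp add: chain_level_def)
    have *: "prob {\<omega> \<in> space M. chain_level j \<le> \<bar>emp_process n \<omega> u' - emp_process n \<omega> u\<bar>} \<le> 2 * exp (1 - 3 * real j)"
      if "u \<in> unit_square" "u' \<in> unit_square" "fst u \<le> fst u'" "snd u \<le> snd u'" "C u' - C u \<le> 1 / 2 ^ j" for u u'
      using emp_process_increment_tail[OF that _ sq n1, of "chain_level j"] unfolding expo by simp
    have "prob (H p t) \<le> 2 * exp (1 - 3 * real j)"
      unfolding H_def t(1) case_prod_conv
      by (rule *) (use mem le gap lip1[of "dyadic j k" "dyadic j (Suc k)" "dyadic j i"]
           lip2[of "dyadic j k" "dyadic j (Suc k)" "dyadic j i"] in auto)
    then show ?thesis using exp_minus_three_le[of j] by simp
  qed
  have "space M - A \<subseteq> (\<Union>t\<in>T. H True t \<union> H False t)"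
  proof
    fix \<omega> assume w: "\<omega> \<in> space M - A"
    then obtain t where t: "t \<in> T" "\<omega> \<notin> H' True t \<inter> H' False t" by (auto simp: A_eq)
    then have "\<omega> \<in> H True t \<union> H False t" using w by (cases t) (auto simp: H_def H'_def not_le less_imp_le)
    then show "\<omega> \<in> (\<Union>t\<in>T. H True t \<union> H False t)" using t by blast
  qed
  then have "prob (space M - A) \<le> prob (\<Union>t\<in>T. H True t \<union> H False t)"
    using Hm finT by (intro finite_measure_mono sets.finite_UN) auto
  also have "\<dots> \<le> (\<Sum>t\<in>T. prob (H True t \<union> H False t))"
    using Hm finT by (intro finite_measure_subadditive_finite) auto
  also have "\<dots> \<le> (\<Sum>t\<in>T. 12 / 8 ^ j)"
  proof (rule sum_mono)
    fix t assume t: "t \<in> T"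
    have "prob (H True t \<union> H False t) \<le> prob (H True t) + prob (H False t)"
      using Hm by (intro measure_subadditive) auto
    then show "prob (H True t \<union> H False t) \<le> 12 / 8 ^ j" using pH[OF t, of True] pH[OF t, of False] by simp
  qed
  also have "\<dots> = 2 ^ j * (2 ^ j + 1) * (12 / 8 ^ j)" by (simp add: T_def algebra_simps)
  also have "\<dots> \<le> 2 ^ j * (2 * 2 ^ j) * (12 / 8 ^ j)" by (intro mult_mono) auto
  also have "\<dots> = 24 / 2 ^ j"
  proof -
    have "(8::real) ^ j = 2 ^ j * 2 ^ j * 2 ^ j" by (simp flip: power_mult_distrib)
    then show ?thesis by (simp add: field_simps)
  qed
  finally show "prob (space M - A) \<le> 24 / 2 ^ j" .
qed

text \<open>Chaining runs from a fixed level \<open>m\<close> to the last level \<open>J\<close>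
  with \<open>2 ^ J \<le> n\<close>, as far as the tail bound reaches. Since
  \<open>n < 2 * 2 ^ J\<close>, the remainder \<open>4 * sqrt n / 2 ^ J\<close> below that level is
  of order \<open>1 / sqrt n\<close>.\<close>

lemma emp_process_equicontinuous:
  assumes "0 < \<epsilon>" "0 < \<eta>"
  obtains m n0 where "\<And>n. n0 \<le> n \<Longrightarrow>
    \<exists>A\<in>events. prob (space M - A) \<le> \<epsilon> \<and> (\<forall>\<omega>\<in>A. modulus_le (1 / 2 ^ m) \<eta> (emp_process n \<omega>))"
proof -
  have cl0: "0 \<le> chain_level j" for j by (simp add: chain_level_def)
  \<comment> \<open>A tail below \<open>\<eta> / 16\<close> makes the chaining term, with its factor
    8, at most \<open>\<eta> / 2\<close>; the other half is left for the remainder.\<close>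
  have "(\<lambda>m. \<Sum>j. chain_level (j + m)) \<longlonglongrightarrow> 0"
    by (rule suminf_exist_split2[OF summable_chain_level])
  then have "\<forall>\<^sub>F m in sequentially. (\<Sum>j. chain_level (j + m)) < \<eta> / 16"
    by (rule order_tendstoD(2)) (use assms in simp)
  \<comment> \<open>The failure probabilities \<open>24 / 2 ^ j\<close> over all levels from
    \<open>m\<close> on add up to at most \<open>48 / 2 ^ m\<close>.\<close>
  moreover have "(\<lambda>m. 48 * (1 / 2) ^ m) \<longlonglongrightarrow> (48 * 0 :: real)"
    by (intro tendsto_mult tendsto_const LIMSEQ_power_zero) simp
  then have "\<forall>\<^sub>F m in sequentially. 48 * (1 / 2) ^ m < \<epsilon>"
    by (rule order_tendstoD(2)) (use assms in simp)
  ultimately have "\<forall>\<^sub>F m in sequentially. (\<Sum>j. chain_level (j + m)) < \<eta> / 16 \<and> 48 * (1 / 2) ^ m < \<epsilon>"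
    by eventually_elim simp
  then obtain m where m: "(\<Sum>j. chain_level (j + m)) < \<eta> / 16" "48 * (1 / 2) ^ m < \<epsilon>"
    by (auto simp: eventually_sequentially)
  \<comment> \<open>Chosen so that the remainder, at most \<open>8 / sqrt n\<close>, is at most
    \<open>\<eta> / 2\<close>.\<close>
  obtain n1 :: nat where n1: "(16 / \<eta>)\<^sup>2 \<le> real n1" using real_arch_simple by blast
  show thesis
  proof (rule that[of "max (2 ^ m) n1" m])
    fix n assume n: "max (2 ^ m) n1 \<le> n"
    then have "0 < n" by (metis leD le_trans max.cobounded1 not_gr_zero pos2 zero_less_power)
    obtain J where J: "2 ^ J \<le> n" "n < 2 ^ (J + 1)"
      using ex_power_ivl1[of 2 n] \<open>0 < n\<close> by auto
    have "(2::nat) ^ m < 2 ^ (J + 1)" using J n by linarith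
    then have mJ: "m \<le> J" using power_strict_increasing_iff[of "2::nat" m "J+1"] by simp
    define A where "A j = {\<omega> \<in> space M. grid_step_le j (chain_level j) (emp_process n \<omega>)}" for j
    have Aj: "A j \<in> events" "prob (space M - A j) \<le> 24 / 2 ^ j" if "j \<le> J" for j
    proof -
      have "(2::nat) ^ j \<le> 2 ^ J" using that by (intro power_increasing) auto
      then have "2 ^ j \<le> n" using J(1) by linarith
      then show "A j \<in> events" "prob (space M - A j) \<le> 24 / 2 ^ j"
        unfolding A_def by (rule grid_step_event)+
    qed
    define B where "B = (\<Inter>j\<in>{m..J}. A j)"
    have Bev: "B \<in> events" unfolding B_def using mJ Aj by (intro sets.finite_INT) auto
    have eq: "space M - B = (\<Union>j\<in>{m..J}. space M - A j)" by (auto simp: B_def)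
    have "prob (space M - B) \<le> (\<Sum>j\<in>{m..J}. prob (space M - A j))"
      unfolding eq by (intro finite_measure_subadditive_finite) (use Aj in auto)
    also have "\<dots> \<le> (\<Sum>j\<in>{m..J}. 24 * (1 / 2) ^ j)"
      using Aj(2) by (intro sum_mono) (simp add: power_one_over)
    also have "\<dots> = 24 * (\<Sum>j\<in>{m..J}. (1 / 2) ^ j)" by (simp add: sum_distrib_left)
    also have "(\<Sum>j\<in>{m..J}. (1 / 2 :: real) ^ j) \<le> 2 * (1 / 2) ^ m"
    proof -
      have "(\<Sum>j\<in>{m..J}. (1 / 2 :: real) ^ j) = 2 * (1 / 2) ^ m - (1 / 2) ^ J"
        using mJ by (induction J rule: dec_induct) (simp_all add: sum.nat_ivl_Suc')
      then show ?thesis by simp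
    qed
    finally have pB: "prob (space M - B) \<le> \<epsilon>" using m(2) by simp
    have sumJ: "(\<Sum>j\<in>{m..J}. chain_level j) \<le> \<eta> / 16"
    proof -
      have "(\<Sum>j\<in>{m..J}. chain_level j) = (\<Sum>j<Suc (J - m). chain_level (j + m))"
        using mJ by (intro sum.reindex_bij_witness[of _ "\<lambda>j. j + m" "\<lambda>j. j - m"]) auto
      also have "\<dots> \<le> (\<Sum>j. chain_level (j + m))"
        by (intro sum_le_suminf summable_ignore_initial_segment summable_chain_level) (auto simp: cl0)
      finally show ?thesis using m(1) by simp
    qed
    have rem: "4 * sqrt (real n) / 2 ^ J \<le> \<eta> / 2"
    proof -
      have "real n \<le> 2 * 2 ^ J" using J(2) by (metis Suc_eq_plus1 less_imp_le of_nat_le_iff of_nat_numeral of_nat_power power_Suc)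
      then have "4 * sqrt (real n) / 2 ^ J \<le> 4 * sqrt (real n) / (real n / 2)"
        using \<open>0 < n\<close> by (intro divide_left_mono) auto
      also have "\<dots> = 8 / sqrt (real n)" using \<open>0 < n\<close> by (simp add: field_simps)
      also have "\<dots> \<le> \<eta> / 2"
      proof -
        have "16 / \<eta> \<le> sqrt (real n)" using n1 n by (intro real_le_rsqrt) linarith
        then show ?thesis using assms \<open>0 < n\<close> by (simp add: field_simps)
      qed
      finally show ?thesis .
    qed
    have "modulus_le (1 / 2 ^ m) \<eta> (emp_process n \<omega>)" if "\<omega> \<in> B" for \<omega>
    proof -
      have "modulus_le (1 / 2 ^ m) (8 * (\<Sum>j\<in>{m..J}. chain_level j) + 4 * sqrt (real n) / 2 ^ J) (emp_process n \<omega>)"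
        by (rule modulus_le_chaining[OF emp_process_mono]) (use that mJ in \<open>auto simp: B_def A_def\<close>)
      then show ?thesis using sumJ rem unfolding modulus_le_def by fastforce
    qed
    then show "\<exists>A\<in>events. prob (space M - A) \<le> \<epsilon> \<and> (\<forall>\<omega>\<in>A. modulus_le (1 / 2 ^ m) \<eta> (emp_process n \<omega>))"
      using Bev pB by blast
  qed
qed

end

section \<open>Finite-dimensional convergence\<close>

inductive trig_sum :: "'i set \<Rightarrow> (('i \<Rightarrow> real) \<Rightarrow> complex) \<Rightarrow> bool" for T where
  wave: "trig_sum T (\<lambda>x. c * cis (\<Sum>t\<in>T. a t * x t))"
| add: "trig_sum T f \<Longrightarrow> trig_sum T g \<Longrightarrow> trig_sum T (\<lambda>x. f x + g x)"

lemma trig_sum_mult_wave: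
  assumes "trig_sum T f"
  shows "trig_sum T (\<lambda>x. c * cis (\<Sum>t\<in>T. a t * x t) * f x)"
  using assms
proof induction
  case (wave c' a')
  have eq: "c * cis (\<Sum>t\<in>T. a t * x t) * (c' * cis (\<Sum>t\<in>T. a' t * x t))
      = (c * c') * cis (\<Sum>t\<in>T. (a t + a' t) * x t)" for x
    by (simp add: distrib_right sum.distrib flip: cis_mult)
  show ?case unfolding eq by (rule trig_sum.wave)
next
  case (add f g)
  then show ?case by (simp add: distrib_left trig_sum.add)
qed

text \<open>Frequencies add under multiplication, so these sums form an algebra into which
  polynomials in sines can be expanded, while their expectations only involve characteristic
  functions of linear combinations.\<close>

lemma trig_sum_mult: "trig_sum T f \<Longrightarrow> trig_sum T g \<Longrightarrow> trig_sum T (\<lambda>x. f x * g x)"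
proof (induction rule: trig_sum.induct)
  case (wave c a)
  then show ?case by (rule trig_sum_mult_wave)
next
  case (add f g')
  then show ?case by (simp add: distrib_right trig_sum.add)
qed

lemma trig_sum_const: "trig_sum T (\<lambda>x. c)"
  using trig_sum.wave[of T c "\<lambda>_. 0"] by simp

lemma trig_sum_sin:
  assumes "finite T" "t \<in> T"
  shows "trig_sum T (\<lambda>x. complex_of_real (sin (c * x t)))"
proof -
  have sel: "(\<Sum>s\<in>T. (if s = t then b else 0) * x s) = b * x t" for b and x :: "'a \<Rightarrow> real"
    using assms by (simp add: if_distrib[of "\<lambda>z. z * _"] sum.delta cong: if_cong)
  have "trig_sum T (\<lambda>x. 1 / (2 * \<i>) * cis (\<Sum>s\<in>T. (if s = t then c else 0) * x s)
      + (- 1 / (2 * \<i>)) * cis (\<Sum>s\<in>T. (if s = t then - c else 0) * x s))"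
    by (intro trig_sum.intros)
  moreover have "1 / (2 * \<i>) * cis (c * y) + (- 1 / (2 * \<i>)) * cis (- c * y) = complex_of_real (sin (c * y))" for y
    by (simp add: complex_eq_iff)
  ultimately show ?thesis unfolding sel by simp
qed

text \<open>The algebra for Stone-Weierstrass on a compact cube. Substituting sines for the
  coordinates turns its members into trigonometric sums.\<close>

inductive coordinate_poly :: "'i set \<Rightarrow> (('i \<Rightarrow> real) \<Rightarrow> real) \<Rightarrow> bool" for T where
  const: "coordinate_poly T (\<lambda>y. c)"
| coord: "t \<in> T \<Longrightarrow> coordinate_poly T (\<lambda>y. y t)"
| add: "coordinate_poly T p \<Longrightarrow> coordinate_poly T q \<Longrightarrow> coordinate_poly T (\<lambda>y. p y + q y)"
| mult: "coordinate_poly T p \<Longrightarrow> coordinate_poly T q \<Longrightarrow> coordinate_poly T (\<lambda>y. p y * q y)"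

lemma coordinate_poly_continuous: "coordinate_poly T p \<Longrightarrow> continuous_on S p"
  by (induction rule: coordinate_poly.induct)
    (auto intro!: continuous_intros continuous_on_subset[OF continuous_on_product_coordinates])

lemma coordinate_poly_sin:
  assumes "coordinate_poly T p" "finite T"
  shows "trig_sum T (\<lambda>x. complex_of_real (p (\<lambda>t. if t \<in> T then sin (c * x t) else 0)))"
  using assms(1)
proof induction
  case (const c)
  then show ?case by (rule trig_sum_const)
next
  case (coord t)
  then show ?case using trig_sum_sin[OF assms(2), of t c] by simp
next
  case (add p q)
  then show ?case by (simp add: trig_sum.add)
next
  case (mult p q)
  then show ?case by (simp add: trig_sum_mult)
qed

text \<open>Fixing the coordinates outside \<open>T\<close> at 0 lets the coordinates in
  \<open>T\<close> separate points, while compactness is that of a product of compact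
  factors.\<close>

lemma compact_cube_fun:
  "compact {y :: 'i \<Rightarrow> real. (\<forall>t\<in>T. y t \<in> {-1..1}) \<and> (\<forall>t. t \<notin> T \<longrightarrow> y t = 0)}"
proof -
  let ?S = "\<lambda>t. if t \<in> T then {-1..1} else {0::real}"
  have "compactin (product_topology (\<lambda>i. euclidean) UNIV) (PiE UNIV ?S)"
    unfolding compactin_PiE by auto
  then have "compact (PiE UNIV ?S)" by (simp add: euclidean_product_topology)
  also have "PiE UNIV ?S = {y. (\<forall>t\<in>T. y t \<in> {-1..1}) \<and> (\<forall>t. t \<notin> T \<longrightarrow> y t = 0)}"
    by (auto simp: PiE_def Pi_def)
  finally show ?thesis .
qed

lemma trig_sum_integrable:
  assumes "trig_sum T f" "prob_space M" "\<And>t. (\<lambda>\<omega>. z \<omega> t) \<in> borel_measurable M"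
  shows "integrable M (\<lambda>\<omega>. f (z \<omega>))"
  using assms(1)
proof induction
  case (wave c a)
  interpret prob_space M by fact
  have [measurable]: "(\<lambda>\<omega>. \<Sum>t\<in>T. a t * z \<omega> t) \<in> borel_measurable M"
    by (intro borel_measurable_sum borel_measurable_times borel_measurable_const assms)
  have "(\<lambda>\<omega>. c * cis (\<Sum>t\<in>T. a t * z \<omega> t)) \<in> borel_measurable M"
    unfolding cis_conv_exp by measurable
  then show ?case
    by (intro integrable_const_bound[where B="norm c"]) (auto simp: norm_mult)
next
  case (add f g)
  then show ?case by simp
qed

text \<open>A continuous function of the coordinates in \<open>T\<close> agrees on a large box with a periodic one,
  obtained by inserting \<open>arcsin (sin _)\<close>, and the latter is a uniform limit of trigonometric sums.\<close>

lemma trig_approximation: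
  fixes g :: "('i::countable \<Rightarrow> real) \<Rightarrow> real"
  assumes T: "finite T" and cont: "continuous_on UNIV g" and bnd: "\<And>x. \<bar>g x\<bar> \<le> K"
    and dep: "\<And>x y. (\<And>t. t \<in> T \<Longrightarrow> x t = y t) \<Longrightarrow> g x = g y" and k: "0 < k" and e: "0 < e"
  obtains q where "trig_sum T (\<lambda>x. complex_of_real (q x))"
    "\<And>x. \<bar>g x - q x\<bar> \<le> e + 2 * K * (\<Sum>t\<in>T. (x t)\<^sup>2) / k\<^sup>2"
proof -
  \<comment> \<open>This scaling maps \<open>[-k, k]\<close> onto \<open>[-pi/2, pi/2]\<close>,
    where \<open>arcsin\<close> inverts \<open>sin\<close>.\<close>
  define c where "c = pi / (2 * k)"
  have c: "0 < c" "c * k = pi / 2" using k by (auto simp: c_def)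
  define S where "S = {y :: 'i \<Rightarrow> real. (\<forall>t\<in>T. y t \<in> {-1..1}) \<and> (\<forall>t. t \<notin> T \<longrightarrow> y t = 0)}"
  define G where "G y = g (\<lambda>t. arcsin (y t) / c)" for y
  have S1: "y t \<in> {-1..1}" if "y \<in> S" for y t
    using that by (cases "t \<in> T") (auto simp: S_def)
  have coordS: "continuous_on S (\<lambda>y. y t)" for t
    by (rule continuous_on_subset[OF continuous_on_product_coordinates]) simp
  have contG: "continuous_on S G"
    unfolding G_def
    by (intro continuous_on_compose2[OF cont] continuous_on_coordinatewise_then_product
          continuous_on_divide continuous_on_arcsin continuous_on_const coordS)
      (use S1 c in auto)
  interpret P: function_ring_on "Collect (coordinate_poly T)" S
  proof
    show "compact S" unfolding S_def by (rule compact_cube_fun)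
    fix x y assume xy: "x \<in> S" "y \<in> S" "x \<noteq> y"
    then obtain t where t: "x t \<noteq> y t" by blast
    then have "t \<in> T" using xy by (auto simp: S_def)
    then have mem: "(\<lambda>y. y t) \<in> Collect (coordinate_poly T)" by (simp add: coordinate_poly.coord)
    show "\<exists>f\<in>Collect (coordinate_poly T). f x \<noteq> f y"
      by (rule bexI[OF _ mem]) (rule t)
  qed (auto intro: coordinate_poly.intros coordinate_poly_continuous)
  obtain p where p: "coordinate_poly T p" "\<And>y. y \<in> S \<Longrightarrow> \<bar>G y - p y\<bar> < e"
    using P.Stone_Weierstrass_basic[OF contG e] by blast
  define s where "s x = (\<lambda>t. if t \<in> T then sin (c * x t) else 0)" for x :: "'i \<Rightarrow> real"
  have sS: "s x \<in> S" for x by (auto simp: s_def S_def)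
  show thesis
  proof (rule that[of "\<lambda>x. p (s x)"])
    show "trig_sum T (\<lambda>x. complex_of_real (p (s x)))"
      unfolding s_def by (rule coordinate_poly_sin[OF p(1) T])
    fix x :: "'i \<Rightarrow> real"
    have K: "0 \<le> K" using bnd[of x] by linarith
    have sum0: "0 \<le> (\<Sum>t\<in>T. (x t)\<^sup>2)" by (simp add: sum_nonneg)
    have pe: "\<bar>G (s x) - p (s x)\<bar> \<le> e" using p(2)[OF sS] by (rule less_imp_le)
    show "\<bar>g x - p (s x)\<bar> \<le> e + 2 * K * (\<Sum>t\<in>T. (x t)\<^sup>2) / k\<^sup>2"
    proof (cases "\<forall>t\<in>T. \<bar>x t\<bar> \<le> k")
      case True
      have "G (s x) = g x"
        unfolding G_def
      proof (rule dep)
        fix t assume t: "t \<in> T"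
        have "\<bar>c * x t\<bar> \<le> c * k" using True t c by (simp add: abs_mult)
        then have "- (pi / 2) \<le> c * x t" "c * x t \<le> pi / 2" unfolding c by auto
        then show "arcsin (s x t) / c = x t" using t c by (simp add: s_def arcsin_sin)
      qed
      moreover have "0 \<le> 2 * K * (\<Sum>t\<in>T. (x t)\<^sup>2) / k\<^sup>2" using K sum0 by simp
      ultimately show ?thesis using pe by linarith
    next
      case False
      \<comment> \<open>Outside the box the scaled sum of squares is at least 1, which pays for the
        trivial bound \<open>2 * K\<close>.\<close>
      then obtain t where t: "t \<in> T" "k < \<bar>x t\<bar>" by (auto simp: not_le)
      have "k\<^sup>2 \<le> (x t)\<^sup>2" using t k by (simp add: abs_le_square_iff[symmetric])
      also have "\<dots> \<le> (\<Sum>t\<in>T. (x t)\<^sup>2)" using t T by (intro member_le_sum) auto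
      finally have "1 \<le> (\<Sum>t\<in>T. (x t)\<^sup>2) / k\<^sup>2" using k by simp
      then have "2 * K * 1 \<le> 2 * K * ((\<Sum>t\<in>T. (x t)\<^sup>2) / k\<^sup>2)" using K by (intro mult_left_mono) auto
      moreover have "\<bar>g x - G (s x)\<bar> \<le> 2 * K"
        using bnd[of x] bnd[of "\<lambda>t. arcsin (s x t) / c"] unfolding G_def by linarith
      ultimately show ?thesis using pe by simp
    qed
  qed
qed

text \<open>Integrates the pointwise error of \<open>trig_approximation\<close>. Second moments at
  most 1 make the result independent of the law of \<open>v\<close>, which takes the place of
  tightness.\<close>

lemma integral_approximation:
  fixes g q :: "('i::countable \<Rightarrow> real) \<Rightarrow> real"
  assumes P: "prob_space P" and vm: "\<And>t. (\<lambda>\<omega>. v \<omega> t) \<in> borel_measurable P"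
    and vi: "\<And>t. t \<in> T \<Longrightarrow> integrable P (\<lambda>\<omega>. (v \<omega> t)\<^sup>2)" and v1: "\<And>t. t \<in> T \<Longrightarrow> (\<integral>\<omega>. (v \<omega> t)\<^sup>2 \<partial>P) \<le> 1"
    and cont: "continuous_on UNIV g" and bnd: "\<And>x. \<bar>g x\<bar> \<le> K" and K: "0 \<le> K"
    and q: "trig_sum T (\<lambda>x. complex_of_real (q x))" "\<And>x. \<bar>g x - q x\<bar> \<le> e + 2 * K * (\<Sum>t\<in>T. (x t)\<^sup>2) / k\<^sup>2"
  shows "\<bar>(\<integral>\<omega>. g (v \<omega>) \<partial>P) - (\<integral>\<omega>. q (v \<omega>) \<partial>P)\<bar> \<le> e + 2 * K * real (card T) / k\<^sup>2"
proof -
  interpret P: prob_space P by fact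
  have "v \<in> borel_measurable P" by (rule measurable_coordinatewise_then_product[OF vm])
  then have "(\<lambda>\<omega>. g (v \<omega>)) \<in> borel_measurable P"
    by (rule measurable_compose) (rule borel_measurable_continuous_onI[OF cont])
  then have gi: "integrable P (\<lambda>\<omega>. g (v \<omega>))"
    by (intro P.integrable_const_bound[where B=K]) (auto simp: bnd)
  have qi: "integrable P (\<lambda>\<omega>. q (v \<omega>))"
    using trig_sum_integrable[OF q(1) P vm] by (simp only: complex_of_real_integrable_eq)
  have si: "integrable P (\<lambda>\<omega>. \<Sum>t\<in>T. (v \<omega> t)\<^sup>2)" using vi by (rule Bochner_Integration.integrable_sum)
  have "\<bar>(\<integral>\<omega>. g (v \<omega>) \<partial>P) - (\<integral>\<omega>. q (v \<omega>) \<partial>P)\<bar> = \<bar>\<integral>\<omega>. g (v \<omega>) - q (v \<omega>) \<partial>P\<bar>"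
    using gi qi by simp
  also have "\<dots> \<le> (\<integral>\<omega>. \<bar>g (v \<omega>) - q (v \<omega>)\<bar> \<partial>P)" by (rule integral_abs_bound)
  also have "\<dots> \<le> (\<integral>\<omega>. e + 2 * K * (\<Sum>t\<in>T. (v \<omega> t)\<^sup>2) / k\<^sup>2 \<partial>P)"
    using gi qi si q(2) by (intro integral_mono) auto
  also have "\<dots> = e + 2 * K * (\<integral>\<omega>. (\<Sum>t\<in>T. (v \<omega> t)\<^sup>2) \<partial>P) / k\<^sup>2"
    using si by (simp add: P.prob_space)
  also have "(\<integral>\<omega>. (\<Sum>t\<in>T. (v \<omega> t)\<^sup>2) \<partial>P) = (\<Sum>t\<in>T. \<integral>\<omega>. (v \<omega> t)\<^sup>2 \<partial>P)"
    by (rule Bochner_Integration.integral_sum[OF vi])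
  also have "e + 2 * K * \<dots> / k\<^sup>2 \<le> e + 2 * K * real (card T) / k\<^sup>2"
    using sum_bounded_above[of T "\<lambda>t. \<integral>\<omega>. (v \<omega> t)\<^sup>2 \<partial>P" 1] v1 K
    by (intro add_left_mono divide_right_mono mult_left_mono) auto
  finally show ?thesis .
qed

text \<open>Hypothesis \<open>char\<close> gives convergence for trigonometric sums, and one such
  sum approximates \<open>g\<close> under the laws of all \<open>z n\<close> and of \<open>w\<close>
  simultaneously.\<close>

theorem cramer_wold_convergence:
  fixes g :: "('i::countable \<Rightarrow> real) \<Rightarrow> real" and z :: "nat \<Rightarrow> 'a \<Rightarrow> 'i \<Rightarrow> real" and w :: "'b \<Rightarrow> 'i \<Rightarrow> real"
  assumes M: "prob_space M" and N: "prob_space N" and T: "finite T"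
    and zm: "\<And>n t. (\<lambda>\<omega>. z n \<omega> t) \<in> borel_measurable M" and wm: "\<And>t. (\<lambda>\<omega>. w \<omega> t) \<in> borel_measurable N"
    and zi: "\<And>n t. t \<in> T \<Longrightarrow> integrable M (\<lambda>\<omega>. (z n \<omega> t)\<^sup>2)" and wi: "\<And>t. t \<in> T \<Longrightarrow> integrable N (\<lambda>\<omega>. (w \<omega> t)\<^sup>2)"
    and z1: "\<And>n t. t \<in> T \<Longrightarrow> (\<integral>\<omega>. (z n \<omega> t)\<^sup>2 \<partial>M) \<le> 1" and w1: "\<And>t. t \<in> T \<Longrightarrow> (\<integral>\<omega>. (w \<omega> t)\<^sup>2 \<partial>N) \<le> 1"
    and char: "\<And>a. (\<lambda>n. \<integral>\<omega>. cis (\<Sum>t\<in>T. a t * z n \<omega> t) \<partial>M) \<longlonglongrightarrow> (\<integral>\<omega>. cis (\<Sum>t\<in>T. a t * w \<omega> t) \<partial>N)"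
    and cont: "continuous_on UNIV g" and bnd: "\<And>x. \<bar>g x\<bar> \<le> K"
    and dep: "\<And>x y. (\<And>t. t \<in> T \<Longrightarrow> x t = y t) \<Longrightarrow> g x = g y"
  shows "(\<lambda>n. \<integral>\<omega>. g (z n \<omega>) \<partial>M) \<longlonglongrightarrow> (\<integral>\<omega>. g (w \<omega>) \<partial>N)"
proof (rule LIMSEQ_I)
  fix r :: real assume r: "0 < r"
  interpret M: prob_space M by fact
  interpret N: prob_space N by fact
  have K: "0 \<le> K" using bnd[of undefined] by linarith
  have conv: "(\<lambda>n. \<integral>\<omega>. f (z n \<omega>) \<partial>M) \<longlonglongrightarrow> (\<integral>\<omega>. f (w \<omega>) \<partial>N)" if "trig_sum T f" for f
    using that
  proof induction
    case (wave c a)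
    then show ?case using char[of a] by (auto intro: tendsto_mult_left)
  next
    case (add f g)
    then show ?case
      using trig_sum_integrable[OF add.hyps(1) M zm] trig_sum_integrable[OF add.hyps(2) M zm]
        trig_sum_integrable[OF add.hyps(1) N wm] trig_sum_integrable[OF add.hyps(2) N wm]
      by (simp add: tendsto_add)
  qed
  \<comment> \<open>\<open>A\<close> is the square of the box radius, large enough that the error
    outside the box is at most \<open>r / 8\<close>; the summand 1 keeps it positive if
    \<open>K\<close> or \<open>card T\<close> is 0.\<close>
  define A where "A = 16 * K * real (card T) / r + 1"
  have A: "0 < A" "2 * K * real (card T) / A \<le> r / 8"
  proof -
    show "0 < A" using K r by (auto simp: A_def intro: add_nonneg_pos)
    have "16 * K * real (card T) \<le> A * r" using r by (simp add: A_def field_simps)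
    then show "2 * K * real (card T) / A \<le> r / 8" using \<open>0 < A\<close> by (simp add: field_simps)
  qed
  define k where "k = sqrt A"
  have k: "0 < k" "k\<^sup>2 = A" using A by (auto simp: k_def)
  obtain q where q: "trig_sum T (\<lambda>x. complex_of_real (q x))"
    "\<And>x. \<bar>g x - q x\<bar> \<le> r / 8 + 2 * K * (\<Sum>t\<in>T. (x t)\<^sup>2) / k\<^sup>2"
    using trig_approximation[OF T cont bnd dep k(1), of "r / 8"] r by auto
  have "(\<lambda>n. complex_of_real (\<integral>\<omega>. q (z n \<omega>) \<partial>M)) \<longlonglongrightarrow> complex_of_real (\<integral>\<omega>. q (w \<omega>) \<partial>N)"
    using conv[OF q(1)] by (simp only: integral_complex_of_real)
  then have "(\<lambda>n. \<integral>\<omega>. q (z n \<omega>) \<partial>M) \<longlonglongrightarrow> (\<integral>\<omega>. q (w \<omega>) \<partial>N)" by (simp add: tendsto_of_real_iff)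
  from LIMSEQ_D[OF this, of "r / 4"] r
  obtain n0 where n0: "\<And>n. n \<ge> n0 \<Longrightarrow> norm ((\<integral>\<omega>. q (z n \<omega>) \<partial>M) - (\<integral>\<omega>. q (w \<omega>) \<partial>N)) < r / 4"
    by auto
  have small: "r / 8 + 2 * K * real (card T) / k\<^sup>2 \<le> r / 4" using A(2) k by simp
  show "\<exists>n0. \<forall>n\<ge>n0. norm ((\<integral>\<omega>. g (z n \<omega>) \<partial>M) - (\<integral>\<omega>. g (w \<omega>) \<partial>N)) < r"
  proof (intro exI allI impI)
    fix n assume "n0 \<le> n"
    have "\<bar>(\<integral>\<omega>. g (z n \<omega>) \<partial>M) - (\<integral>\<omega>. q (z n \<omega>) \<partial>M)\<bar> \<le> r / 4"
      by (rule order_trans[OF integral_approximation[OF M zm zi z1 cont bnd K q] small])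
    moreover have "\<bar>(\<integral>\<omega>. g (w \<omega>) \<partial>N) - (\<integral>\<omega>. q (w \<omega>) \<partial>N)\<bar> \<le> r / 4"
      by (rule order_trans[OF integral_approximation[OF N wm wi w1 cont bnd K q] small])
    moreover note n0[OF \<open>n0 \<le> n\<close>]
    ultimately
    show "norm ((\<integral>\<omega>. g (z n \<omega>) \<partial>M) - (\<integral>\<omega>. g (w \<omega>) \<partial>N)) < r"
      unfolding real_norm_def using r by linarith
  qed
qed

section \<open>Gaussian characteristic functions and the central limit theorem\<close>

lemma (in prob_space) integral_cis_std_normal:
  assumes "distributed M lborel Z std_normal_density"
  shows "(\<integral>\<omega>. cis (s * Z \<omega>) \<partial>M) = complex_of_real (exp (- s\<^sup>2 / 2))"
proof -
  have Zm: "Z \<in> borel_measurable M" using distributed_measurable[OF assms] by simp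
  have eq: "distr M lborel Z = std_normal_distribution" using assms by (simp add: distributed_def)
  have "(\<integral>\<omega>. cis (s * Z \<omega>) \<partial>M) = (\<integral>x. cis (s * x) \<partial>distr M lborel Z)"
    using Zm by (subst integral_distr) (auto simp: cis_conv_exp)
  also have "\<dots> = char std_normal_distribution s" unfolding eq char_def by (simp add: cis_conv_exp)
  finally show ?thesis by (simp add: char_std_normal_distribution)
qed

text \<open>The normal case reduces to the standard normal by scaling. In the degenerate case a mean
  of 0 forces the constant to be 0, and both sides of the last equation are 1.\<close>

lemma (in prob_space) gaussian_rv_moments:
  assumes Y: "gaussian_rv M Y"
  shows "integrable M Y" "integrable M (\<lambda>\<omega>. (Y \<omega>)\<^sup>2)"
    and "expectation Y = 0 \<Longrightarrow> (\<integral>\<omega>. cis (Y \<omega>) \<partial>M) = complex_of_real (exp (- expectation (\<lambda>\<omega>. (Y \<omega>)\<^sup>2) / 2))"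
proof -
  have Ym: "Y \<in> borel_measurable M" using Y by (simp add: gaussian_rv_def)
  have "integrable M Y \<and> integrable M (\<lambda>\<omega>. (Y \<omega>)\<^sup>2) \<and> (expectation Y = 0 \<longrightarrow>
      (\<integral>\<omega>. cis (Y \<omega>) \<partial>M) = complex_of_real (exp (- expectation (\<lambda>\<omega>. (Y \<omega>)\<^sup>2) / 2)))"
  proof -
    consider c where "AE \<omega> in M. Y \<omega> = c" | \<mu> \<sigma> where "0 < \<sigma>" "distributed M lborel Y (\<lambda>x. ennreal (normal_density \<mu> \<sigma> x))"
      using Y unfolding gaussian_rv_def by blast
    then show ?thesis
    proof cases
      case 1
      have cm: "(\<lambda>\<omega>. cis (Y \<omega>)) \<in> borel_measurable M" using Ym unfolding cis_conv_exp by measurable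
      have "integrable M Y \<longleftrightarrow> integrable M (\<lambda>_. c)" using 1 Ym by (intro integrable_cong_AE) auto
      moreover have "integrable M (\<lambda>\<omega>. (Y \<omega>)\<^sup>2) \<longleftrightarrow> integrable M (\<lambda>_. c\<^sup>2)"
        using 1 Ym by (intro integrable_cong_AE) auto
      moreover have "expectation Y = expectation (\<lambda>_. c)" using 1 Ym by (intro integral_cong_AE) auto
      moreover have "expectation (\<lambda>\<omega>. (Y \<omega>)\<^sup>2) = expectation (\<lambda>_. c\<^sup>2)" using 1 Ym by (intro integral_cong_AE) auto
      moreover have "(\<integral>\<omega>. cis (Y \<omega>) \<partial>M) = (\<integral>\<omega>. cis c \<partial>M)" using 1 cm by (intro integral_cong_AE) auto
      ultimately show ?thesis by (simp add: prob_space)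
    next
      case 2
      have nn: "\<And>x. x \<in> space lborel \<Longrightarrow> 0 \<le> normal_density \<mu> \<sigma> x" by simp
      have "integrable lborel (\<lambda>x. normal_density \<mu> \<sigma> x * (x - \<mu>)\<^sup>2)"
        by (rule integrable_normal_moment[OF 2(1)])
      moreover have "integrable lborel (\<lambda>x. normal_density \<mu> \<sigma> x * x)"
        by (rule integrable_normal_moment_nz_1[OF 2(1)])
      ultimately have i1: "integrable M Y" and i2: "integrable M (\<lambda>\<omega>. (Y \<omega> - \<mu>)\<^sup>2)"
        using distributed_integrable[OF 2(2), of "\<lambda>x. x"] distributed_integrable[OF 2(2), of "\<lambda>x. (x - \<mu>)\<^sup>2"] by auto
      have eq: "(Y \<omega>)\<^sup>2 = (Y \<omega> - \<mu>)\<^sup>2 + 2 * \<mu> * Y \<omega> - \<mu>\<^sup>2" for \<omega> by (simp add: power2_eq_square algebra_simps)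
      have "integrable M (\<lambda>\<omega>. (Y \<omega>)\<^sup>2)" unfolding eq using i1 i2 by simp
      moreover have "(\<integral>\<omega>. cis (Y \<omega>) \<partial>M) = complex_of_real (exp (- expectation (\<lambda>\<omega>. (Y \<omega>)\<^sup>2) / 2))"
        if "expectation Y = 0"
      proof -
        have "\<mu> = 0" using normal_distributed_expectation[OF 2] that by simp
        moreover have "expectation (\<lambda>\<omega>. (Y \<omega>)\<^sup>2) = \<sigma>\<^sup>2"
          using normal_distributed_variance[OF 2] that by simp
        moreover have "distributed M lborel (\<lambda>\<omega>. (Y \<omega> - \<mu>) / \<sigma>) std_normal_density"
          using normal_standard_normal_convert[OF 2(1), of Y \<mu>] 2(2) by simp
        ultimately show ?thesis
          using integral_cis_std_normal[of "\<lambda>\<omega>. (Y \<omega> - \<mu>) / \<sigma>" \<sigma>] 2(1) by simp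
      qed
      ultimately show ?thesis using i1 by blast
    qed
  qed
  then show "integrable M Y" "integrable M (\<lambda>\<omega>. (Y \<omega>)\<^sup>2)"
    "expectation Y = 0 \<Longrightarrow> (\<integral>\<omega>. cis (Y \<omega>) \<partial>M) = complex_of_real (exp (- expectation (\<lambda>\<omega>. (Y \<omega>)\<^sup>2) / 2))"
    by blast+
qed

text \<open>The central limit theorem and Levy continuity, read at the single frequency
  \<open>\<sigma>\<close>, which undoes the normalisation by the standard deviation. Zero variance
  is separate: then almost every path of the sums is 0.\<close>

lemma (in prob_space) central_limit_cis:
  fixes W :: "nat \<Rightarrow> 'a \<Rightarrow> real"
  assumes indep: "indep_vars (\<lambda>i. borel) W UNIV" and mean: "\<And>n. expectation (W n) = 0"
    and sq: "\<And>n. integrable M (\<lambda>\<omega>. (W n \<omega>)\<^sup>2)" and var: "\<And>n. expectation (\<lambda>\<omega>. (W n \<omega>)\<^sup>2) = v"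
    and ident: "\<And>n. distr M borel (W n) = \<mu>"
  shows "(\<lambda>n. \<integral>\<omega>. cis ((\<Sum>i<n. W i \<omega>) / sqrt (real n)) \<partial>M) \<longlonglongrightarrow> complex_of_real (exp (- v / 2))"
proof -
  have rv: "W n \<in> borel_measurable M" for n using indep unfolding indep_vars_def2 by auto
  have v0: "0 \<le> v" unfolding var[of 0, symmetric] by (intro Bochner_Integration.integral_nonneg) simp
  show ?thesis
  proof (cases "v = 0")
    case True
    have "AE \<omega> in M. W n \<omega> = 0" for n
      using integral_nonneg_eq_0_iff_AE[OF sq[of n]] var[of n] True by simp
    then have "AE \<omega> in M. \<forall>n. W n \<omega> = 0" by (simp add: AE_all_countable)
    then have *: "AE \<omega> in M. cis ((\<Sum>i<n. W i \<omega>) / sqrt (real n)) = 1" for n by eventually_elim simp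
    have "(\<integral>\<omega>. cis ((\<Sum>i<n. W i \<omega>) / sqrt (real n)) \<partial>M) = (\<integral>\<omega>. 1 \<partial>M)" for n
    proof (rule integral_cong_AE)
      have [measurable]: "(\<lambda>\<omega>. \<Sum>i<n. W i \<omega>) \<in> borel_measurable M" by (intro borel_measurable_sum rv)
      show "(\<lambda>\<omega>. cis ((\<Sum>i<n. W i \<omega>) / sqrt (real n))) \<in> borel_measurable M"
        unfolding cis_conv_exp by measurable
    qed (use * in auto)
    then show ?thesis using True by (simp add: prob_space)
  next
    case False
    define \<sigma> where "\<sigma> = sqrt v"
    have \<sigma>: "0 < \<sigma>" "\<sigma>\<^sup>2 = v" using False v0 by (auto simp: \<sigma>_def)
    let ?P = "\<lambda>n. distr M borel (\<lambda>\<omega>. (\<Sum>i<n. W i \<omega>) / sqrt (real n * \<sigma>\<^sup>2))"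
    have Sm: "(\<lambda>\<omega>. (\<Sum>i<n. W i \<omega>) / c) \<in> borel_measurable M" for n c
      by (intro borel_measurable_divide borel_measurable_sum rv borel_measurable_const)
    have "weak_conv_m ?P std_normal_distribution"
      by (rule central_limit_theorem_zero_mean[OF indep mean \<sigma>(1) sq _ ident]) (simp add: mean var \<sigma>)
    then have "(\<lambda>n. char (?P n) \<sigma>) \<longlonglongrightarrow> char std_normal_distribution \<sigma>"
      using Sm by (intro levy_continuity1 real_distribution_distr real_dist_normal_dist) auto
    moreover have "char (?P n) \<sigma> = (\<integral>\<omega>. cis ((\<Sum>i<n. W i \<omega>) / sqrt (real n)) \<partial>M)" for n
    proof -
      have eq: "\<sigma> * (x / sqrt (real n * \<sigma>\<^sup>2)) = x / sqrt (real n)" for x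
        using \<sigma>(1) by (simp add: real_sqrt_mult)
      have "char (?P n) \<sigma> = (\<integral>\<omega>. cis (\<sigma> * ((\<Sum>i<n. W i \<omega>) / sqrt (real n * \<sigma>\<^sup>2))) \<partial>M)"
        unfolding char_def using Sm by (subst integral_distr) (auto simp: cis_conv_exp)
      then show ?thesis by (simp only: eq)
    qed
    ultimately show ?thesis by (simp add: char_std_normal_distribution \<sigma>)
  qed
qed

lemma (in prob_space) integrable_mult_square:
  fixes f g :: "'a \<Rightarrow> real"
  assumes "f \<in> borel_measurable M" "g \<in> borel_measurable M"
    and "integrable M (\<lambda>\<omega>. (f \<omega>)\<^sup>2)" "integrable M (\<lambda>\<omega>. (g \<omega>)\<^sup>2)"
  shows "integrable M (\<lambda>\<omega>. f \<omega> * g \<omega>)"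
proof (rule Bochner_Integration.integrable_bound)
  show "integrable M (\<lambda>\<omega>. (f \<omega>)\<^sup>2 + (g \<omega>)\<^sup>2)" using assms by simp
  show "AE \<omega> in M. norm (f \<omega> * g \<omega>) \<le> norm ((f \<omega>)\<^sup>2 + (g \<omega>)\<^sup>2)"
  proof (rule AE_I2)
    fix \<omega>
    have "0 \<le> (\<bar>f \<omega>\<bar> - \<bar>g \<omega>\<bar>)\<^sup>2" by simp
    then have "2 * (\<bar>f \<omega>\<bar> * \<bar>g \<omega>\<bar>) \<le> (f \<omega>)\<^sup>2 + (g \<omega>)\<^sup>2" by (simp add: power2_eq_square algebra_simps)
    moreover have "0 \<le> \<bar>f \<omega>\<bar> * \<bar>g \<omega>\<bar>" by (intro mult_nonneg_nonneg) auto
    ultimately have "\<bar>f \<omega>\<bar> * \<bar>g \<omega>\<bar> \<le> (f \<omega>)\<^sup>2 + (g \<omega>)\<^sup>2" by linarith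
    then show "norm (f \<omega> * g \<omega>) \<le> norm ((f \<omega>)\<^sup>2 + (g \<omega>)\<^sup>2)" by (simp add: abs_mult)
  qed
qed (use assms in simp)

lemma (in prob_space) expectation_square_sum:
  fixes f :: "'t \<Rightarrow> 'a \<Rightarrow> real"
  assumes T: "finite T" and m: "\<And>t. t \<in> T \<Longrightarrow> f t \<in> borel_measurable M" "\<And>t. t \<in> T \<Longrightarrow> integrable M (\<lambda>\<omega>. (f t \<omega>)\<^sup>2)"
  shows "expectation (\<lambda>\<omega>. (\<Sum>t\<in>T. a t * f t \<omega>)\<^sup>2) = (\<Sum>s\<in>T. \<Sum>t\<in>T. a s * a t * expectation (\<lambda>\<omega>. f s \<omega> * f t \<omega>))"
proof -
  have i: "integrable M (\<lambda>\<omega>. f s \<omega> * f t \<omega>)" if "s \<in> T" "t \<in> T" for s t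
    using that m by (intro integrable_mult_square) auto
  have eq: "(\<Sum>t\<in>T. a t * f t \<omega>)\<^sup>2 = (\<Sum>s\<in>T. \<Sum>t\<in>T. a s * a t * (f s \<omega> * f t \<omega>))" for \<omega>
    unfolding power2_eq_square sum_product by (intro sum.cong refl) (simp add: algebra_simps)
  show ?thesis
    unfolding eq using i by (simp add: Bochner_Integration.integral_sum Bochner_Integration.integrable_sum)
qed

text \<open>Induction: the new summand is centred and independent of the sum of the others, so the
  cross term has expectation 0.\<close>

lemma (in prob_space) expectation_square_sum_indep:
  fixes W :: "'i \<Rightarrow> 'a \<Rightarrow> real"
  assumes "finite I" and "indep_vars (\<lambda>_. borel) W I" and bnd: "\<And>i \<omega>. i \<in> I \<Longrightarrow> \<bar>W i \<omega>\<bar> \<le> b"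
    and mean: "\<And>i. i \<in> I \<Longrightarrow> expectation (W i) = 0"
  shows "expectation (\<lambda>\<omega>. (\<Sum>i\<in>I. W i \<omega>)\<^sup>2) = (\<Sum>i\<in>I. expectation (\<lambda>\<omega>. (W i \<omega>)\<^sup>2))"
  using assms
proof (induction I rule: finite_induct)
  case empty
  then show ?case by simp
next
  case (insert j I)
  have rv: "W i \<in> borel_measurable M" if "i \<in> insert j I" for i
    using insert.prems(1) that unfolding indep_vars_def2 by auto
  have ind: "indep_vars (\<lambda>_. borel) W I" by (rule indep_vars_subset[OF insert.prems(1)]) auto
  have IH: "expectation (\<lambda>\<omega>. (\<Sum>i\<in>I. W i \<omega>)\<^sup>2) = (\<Sum>i\<in>I. expectation (\<lambda>\<omega>. (W i \<omega>)\<^sup>2))"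
    by (rule insert.IH[OF ind]) (use insert.prems in auto)
  let ?S = "\<lambda>\<omega>. \<Sum>i\<in>I. W i \<omega>"
  have iv: "indep_var borel (W j) borel ?S"
    by (rule indep_vars_sum[OF insert.hyps insert.prems(1)])
  have Sm: "?S \<in> borel_measurable M" by (intro borel_measurable_sum rv) auto
  have i1: "integrable M (W i)" if "i \<in> insert j I" for i
    using rv[OF that] insert.prems(2)[OF that] by (intro integrable_const_bound[where B=b]) auto
  have Sb: "\<bar>?S \<omega>\<bar> \<le> real (card I) * b" for \<omega>
    by (rule order_trans[OF sum_abs sum_bounded_above]) (use insert.prems(2) in auto)
  have iS: "integrable M ?S" by (intro Bochner_Integration.integrable_sum i1) auto
  have iS2: "integrable M (\<lambda>\<omega>. (?S \<omega>)\<^sup>2)"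
  proof (rule integrable_const_bound[where B="(real (card I) * b)\<^sup>2"])
    show "AE \<omega> in M. norm ((?S \<omega>)\<^sup>2) \<le> (real (card I) * b)\<^sup>2"
      using power_mono[OF Sb, where n=2] by (intro AE_I2) simp
  qed (use Sm in measurable)
  have ij2: "integrable M (\<lambda>\<omega>. (W j \<omega>)\<^sup>2)"
  proof (rule integrable_const_bound[where B="b\<^sup>2"])
    show "AE \<omega> in M. norm ((W j \<omega>)\<^sup>2) \<le> b\<^sup>2"
      using power_mono[OF insert.prems(2)[of j], where n=2] by (intro AE_I2) simp
  qed (use rv[of j] in measurable)
  have prod: "expectation (\<lambda>\<omega>. W j \<omega> * ?S \<omega>) = 0"
    using indep_var_lebesgue_integral[OF iv i1[of j] iS] insert.prems(3)[of j] by simp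
  have iprod: "integrable M (\<lambda>\<omega>. W j \<omega> * ?S \<omega>)"
    by (rule integrable_mult_square[OF rv[OF insertI1] Sm ij2 iS2])
  have "expectation (\<lambda>\<omega>. (\<Sum>i\<in>insert j I. W i \<omega>)\<^sup>2)
      = expectation (\<lambda>\<omega>. (W j \<omega>)\<^sup>2 + 2 * (W j \<omega> * ?S \<omega>) + (?S \<omega>)\<^sup>2)"
    using insert.hyps by (simp add: power2_eq_square algebra_simps)
  also have "\<dots> = expectation (\<lambda>\<omega>. (W j \<omega>)\<^sup>2) + expectation (\<lambda>\<omega>. (?S \<omega>)\<^sup>2)"
    using ij2 iprod iS2 prod by simp
  finally show ?case using IH insert.hyps by simp
qed

text \<open>Serves, with \<open>h = Suc\<close>, to move the sample from indices starting at 1 to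
  the index set \<open>UNIV\<close> of the central limit theorem.\<close>

lemma (in prob_space) indep_vars_reindex_inj:
  assumes "indep_vars M' X I" "inj_on h J" "h ` J \<subseteq> I"
  shows "indep_vars (\<lambda>j. M' (h j)) (\<lambda>j. X (h j)) J"
proof -
  have rv: "\<And>i. i \<in> I \<Longrightarrow> random_variable (M' i) (X i)"
    and ind: "indep_sets (\<lambda>i. {X i -` A \<inter> space M | A. A \<in> sets (M' i)}) I"
    using assms(1) by (auto simp: indep_vars_def2)
  have "indep_sets (\<lambda>j. {X (h j) -` A \<inter> space M | A. A \<in> sets (M' (h j))}) J"
  proof (rule indep_setsI)
    show "{X (h j) -` A \<inter> space M | A. A \<in> sets (M' (h j))} \<subseteq> events" if "j \<in> J" for j
      using rv[of "h j"] that assms(3) by (auto intro: measurable_sets)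
    fix A K assume K: "K \<noteq> {}" "K \<subseteq> J" "finite K"
      and A: "\<forall>j\<in>K. A j \<in> {X (h j) -` A \<inter> space M | A. A \<in> sets (M' (h j))}"
    define B where "B i = A (the_inv_into J h i)" for i
    have BA: "B (h j) = A j" if "j \<in> K" for j
      using that K the_inv_into_f_f[OF assms(2)] by (auto simp: B_def)
    have injK: "inj_on h K" using assms(2) K(2) by (rule inj_on_subset)
    have "prob (\<Inter>i\<in>h ` K. B i) = (\<Prod>i\<in>h ` K. prob (B i))"
      by (rule indep_setsD[OF ind]) (use K assms(3) A BA in auto)
    then show "prob (\<Inter>j\<in>K. A j) = (\<Prod>j\<in>K. prob (A j))"
      using BA by (simp add: prod.reindex[OF injK] image_image cong: prod.cong INF_cong)
  qed
  then show ?thesis using rv assms(3) by (auto simp: indep_vars_def2)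
qed

section \<open>Finite-dimensional laws of the empirical process\<close>

locale iid_copula_sample = copula_sample +
  assumes ident: "\<And>i. 1 \<le> i \<Longrightarrow> distr M borel (U i) = distr M borel (U 1)"
begin

text \<open>Two lower left quadrants meet in the quadrant with the componentwise minimum as corner,
  so the product of indicators is again an indicator.\<close>

lemma expectation_centered_product:
  assumes i: "1 \<le> i" and u: "u \<in> unit_square" "v \<in> unit_square"
  shows "expectation (\<lambda>\<omega>. (below u (U i \<omega>) - C u) * (below v (U i \<omega>) - C v))
    = C (min (fst u) (fst v), min (snd u) (snd v)) - C u * C v"
proof -
  define w where "w = (min (fst u) (fst v), min (snd u) (snd v))"
  have w: "w \<in> unit_square" using u by (simp add: w_def mem_Times_iff min_def)
  have eq: "(below u p - C u) * (below v p - C v) = below w p - C v * below u p - C u * below v p + C u * C v" for p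
    by (auto simp: below_def w_def algebra_simps)
  have "expectation (\<lambda>\<omega>. (below u (U i \<omega>) - C u) * (below v (U i \<omega>) - C v))
      = expectation (\<lambda>\<omega>. below w (U i \<omega>)) - C v * expectation (\<lambda>\<omega>. below u (U i \<omega>))
        - C u * expectation (\<lambda>\<omega>. below v (U i \<omega>)) + C u * C v"
    unfolding eq by (simp add: below_integrable[OF i] prob_space)
  also have "\<dots> = C w - C u * C v"
    unfolding expectation_below[OF i u(1)] expectation_below[OF i u(2)] expectation_below[OF i w] by simp
  finally show ?thesis by (simp add: w_def)
qed

text \<open>Variances of independent summands add and each is at most 1, which the normalisation by
  \<open>sqrt n\<close> turns into a bound free of \<open>n\<close>, as
  \<open>cramer_wold_convergence\<close> demands.\<close>

lemma emp_process_second_moment: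
  assumes u: "u \<in> unit_square"
  shows "integrable M (\<lambda>\<omega>. (emp_process n \<omega> u)\<^sup>2)" "expectation (\<lambda>\<omega>. (emp_process n \<omega> u)\<^sup>2) \<le> 1"
proof -
  define W where "W i \<omega> = below u (U i \<omega>) - C u" for i \<omega>
  have C01: "C u \<in> {0..1}" using u range01[of "fst u" "snd u"] by (simp add: mem_Times_iff)
  have W1: "\<bar>W i \<omega>\<bar> \<le> 1" for i \<omega> using C01 by (auto simp: W_def below_def)
  have Wrv: "W i \<in> borel_measurable M" if "1 \<le> i" for i
    unfolding W_def by (intro borel_measurable_diff below_rv that borel_measurable_const)
  have Wsq: "\<bar>(W i \<omega>)\<^sup>2\<bar> \<le> 1" for i \<omega> using W1[of i \<omega>] by (simp add: abs_square_le_1)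
  have W2: "expectation (\<lambda>\<omega>. (W i \<omega>)\<^sup>2) \<le> 1" if "1 \<le> i" for i
  proof -
    have "expectation (\<lambda>\<omega>. (W i \<omega>)\<^sup>2) \<le> expectation (\<lambda>_. 1)"
    proof (rule integral_mono)
      show "integrable M (\<lambda>\<omega>. (W i \<omega>)\<^sup>2)"
        using Wrv[OF that] Wsq by (intro integrable_const_bound[where B=1]) auto
    qed (use Wsq in \<open>auto simp: abs_le_iff\<close>)
    then show ?thesis by (simp add: prob_space)
  qed
  have ind: "indep_vars (\<lambda>_. borel) W {1..n}"
    unfolding W_def by (rule indep_vars_compose2[OF indep_vars_subset[OF indep]]) auto
  have "expectation (\<lambda>\<omega>. (\<Sum>i\<in>{1..n}. W i \<omega>)\<^sup>2) = (\<Sum>i\<in>{1..n}. expectation (\<lambda>\<omega>. (W i \<omega>)\<^sup>2))"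
  proof (rule expectation_square_sum_indep[OF _ ind W1])
    show "expectation (W i) = 0" if "i \<in> {1..n}" for i
      unfolding W_def using that below_integrable[of i u] expectation_below[of i u] u by (simp add: prob_space)
  qed simp
  also have "\<dots> \<le> (\<Sum>i\<in>{1..n}. 1)" using W2 by (intro sum_mono) auto
  finally have S: "expectation (\<lambda>\<omega>. (\<Sum>i\<in>{1..n}. W i \<omega>)\<^sup>2) \<le> real n" by simp
  have eq: "(emp_process n \<omega> u)\<^sup>2 = (\<Sum>i\<in>{1..n}. W i \<omega>)\<^sup>2 / real n" for \<omega>
    by (simp add: empirical_process_def W_def power_divide)
  show "expectation (\<lambda>\<omega>. (emp_process n \<omega> u)\<^sup>2) \<le> 1"
    unfolding eq using S by (cases "n = 0") (simp_all add: field_simps)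
  have Sb: "\<bar>\<Sum>i\<in>{1..n}. W i \<omega>\<bar> \<le> real n" for \<omega>
    using order_trans[OF sum_abs sum_bounded_above[of "{1..n}" "\<lambda>i. \<bar>W i \<omega>\<bar>" 1]] W1 by simp
  have "integrable M (\<lambda>\<omega>. (\<Sum>i\<in>{1..n}. W i \<omega>)\<^sup>2)"
  proof (rule integrable_const_bound[where B="(real n)\<^sup>2"])
    show "AE \<omega> in M. norm ((\<Sum>i\<in>{1..n}. W i \<omega>)\<^sup>2) \<le> (real n)\<^sup>2"
      using power_mono[OF Sb, where n=2] by (intro AE_I2) simp
    show "(\<lambda>\<omega>. (\<Sum>i\<in>{1..n}. W i \<omega>)\<^sup>2) \<in> borel_measurable M"
      by (intro borel_measurable_power borel_measurable_sum Wrv) auto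
  qed
  then show "integrable M (\<lambda>\<omega>. (emp_process n \<omega> u)\<^sup>2)" unfolding eq by simp
qed

text \<open>Exchanging the sums over grid and sample exhibits the linear combination as a normalised
  sum of i.i.d. bounded centred variables \<open>Y (U i)\<close>, whose variance is the quadratic
  form in the exponent.\<close>

lemma emp_process_fidi_cis:
  assumes T: "finite T" and u: "\<And>t. t \<in> T \<Longrightarrow> u t \<in> unit_square"
  shows "(\<lambda>n. \<integral>\<omega>. cis (\<Sum>t\<in>T. a t * emp_process n \<omega> (u t)) \<partial>M) \<longlonglongrightarrow>
    complex_of_real (exp (- (\<Sum>s\<in>T. \<Sum>t\<in>T. a s * a t *
      (C (min (fst (u s)) (fst (u t)), min (snd (u s)) (snd (u t))) - C (u s) * C (u t))) / 2))"
proof -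
  define Y where "Y p = (\<Sum>t\<in>T. a t * (below (u t) p - C (u t)))" for p
  have Ym: "Y \<in> borel_measurable borel" unfolding Y_def by measurable
  have cm: "(\<lambda>\<omega>. below (u t) (U i \<omega>) - C (u t)) \<in> borel_measurable M" if "1 \<le> i" for t i
    by (intro borel_measurable_diff below_rv that borel_measurable_const)
  have csq: "integrable M (\<lambda>\<omega>. (below (u t) (U i \<omega>) - C (u t))\<^sup>2)" if "1 \<le> i" "t \<in> T" for t i
  proof (rule integrable_const_bound[where B=1])
    have "C (u t) \<in> {0..1}" using u[OF that(2)] range01[of "fst (u t)" "snd (u t)"] by (simp add: mem_Times_iff)
    then have "\<bar>below (u t) p - C (u t)\<bar> \<le> 1" for p by (auto simp: below_def)
    then show "AE \<omega> in M. norm ((below (u t) (U i \<omega>) - C (u t))\<^sup>2) \<le> 1"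
      by (auto simp: abs_square_le_1)
  qed (use cm[OF that(1)] in measurable)
  let ?v = "\<Sum>s\<in>T. \<Sum>t\<in>T. a s * a t * (C (min (fst (u s)) (fst (u t)), min (snd (u s)) (snd (u t))) - C (u s) * C (u t))"
  have var: "expectation (\<lambda>\<omega>. (Y (U i \<omega>))\<^sup>2) = ?v" if i: "1 \<le> i" for i
  proof -
    have "expectation (\<lambda>\<omega>. (Y (U i \<omega>))\<^sup>2) = (\<Sum>s\<in>T. \<Sum>t\<in>T. a s * a t *
        expectation (\<lambda>\<omega>. (below (u s) (U i \<omega>) - C (u s)) * (below (u t) (U i \<omega>) - C (u t))))"
      unfolding Y_def by (rule expectation_square_sum[OF T cm[OF i] csq[OF i]])
    also have "\<dots> = ?v" using u by (intro sum.cong refl) (simp add: expectation_centered_product[OF i])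
    finally show ?thesis .
  qed
  have Ybound: "\<bar>Y p\<bar> \<le> (\<Sum>t\<in>T. \<bar>a t\<bar>)" for p
    unfolding Y_def
  proof (rule order_trans[OF sum_abs], rule sum_mono)
    fix t assume t: "t \<in> T"
    have "C (u t) \<in> {0..1}" using u[OF t] range01[of "fst (u t)" "snd (u t)"] by (simp add: mem_Times_iff)
    then have "\<bar>below (u t) p - C (u t)\<bar> \<le> 1" by (auto simp: below_def)
    then show "\<bar>a t * (below (u t) p - C (u t))\<bar> \<le> \<bar>a t\<bar>" by (simp add: abs_mult mult_left_le)
  qed
  have Urv: "(\<lambda>\<omega>. Y (U i \<omega>)) \<in> borel_measurable M" if "1 \<le> i" for i
    by (rule measurable_compose[OF U_measurable[OF that] Ym])
  have clt: "(\<lambda>n. \<integral>\<omega>. cis ((\<Sum>i<n. Y (U (Suc i) \<omega>)) / sqrt (real n)) \<partial>M) \<longlonglongrightarrow> complex_of_real (exp (- ?v / 2))"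
  proof (rule central_limit_cis)
    have "indep_vars (\<lambda>_. borel) (\<lambda>i. U (Suc i)) UNIV"
      by (rule indep_vars_reindex_inj[OF indep]) auto
    then show "indep_vars (\<lambda>i. borel) (\<lambda>i \<omega>. Y (U (Suc i) \<omega>)) UNIV"
      by (rule indep_vars_compose2) (rule Ym)
    show "expectation (\<lambda>\<omega>. Y (U (Suc n) \<omega>)) = 0" for n
    proof -
      have "expectation (\<lambda>\<omega>. Y (U (Suc n) \<omega>)) = (\<Sum>t\<in>T. expectation (\<lambda>\<omega>. a t * (below (u t) (U (Suc n) \<omega>) - C (u t))))"
        unfolding Y_def by (rule Bochner_Integration.integral_sum) (simp add: below_integrable)
      also have "\<dots> = 0"
        using u by (intro sum.neutral ballI) (simp add: below_integrable expectation_below prob_space)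
      finally show ?thesis .
    qed
    show "integrable M (\<lambda>\<omega>. (Y (U (Suc n) \<omega>))\<^sup>2)" for n
    proof (rule integrable_const_bound[where B="(\<Sum>t\<in>T. \<bar>a t\<bar>)\<^sup>2"])
      show "AE \<omega> in M. norm ((Y (U (Suc n) \<omega>))\<^sup>2) \<le> (\<Sum>t\<in>T. \<bar>a t\<bar>)\<^sup>2"
        using power_mono[OF Ybound, where n=2] by (intro AE_I2) simp
    qed (use Urv[of "Suc n"] in measurable)
    show "expectation (\<lambda>\<omega>. (Y (U (Suc n) \<omega>))\<^sup>2) = ?v" for n by (rule var) simp
    show "distr M borel (\<lambda>\<omega>. Y (U (Suc n) \<omega>)) = distr (distr M borel (U 1)) borel Y" for n
      using distr_distr[OF Ym, of "U (Suc n)" M] U_measurable[of "Suc n"] ident[of "Suc n"] by (simp add: comp_def)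
  qed
  have eq: "(\<Sum>t\<in>T. a t * emp_process n \<omega> (u t)) = (\<Sum>i<n. Y (U (Suc i) \<omega>)) / sqrt (real n)" for n \<omega>
  proof -
    have "(\<Sum>t\<in>T. a t * emp_process n \<omega> (u t)) = (\<Sum>t\<in>T. \<Sum>i\<in>{1..n}. a t * (below (u t) (U i \<omega>) - C (u t))) / sqrt (real n)"
      by (simp add: empirical_process_def sum_distrib_left sum_divide_distrib)
    also have "(\<Sum>t\<in>T. \<Sum>i\<in>{1..n}. a t * (below (u t) (U i \<omega>) - C (u t))) = (\<Sum>i\<in>{1..n}. Y (U i \<omega>))"
      unfolding Y_def by (rule sum.swap)
    also have "\<dots> = (\<Sum>i<n. Y (U (Suc i) \<omega>))"
      by (rule sum.reindex_bij_witness[of _ Suc "\<lambda>i. i - 1"]) auto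
    finally show ?thesis .
  qed
  show ?thesis unfolding eq by (rule clt)
qed

end

section \<open>Finite-dimensional laws of the bridge\<close>

lemma C_brownian_bridge_gaussian:
  assumes B: "C_brownian_bridge C N B" and S: "finite S" "S \<subseteq> unit_square"
  shows "gaussian_rv N (\<lambda>\<omega>. \<Sum>t\<in>S. a t * B \<omega> t)"
proof -
  have "\<forall>S a. finite S \<and> S \<subseteq> unit_square \<longrightarrow> gaussian_rv N (\<lambda>\<omega>. \<Sum>t\<in>S. a t * B \<omega> t)"
    using B unfolding C_brownian_bridge_def gaussian_field_def by (elim conjE)
  from this[rule_format, OF conjI[OF S]] show ?thesis .
qed

lemma C_brownian_bridge_moments:
  assumes N: "prob_space N" and B: "C_brownian_bridge C N B" and u: "u \<in> unit_square"
  shows "(\<lambda>\<omega>. B \<omega> u) \<in> borel_measurable N" "integrable N (\<lambda>\<omega>. B \<omega> u)" "integrable N (\<lambda>\<omega>. (B \<omega> u)\<^sup>2)"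
    "(\<integral>\<omega>. B \<omega> u \<partial>N) = 0"
proof -
  interpret N: prob_space N by fact
  have "gaussian_rv N (\<lambda>\<omega>. \<Sum>t\<in>{u}. 1 * B \<omega> t)"
    by (rule C_brownian_bridge_gaussian[OF B]) (use u in simp_all)
  then have g: "gaussian_rv N (\<lambda>\<omega>. B \<omega> u)" by simp
  from g show "(\<lambda>\<omega>. B \<omega> u) \<in> borel_measurable N" by (simp add: gaussian_rv_def)
  show "integrable N (\<lambda>\<omega>. B \<omega> u)" "integrable N (\<lambda>\<omega>. (B \<omega> u)\<^sup>2)" using N.gaussian_rv_moments[OF g] by auto
  show "(\<integral>\<omega>. B \<omega> u \<partial>N) = 0" using B u unfolding C_brownian_bridge_def by blast
qed

lemma C_brownian_bridge_product:
  assumes N: "prob_space N" and B: "C_brownian_bridge C N B" and u: "u \<in> unit_square" and v: "v \<in> unit_square"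
  shows "(\<integral>\<omega>. B \<omega> u * B \<omega> v \<partial>N) = C (min (fst u) (fst v), min (snd u) (snd v)) - C u * C v"
proof -
  have "covariance N (\<lambda>\<omega>. B \<omega> u) (\<lambda>\<omega>. B \<omega> v) = C (min (fst u) (fst v), min (snd u) (snd v)) - C u * C v"
    using B u v unfolding C_brownian_bridge_def by blast
  then show ?thesis
    by (simp add: covariance_def C_brownian_bridge_moments(4)[OF N B u] C_brownian_bridge_moments(4)[OF N B v])
qed

text \<open>The same exponent as in \<open>emp_process_fidi_cis\<close>, so the finite-dimensional
  limits match. A Gaussian field is tested on sets of points, whereas the sum here runs over
  indices; injectivity of \<open>u\<close> translates between the two.\<close>

lemma C_brownian_bridge_fidi_cis:
  assumes N: "prob_space N" and B: "C_brownian_bridge C N B" and T: "finite T" and inj: "inj_on u T"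
    and u: "\<And>t. t \<in> T \<Longrightarrow> u t \<in> unit_square"
  shows "(\<integral>\<omega>. cis (\<Sum>t\<in>T. a t * B \<omega> (u t)) \<partial>N) =
    complex_of_real (exp (- (\<Sum>s\<in>T. \<Sum>t\<in>T. a s * a t *
      (C (min (fst (u s)) (fst (u t)), min (snd (u s)) (snd (u t))) - C (u s) * C (u t))) / 2))"
proof -
  interpret N: prob_space N by fact
  note m = C_brownian_bridge_moments[OF N B u]
  let ?W = "\<lambda>\<omega>. \<Sum>t\<in>T. a t * B \<omega> (u t)"
  have eq: "?W \<omega> = (\<Sum>s\<in>u ` T. a (the_inv_into T u s) * B \<omega> s)" for \<omega>
    using the_inv_into_f_f[OF inj] by (simp add: sum.reindex[OF inj])
  have sub: "u ` T \<subseteq> unit_square" by (rule image_subsetI) (rule u)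
  have "gaussian_rv N (\<lambda>\<omega>. \<Sum>s\<in>u ` T. a (the_inv_into T u s) * B \<omega> s)"
    by (rule C_brownian_bridge_gaussian[OF B finite_imageI[OF T] sub])
  then have g: "gaussian_rv N ?W" unfolding eq .
  have "(\<integral>\<omega>. ?W \<omega> \<partial>N) = (\<Sum>t\<in>T. \<integral>\<omega>. a t * B \<omega> (u t) \<partial>N)"
    by (rule Bochner_Integration.integral_sum) (simp add: m)
  also have "\<dots> = 0" by (intro sum.neutral) (simp add: m)
  finally have mean: "(\<integral>\<omega>. ?W \<omega> \<partial>N) = 0" .
  have "(\<integral>\<omega>. (?W \<omega>)\<^sup>2 \<partial>N) = (\<Sum>s\<in>T. \<Sum>t\<in>T. a s * a t * (\<integral>\<omega>. B \<omega> (u s) * B \<omega> (u t) \<partial>N))"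
    by (rule N.expectation_square_sum[OF T m(1) m(3)])
  then show ?thesis
    using N.gaussian_rv_moments(3)[OF g mean] by (simp add: C_brownian_bridge_product[OF N B u u])
qed

section \<open>Empirical copulas and the probability integral transform\<close>

text \<open>No strict monotonicity is available, so the half-line has to end at the last point of a
  possible plateau at height \<open>v\<close>. The first two alternatives are the whole line and the
  empty set, which have no such end point.\<close>

lemma sublevel_continuous_mono:
  fixes F :: "real \<Rightarrow> real"
  assumes mono: "mono F" and cont: "continuous_on UNIV F" and bot: "(F \<longlongrightarrow> 0) at_bot" and top: "(F \<longlongrightarrow> 1) at_top"
    and v: "v \<in> {0..1}"
  obtains "v = 1" "{x. F x \<le> v} = UNIV" | "v = 0" "{x. F x \<le> v} = {}" | c where "F c = v" "{x. F x \<le> v} = {..c}"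
proof -
  have le1: "F x \<le> 1" for x
    by (rule tendsto_lowerbound[OF top]) (auto intro: eventually_at_top_linorderI[of x] monoD[OF mono])
  let ?S = "{x. F x \<le> v}"
  show thesis
  proof (cases "v = 1")
    case True
    then show ?thesis using le1 by (intro that(1)) auto
  next
    case False
    then have "v < 1" using v by simp
    show ?thesis
    proof (cases "?S = {}")
      case True
      have "v \<le> 0"
      proof (rule tendsto_lowerbound[OF bot])
        show "\<forall>\<^sub>F x in at_bot. v \<le> F x" using True by (intro always_eventually) (auto simp: not_le less_imp_le)
      qed simp
      then show ?thesis using that(2) v True by auto
    next
      case False
      have "\<forall>\<^sub>F x in at_top. v < F x" using top \<open>v < 1\<close> by (rule order_tendstoD)
      then obtain b where b: "v < F b" by (metis eventually_at_top_linorder order_refl)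
      have up: "x \<le> b" if "x \<in> ?S" for x
        using that b monoD[OF mono, of b x] by (cases "x \<le> b") auto
      then have bdd: "bdd_above ?S" by (auto simp: bdd_above_def)
      define c where "c = Sup ?S"
      have "closed ?S"
        using closed_Collect_le[OF cont continuous_on_const[of UNIV v]] by simp
      then have cS: "c \<in> ?S" unfolding c_def by (rule closed_contains_Sup[OF False bdd])
      have eq: "?S = {..c}"
        using cS cSup_upper[OF _ bdd] monoD[OF mono] unfolding c_def by (auto intro: order_trans)
      \<comment> \<open>If \<open>F c < v\<close>, continuity keeps \<open>F\<close> below
        \<open>v\<close> slightly to the right of \<open>c\<close>, contradicting maximality of
        \<open>c\<close>.\<close>
      have "F c = v"
      proof (rule ccontr)
        assume "F c \<noteq> v"
        then have lt: "F c < v" using cS by simp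
        have "\<forall>\<^sub>F x in at_right c. F x < v"
          using cont lt by (intro order_tendstoD(2)[OF _ lt]) (auto simp: continuous_on_def intro: tendsto_within_subset)
        then obtain d where d: "d > c" "\<And>y. c < y \<Longrightarrow> y < d \<Longrightarrow> F y < v"
          by (auto simp: eventually_at_right_field)
        then have "F ((c + d) / 2) \<le> v" by (intro less_imp_le d(2)) auto
        then have "(c + d) / 2 \<le> c" using eq by blast
        then show False using d(1) by simp
      qed
      then show ?thesis using that(3) eq by blast
    qed
  qed
qed

lemma gen_inverse_zero: "(\<And>t. 0 \<le> F t) \<Longrightarrow> gen_inverse F 0 = -\<infinity>"
proof -
  assume "\<And>t. 0 \<le> F t"
  then have "{t. 0 \<le> F t} = UNIV" by auto
  then have "gen_inverse F 0 = (INF t. ereal t)" by (simp add: gen_inverse_def)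
  moreover have "(INF t. ereal t) \<le> y" for y
  proof (rule ereal_le_real)
    fix z assume "y \<le> ereal z"
    show "(INF t. ereal t) \<le> ereal z" by (rule INF_lower) simp
  qed
  ultimately show ?thesis using ereal_infty_less_eq(2) by metis
qed

text \<open>The quantile is the smallest sample value at which the empirical distribution function
  reaches \<open>x\<close>. The last conclusion bounds its left limit there.\<close>

lemma empirical_quantile:
  fixes s :: "nat \<Rightarrow> real"
  assumes n: "1 \<le> n" and x: "0 < x" "x \<le> 1"
  defines "F \<equiv> \<lambda>t. real (card {i \<in> {1..n}. s i \<le> t}) / real n"
  obtains a where "gen_inverse F x = ereal a" "x \<le> F a" "real (card {i \<in> {1..n}. s i < a}) / real n < x"
proof -
  have mono: "F t \<le> F t'" if "t \<le> t'" for t t'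
    unfolding F_def using that by (intro divide_right_mono of_nat_mono card_mono) auto
  let ?A = "s ` {i \<in> {1..n}. x \<le> F (s i)}"
  have fin: "finite ?A" by simp
  \<comment> \<open>The empirical distribution function only changes at sample values, so
    \<open>t\<close> may be replaced by the largest sample value not exceeding it.\<close>
  have jump: "\<exists>j\<in>{1..n}. s j \<le> t \<and> F t = F (s j)" if "{i \<in> {1..n}. s i \<le> t} \<noteq> {}" for t
  proof -
    let ?B = "s ` {i \<in> {1..n}. s i \<le> t}"
    have "Max ?B \<in> ?B" using that by (intro Max_in) auto
    then obtain j where j: "j \<in> {1..n}" "s j \<le> t" "s j = Max ?B" by auto
    have "{i \<in> {1..n}. s i \<le> t} = {i \<in> {1..n}. s i \<le> s j}"
      using j(2) Max_ge[of ?B] unfolding j(3)[symmetric] by auto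
    then have "F t = F (s j)" by (simp add: F_def)
    then show ?thesis using j by blast
  qed
  have inS: "\<exists>b\<in>?A. b \<le> t" if "x \<le> F t" for t
  proof -
    have "{i \<in> {1..n}. s i \<le> t} \<noteq> {}"
    proof
      assume "{i \<in> {1..n}. s i \<le> t} = {}"
      then have "F t = 0" unfolding F_def by (simp only: card.empty of_nat_0 div_0)
      then show False using that x(1) by simp
    qed
    from jump[OF this] obtain j where "j \<in> {1..n}" "s j \<le> t" "F t = F (s j)" by blast
    then show ?thesis using that by auto
  qed
  have "F (Max (s ` {1..n})) = 1"
  proof -
    have "{i \<in> {1..n}. s i \<le> Max (s ` {1..n})} = {1..n}" by auto
    then show ?thesis using n by (simp add: F_def)
  qed
  then have ne: "?A \<noteq> {}" using inS[of "Max (s ` {1..n})"] x(2) by auto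
  define a where "a = Min ?A"
  have aA: "a \<in> ?A" unfolding a_def by (rule Min_in[OF fin ne])
  then have xa: "x \<le> F a" by auto
  have "{t. x \<le> F t} = {a..}"
  proof (intro equalityI subsetI)
    fix t assume "t \<in> {t. x \<le> F t}"
    then have "x \<le> F t" by simp
    from inS[OF this] obtain b where b: "b \<in> ?A" "b \<le> t" by blast
    have "a \<le> t" unfolding a_def using Min_le[OF fin b(1)] b(2) by linarith
    then show "t \<in> {a..}" by simp
  next
    fix t assume "t \<in> {a..}"
    then show "t \<in> {t. x \<le> F t}" using mono[of a t] xa by simp
  qed
  then have "gen_inverse F x = (INF t\<in>{a..}. ereal t)" by (simp add: gen_inverse_def)
  also have "\<dots> = ereal a"
    by (intro antisym INF_lower INF_greatest) auto
  finally have 1: "gen_inverse F x = ereal a" .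
  have 2: "real (card {i \<in> {1..n}. s i < a}) / real n < x"
  proof (cases "{i \<in> {1..n}. s i < a} = {}")
    case True
    show ?thesis unfolding True using x(1) by simp
  next
    case False
    let ?B = "s ` {i \<in> {1..n}. s i < a}"
    have "Max ?B \<in> ?B" using False by (intro Max_in) auto
    then have lt: "Max ?B < a" by auto
    have "real (card {i \<in> {1..n}. s i < a}) / real n \<le> F (Max ?B)"
      unfolding F_def by (intro divide_right_mono of_nat_mono card_mono) auto
    also have "\<dots> < x"
    proof (rule ccontr)
      assume "\<not> F (Max ?B) < x"
      then have "x \<le> F (Max ?B)" by simp
      from inS[OF this] obtain b where b: "b \<in> ?A" "b \<le> Max ?B" by blast
      show False using Min_le[OF fin b(1)] b(2) lt unfolding a_def by linarith
    qed
    finally show ?thesis .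
  qed
  show thesis by (rule that[OF 1 xa 2])
qed

lemma le_of_le_add_small:
  fixes a b k e :: real
  assumes "0 < e" and "\<And>s. 0 < s \<Longrightarrow> s < e \<Longrightarrow> a \<le> b + k * s"
  shows "a \<le> b"
proof -
  have "((\<lambda>s. b + k * s) \<longlongrightarrow> b + k * 0) (at_right 0)" by (intro tendsto_intros)
  moreover have "\<forall>\<^sub>F s in at_right 0. a \<le> b + k * s"
    using assms by (auto simp: eventually_at_right_field)
  ultimately show ?thesis by (auto intro: tendsto_lowerbound)
qed

lemma emp_copula_range: "emp_copula n \<xi> u \<in> {0..1}"
proof -
  have "card {i \<in> {1..n}. P i} \<le> n" for P
  proof -
    have "card {i \<in> {1..n}. P i} \<le> card {1..n}" by (intro card_mono) auto
    then show ?thesis by simp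
  qed
  then show ?thesis by (auto simp: emp_copula_def emp_cdf_def divide_le_eq_1)
qed

context smooth_copula
begin

text \<open>Ties in the sample need no separate treatment: the modulus bounds the jumps of the empirical
  distribution function.\<close>

lemma empirical_approx_emp_copula:
  fixes \<xi> :: "nat \<Rightarrow> real \<times> real" and F1 F2 :: "real \<Rightarrow> real"
  assumes n: "1 \<le> n" and F1: "mono F1" "\<And>t. F1 t \<in> {0..1}" and F2: "mono F2" "\<And>t. F2 t \<in> {0..1}"
  defines "a \<equiv> empirical_process C n (\<lambda>i. (F1 (fst (\<xi> i)), F2 (snd (\<xi> i))))"
  assumes mod: "modulus_le \<delta> \<eta> a" and \<delta>: "0 < \<delta>" and \<eta>: "0 \<le> \<eta>" and a0: "a (0, 1) = 0" "a (1, 0) = 0"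
  shows "empirical_approx (sqrt (real n)) \<eta> a (emp_copula n \<xi>)"
proof -
  define R where "R = sqrt (real n)"
  have R: "0 < R" "R * R = real n" using n by (auto simp: R_def)
  define U where "U i = (F1 (fst (\<xi> i)), F2 (snd (\<xi> i)))" for i
  define cnt where "cnt P = real (card {i \<in> {1..n}. P i}) / real n" for P :: "nat \<Rightarrow> bool"
  have cnt_mono: "cnt P \<le> cnt Q" if "\<And>i. i \<in> {1..n} \<Longrightarrow> P i \<Longrightarrow> Q i" for P Q
    unfolding cnt_def using that by (intro divide_right_mono of_nat_mono card_mono) auto
  define G where "G v w = cnt (\<lambda>i. fst (U i) \<le> v \<and> snd (U i) \<le> w)" for v w
  have G: "R * (G v w - C (v, w)) = a (v, w)" for v w
  proof -
    have "(\<Sum>i\<in>{1..n}. below (v, w) (U i)) = real (card {i \<in> {1..n}. fst (U i) \<le> v \<and> snd (U i) \<le> w})"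
      by (simp add: below_def sum.If_cases Int_def)
    then have "a (v, w) = (real n * G v w - real n * C (v, w)) / R"
      using n by (simp add: a_def empirical_process_def U_def[symmetric] R_def sum_subtractf G_def cnt_def)
    also have "\<dots> = R * (G v w - C (v, w))" using R(1) unfolding R(2)[symmetric] by (simp add: field_simps)
    finally show ?thesis by simp
  qed
  have G1: "G v 1 = cnt (\<lambda>i. fst (U i) \<le> v)" for v unfolding G_def using F2(2) by (simp add: U_def)
  have G2: "G 1 w = cnt (\<lambda>i. snd (U i) \<le> w)" for w unfolding G_def using F1(2) by (simp add: U_def)
  \<comment> \<open>\<open>v\<close> is a level at which the distribution function \<open>g\<close>
    passes \<open>x\<close>. That \<open>x \<le> g v\<close> gives the lower bound; for the upper
    one, \<open>g (v - s) < x\<close> is combined with the modulus and \<open>s\<close> tends to 0.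
    Positivity of \<open>v\<close> holds because \<open>g 0 = 0 < x\<close>.\<close>
  have quant: "0 < v \<and> \<bar>R * (v - x) + b v\<bar> \<le> \<eta>"
    if v: "v \<in> {0..1}" and x: "0 < x" "x \<le> g v" and less: "\<And>v'. v' < v \<Longrightarrow> g v' < x"
      and g: "\<And>v. v \<in> {0..1} \<Longrightarrow> R * (g v - v) = b v" and b0: "b 0 = 0"
      and modb: "\<And>v v'. v \<in> {0..1} \<Longrightarrow> v' \<in> {0..1} \<Longrightarrow> \<bar>v - v'\<bar> \<le> \<delta> \<Longrightarrow> \<bar>b v - b v'\<bar> \<le> \<eta>"
    for v x and g b :: "real \<Rightarrow> real"
  proof -
    have "v \<noteq> 0"
    proof
      assume "v = 0"
      then have "g v = 0" using g[OF v] b0 R(1) by simp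
      then show False using x by simp
    qed
    then have vpos: "0 < v" using v by simp
    have "R * (x - v) \<le> R * (g v - v)" using x(2) R(1) by (intro mult_left_mono) auto
    then have lo: "0 \<le> R * (v - x) + b v" using g[OF v] by (simp add: algebra_simps)
    have up: "R * (v - x) + b v \<le> \<eta>"
    proof (rule le_of_le_add_small[of "min \<delta> v" _ _ R])
      show "0 < min \<delta> v" using \<delta> vpos by simp
      fix s assume s: "0 < s" "s < min \<delta> v"
      have v': "v - s \<in> {0..1}" using s v by auto
      have "R * (g (v - s) - (v - s)) \<le> R * (x - (v - s))"
        using less[of "v - s"] s R(1) by (intro mult_left_mono) auto
      moreover have "\<bar>b v - b (v - s)\<bar> \<le> \<eta>" using s by (intro modb v v') auto
      ultimately show "R * (v - x) + b v \<le> \<eta> + R * s" using g[OF v'] by (simp add: algebra_simps)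
    qed
    show ?thesis using vpos lo up \<eta> by simp
  qed
  have "\<exists>v\<in>{0..1}. \<exists>w\<in>{0..1}. \<bar>R * (v - x) + a (v, 1)\<bar> \<le> \<eta> \<and> \<bar>R * (w - y) + a (1, w)\<bar> \<le> \<eta> \<and>
       \<bar>R * (emp_copula n \<xi> (x, y) - C (v, w)) - a (v, w)\<bar> \<le> \<eta>"
    if xy: "x \<in> {0..1}" "y \<in> {0..1}" "0 < x" "0 < y" for x y
  proof -
    obtain p where p: "gen_inverse (emp_marginal1 n \<xi>) x = ereal p" "x \<le> cnt (\<lambda>i. fst (\<xi> i) \<le> p)" "cnt (\<lambda>i. fst (\<xi> i) < p) < x"
      using empirical_quantile[OF n xy(3), of "\<lambda>i. fst (\<xi> i)"] xy unfolding emp_marginal1_def[abs_def] cnt_def by auto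
    obtain q where q: "gen_inverse (emp_marginal2 n \<xi>) y = ereal q" "y \<le> cnt (\<lambda>i. snd (\<xi> i) \<le> q)" "cnt (\<lambda>i. snd (\<xi> i) < q) < y"
      using empirical_quantile[OF n xy(4), of "\<lambda>i. snd (\<xi> i)"] xy unfolding emp_marginal2_def[abs_def] cnt_def by auto
    define v w where "v = F1 p" and "w = F2 q"
    have vw: "v \<in> {0..1}" "w \<in> {0..1}" using F1(2) F2(2) by (auto simp: v_def w_def)
    \<comment> \<open>Only this direction of monotonicity survives plateaus of \<open>F1\<close>: a
      strictly smaller image comes from a strictly smaller observation.\<close>
    have below1: "fst (\<xi> i) < p" if "fst (U i) \<le> v'" "v' < v" for i v'
      using that monoD[OF F1(1), of p "fst (\<xi> i)"] unfolding U_def v_def by (cases "fst (\<xi> i) < p") auto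
    have below2: "snd (\<xi> i) < q" if "snd (U i) \<le> w'" "w' < w" for i w'
      using that monoD[OF F2(1), of q "snd (\<xi> i)"] unfolding U_def w_def by (cases "snd (\<xi> i) < q") auto
    have above1: "fst (U i) \<le> v" if "fst (\<xi> i) \<le> p" for i
      using monoD[OF F1(1) that] by (simp add: U_def v_def)
    have above2: "snd (U i) \<le> w" if "snd (\<xi> i) \<le> q" for i
      using monoD[OF F2(1) that] by (simp add: U_def w_def)
    have V: "0 < v \<and> \<bar>R * (v - x) + a (v, 1)\<bar> \<le> \<eta>"
    proof (rule quant[of v x "\<lambda>v. G v 1" "\<lambda>v. a (v, 1)"])
      show "x \<le> G v 1" unfolding G1 by (rule order_trans[OF p(2) cnt_mono]) (rule above1)
      show "G v' 1 < x" if "v' < v" for v'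
        unfolding G1 by (rule le_less_trans[OF cnt_mono p(3)]) (rule below1[OF _ that])
      show "R * (G v 1 - v) = a (v, 1)" if "v \<in> {0..1}" for v using G[of v 1] that by simp
      show "\<bar>a (v, 1) - a (v', 1)\<bar> \<le> \<eta>" if "v \<in> {0..1}" "v' \<in> {0..1}" "\<bar>v - v'\<bar> \<le> \<delta>" for v v'
        using that \<delta> by (intro modulus_leD[OF mod]) auto
    qed (use vw xy a0 in auto)
    have W: "0 < w \<and> \<bar>R * (w - y) + a (1, w)\<bar> \<le> \<eta>"
    proof (rule quant[of w y "\<lambda>w. G 1 w" "\<lambda>w. a (1, w)"])
      show "y \<le> G 1 w" unfolding G2 by (rule order_trans[OF q(2) cnt_mono]) (rule above2)
      show "G 1 w' < y" if "w' < w" for w'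
        unfolding G2 by (rule le_less_trans[OF cnt_mono q(3)]) (rule below2[OF _ that])
      show "R * (G 1 w - w) = a (1, w)" if "w \<in> {0..1}" for w using G[of 1 w] that by simp
      show "\<bar>a (1, w) - a (1, w')\<bar> \<le> \<eta>" if "w \<in> {0..1}" "w' \<in> {0..1}" "\<bar>w - w'\<bar> \<le> \<delta>" for w w'
        using that \<delta> by (intro modulus_leD[OF mod]) auto
    qed (use vw xy a0 in auto)
    have c: "emp_copula n \<xi> (x, y) = cnt (\<lambda>i. fst (\<xi> i) \<le> p \<and> snd (\<xi> i) \<le> q)"
      by (simp add: emp_copula_def emp_cdf_def p(1) q(1) cnt_def)
    let ?c = "emp_copula n \<xi> (x, y)"
    have "?c \<le> G v w" unfolding c G_def by (rule cnt_mono) (use above1 above2 in blast)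
    then have "R * (?c - C (v, w)) \<le> R * (G v w - C (v, w))" using R(1) by (intro mult_left_mono) auto
    then have up: "R * (?c - C (v, w)) - a (v, w) \<le> 0" using G by simp
    \<comment> \<open>Shrinking both levels by \<open>s\<close> makes the count at most that of the
      empirical copula; the change of \<open>a\<close> is covered by the modulus and that of
      \<open>C\<close> vanishes with \<open>s\<close>.\<close>
    have lo: "a (v, w) - R * (?c - C (v, w)) \<le> \<eta>"
    proof (rule le_of_le_add_small[of "min \<delta> (min v w)" _ _ "2 * R"])
      show "0 < min \<delta> (min v w)" using \<delta> V W by simp
      fix s assume s: "0 < s" "s < min \<delta> (min v w)"
      have v': "v - s \<in> {0..1}" "w - s \<in> {0..1}" using s vw by auto
      have "G (v - s) (w - s) \<le> ?c"
        unfolding c G_def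
      proof (rule cnt_mono)
        fix i assume "fst (U i) \<le> v - s \<and> snd (U i) \<le> w - s"
        then show "fst (\<xi> i) \<le> p \<and> snd (\<xi> i) \<le> q" using below1[of i "v - s"] below2[of i "w - s"] s by auto
      qed
      then have "R * G (v - s) (w - s) \<le> R * ?c" using R(1) by (intro mult_left_mono) auto
      moreover have "R * C (v, w) \<le> R * (C (v - s, w - s) + 2 * s)"
        using lipschitz[OF vw(1) v'(1) vw(2) v'(2)] s R(1) by (intro mult_left_mono) auto
      moreover have "\<bar>a (v, w) - a (v - s, w - s)\<bar> \<le> \<eta>"
        using s by (intro modulus_leD[OF mod] vw v') auto
      ultimately show "a (v, w) - R * (?c - C (v, w)) \<le> \<eta> + 2 * R * s"
        using G[of "v - s" "w - s"] by (simp add: algebra_simps)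
    qed
    show ?thesis using V W up lo \<eta> vw by (intro bexI[of _ v] bexI[of _ w]) (auto simp: abs_le_iff)
  qed
  moreover have "emp_copula n \<xi> (x, y) = 0" if "x = 0 \<or> y = 0" for x y
    using that gen_inverse_zero[of "emp_marginal1 n \<xi>"] gen_inverse_zero[of "emp_marginal2 n \<xi>"]
    by (auto simp: emp_copula_def emp_cdf_def emp_marginal1_def emp_marginal2_def)
  ultimately show ?thesis
    using emp_copula_range unfolding empirical_approx_def R_def by blast
qed

end

text \<open>The sublevel sets of the continuous margins are half-lines ending exactly at heights
  \<open>v\<close> and \<open>w\<close>, so the set is a rectangle whose measure the copula equation
  gives. The cases where a factor is empty or the whole line match the boundary values of
  \<open>C\<close>.\<close>

lemma measure_transformed_rectangle:
  fixes D :: "(real \<times> real) measure"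
  assumes D: "prob_space D" "sets D = sets borel"
    and F1: "continuous_on UNIV (marginal_cdf1 D)" and F2: "continuous_on UNIV (marginal_cdf2 D)"
    and C: "copula_of C D" and vw: "v \<in> {0..1}" "w \<in> {0..1}"
  shows "measure D {p. marginal_cdf1 D (fst p) \<le> v \<and> marginal_cdf2 D (snd p) \<le> w} = C (v, w)"
proof -
  interpret prob_space D by fact
  have sp: "space D = UNIV" using sets_eq_imp_space_eq[OF D(2)] by simp
  have m: "fst \<in> borel_measurable D" "snd \<in> borel_measurable D"
    unfolding measurable_cong_sets[OF D(2) refl]
    by (intro borel_measurable_continuous_onI continuous_intros)+
  interpret d1: real_distribution "distr D borel fst" by (rule real_distribution_distr[OF m(1)])
  interpret d2: real_distribution "distr D borel snd" by (rule real_distribution_distr[OF m(2)])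
  have cop: "copula C" and rect: "\<And>x y. measure D ({..x} \<times> {..y}) = C (marginal_cdf1 D x, marginal_cdf2 D y)"
    using C unfolding copula_of_def joint_cdf_def by auto
  interpret copula_fun C by unfold_locales (rule cop)
  have M1: "measure D ({..x} \<times> UNIV) = marginal_cdf1 D x" for x
  proof -
    have "marginal_cdf1 D x = measure D (fst -` {..x} \<inter> space D)"
      unfolding marginal_cdf1_def cdf_def by (rule measure_distr[OF m(1)]) simp
    also have "fst -` {..x} \<inter> space D = {..x} \<times> UNIV" by (auto simp: sp)
    finally show ?thesis by simp
  qed
  have M2: "measure D (UNIV \<times> {..y}) = marginal_cdf2 D y" for y
  proof -
    have "marginal_cdf2 D y = measure D (snd -` {..y} \<inter> space D)"
      unfolding marginal_cdf2_def cdf_def by (rule measure_distr[OF m(2)]) simp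
    also have "snd -` {..y} \<inter> space D = UNIV \<times> {..y}" by (auto simp: sp)
    finally show ?thesis by simp
  qed
  let ?S1 = "{x. marginal_cdf1 D x \<le> v}" and ?S2 = "{y. marginal_cdf2 D y \<le> w}"
  have eq: "{p. marginal_cdf1 D (fst p) \<le> v \<and> marginal_cdf2 D (snd p) \<le> w} = ?S1 \<times> ?S2" by auto
  have mono1: "mono (marginal_cdf1 D)" and mono2: "mono (marginal_cdf2 D)"
    using d1.cdf_nondecreasing d2.cdf_nondecreasing by (auto simp: mono_def marginal_cdf1_def marginal_cdf2_def)
  have lim1: "(marginal_cdf1 D \<longlongrightarrow> 0) at_bot" "(marginal_cdf1 D \<longlongrightarrow> 1) at_top"
    unfolding marginal_cdf1_def by (rule d1.cdf_lim_at_bot, rule d1.cdf_lim_at_top_prob)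
  have lim2: "(marginal_cdf2 D \<longlongrightarrow> 0) at_bot" "(marginal_cdf2 D \<longlongrightarrow> 1) at_top"
    unfolding marginal_cdf2_def by (rule d2.cdf_lim_at_bot, rule d2.cdf_lim_at_top_prob)
  have one: "measure D (UNIV \<times> UNIV) = 1" using prob_space by (simp add: sp)
  have I: "(1::real) \<in> {0..1}" "(0::real) \<in> {0..1}" by auto
  show ?thesis
    unfolding eq
  proof (rule sublevel_continuous_mono[OF mono1 F1 lim1 vw(1)])
    assume 1: "v = 1" "?S1 = UNIV"
    show "measure D (?S1 \<times> ?S2) = C (v, w)"
    proof (rule sublevel_continuous_mono[OF mono2 F2 lim2 vw(2)])
      assume 2: "w = 1" "?S2 = UNIV"
      show ?thesis by (simp only: 1(2) 2(2) one) (simp add: 1(1) 2(1))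
    next
      assume 2: "w = 0" "?S2 = {}"
      show ?thesis by (simp only: 1(2) 2(2)) (simp add: 1(1) 2(1))
    next
      fix d assume 2: "marginal_cdf2 D d = w" "?S2 = {..d}"
      show ?thesis using vw by (simp only: 1(2) 2(2) M2) (simp add: 1(1) 2(1))
    qed
  next
    assume 1: "v = 0" "?S1 = {}"
    show "measure D (?S1 \<times> ?S2) = C (v, w)" using vw by (simp only: 1(2)) (simp add: 1(1))
  next
    fix c assume 1: "marginal_cdf1 D c = v" "?S1 = {..c}"
    show "measure D (?S1 \<times> ?S2) = C (v, w)"
    proof (rule sublevel_continuous_mono[OF mono2 F2 lim2 vw(2)])
      assume 2: "w = 1" "?S2 = UNIV"
      show ?thesis using vw by (simp only: 1(2) 2(2) M1) (simp add: 1(1) 2(1))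
    next
      assume 2: "w = 0" "?S2 = {}"
      show ?thesis using vw by (simp only: 2(2)) (simp add: 2(1))
    next
      fix d assume 2: "marginal_cdf2 D d = w" "?S2 = {..d}"
      show ?thesis by (simp only: 1(2) 2(2) rect) (simp only: 1(1) 2(1))
    qed
  qed
qed

section \<open>Weak convergence of the associativity process\<close>

lemma mspace_linf: "f \<in> mspace (linf T) \<longleftrightarrow> f \<in> extensional T \<and> (\<exists>K. \<forall>x\<in>T. \<bar>f x\<bar> \<le> K)"
  by (auto simp: linf_def Met_TC.fspace_def bounded_iff)

lemma mdist_linf_le:
  assumes "f \<in> mspace (linf T)" "g \<in> mspace (linf T)" "T \<noteq> {}" "\<And>x. x \<in> T \<Longrightarrow> \<bar>f x - g x\<bar> \<le> e"
  shows "mdist (linf T) f g \<le> e"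
  using assms funspace_mdist_le[of f T euclidean_metric g e] unfolding linf_def by (simp add: dist_real_def)

text \<open>An open set is where the distance to its complement is positive, and that distance is
  1-Lipschitz. No separability enters. The whole space is separate, because the infimum over an
  empty complement says nothing.\<close>

lemma measurable_borel_of_metric_lipschitzI:
  assumes L: "L \<in> space N \<rightarrow> mspace m"
    and lip: "\<And>f. (\<And>x y. x \<in> mspace m \<Longrightarrow> y \<in> mspace m \<Longrightarrow> \<bar>f x - f y\<bar> \<le> mdist m x y) \<Longrightarrow>
      (\<lambda>\<omega>. f (L \<omega>) :: real) \<in> borel_measurable N"
  shows "L \<in> N \<rightarrow>\<^sub>M borel_of_metric m"
proof (rule measurable_borel_of_metricI[OF L])
  interpret Metric_space "mspace m" "mdist m" by simp
  fix U assume U: "openin (mtopology_of m) U"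
  then have Um: "U \<subseteq> mspace m" by (rule openin_mtopology_of_subset)
  let ?A = "mspace m - U"
  show "L -` U \<inter> space N \<in> sets N"
  proof (cases "?A = {}")
    case True
    then have "L -` U \<inter> space N = space N" using L Um by blast
    then show ?thesis by simp
  next
    case False
    define f where "f x = (INF y\<in>?A. mdist m x y)" for x
    have bdd: "bdd_below (mdist m x ` ?A)" for x by (rule bdd_belowI2[of _ 0]) simp
    have half: "f x \<le> f y + mdist m x y" if "x \<in> mspace m" "y \<in> mspace m" for x y
    proof -
      have "f x - mdist m x y \<le> f y"
        unfolding f_def[of y]
      proof (rule cINF_greatest[OF False])
        fix w assume w: "w \<in> ?A"
        have "f x \<le> mdist m x w" unfolding f_def by (rule cINF_lower[OF bdd w])
        also have "\<dots> \<le> mdist m x y + mdist m y w" using triangle that w by auto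
        finally show "f x - mdist m x y \<le> mdist m y w" by simp
      qed
      then show ?thesis by simp
    qed
    have f1: "\<bar>f x - f y\<bar> \<le> mdist m x y" if "x \<in> mspace m" "y \<in> mspace m" for x y
      using half[OF that] half[OF that(2,1)] by (simp add: commute abs_le_iff)
    have "x \<in> U \<longleftrightarrow> 0 < f x" if x: "x \<in> mspace m" for x
    proof
      assume "x \<in> U"
      then obtain r where r: "r > 0" "mball x r \<subseteq> U"
        using U unfolding mtopology_of_def openin_mtopology by blast
      have "r \<le> f x"
        unfolding f_def
      proof (rule cINF_greatest[OF False])
        fix y assume "y \<in> ?A"
        then have "y \<notin> mball x r" "y \<in> mspace m" using r by auto
        then show "r \<le> mdist m x y" using x by auto
      qed
      then show "0 < f x" using r by simp
    next
      assume "0 < f x"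
      show "x \<in> U"
      proof (rule ccontr)
        assume "x \<notin> U"
        then have "f x \<le> mdist m x x" unfolding f_def using x by (intro cINF_lower[OF bdd]) auto
        then show False using \<open>0 < f x\<close> x by simp
      qed
    qed
    then have "L -` U \<inter> space N = {\<omega> \<in> space N. 0 < f (L \<omega>)}" using L by auto
    also have "\<dots> \<in> sets N" using lip[OF f1] by measurable
    finally show ?thesis .
  qed
qed

section \<open>Step functions through grid values\<close>

definition step_fun :: "nat \<Rightarrow> (nat \<times> nat \<Rightarrow> real) \<Rightarrow> real \<times> real \<Rightarrow> real" where
  "step_fun m z u = z (dyadic_index m (fst u), dyadic_index m (snd u))"

definition grid_index :: "nat \<Rightarrow> (nat \<times> nat) set" where
  "grid_index m = {..2 ^ m} \<times> {..2 ^ m}"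

definition grid_point :: "nat \<Rightarrow> nat \<times> nat \<Rightarrow> real \<times> real" where
  "grid_point m t = (dyadic m (fst t), dyadic m (snd t))"

text \<open>Extended by 0 off the grid, so that the vector lives in the product space over all index
  pairs, where measurability and continuity can be treated coordinatewise.\<close>

definition grid_values :: "nat \<Rightarrow> (real \<times> real \<Rightarrow> real) \<Rightarrow> nat \<times> nat \<Rightarrow> real" where
  "grid_values m b t = (if t \<in> grid_index m then b (grid_point m t) else 0)"

lemma finite_grid_index [simp]: "finite (grid_index m)" by (simp add: grid_index_def)

lemma grid_point_in: "t \<in> grid_index m \<Longrightarrow> grid_point m t \<in> unit_square"
  using dyadic_in by (auto simp: grid_index_def grid_point_def)

lemma inj_grid_point: "inj_on (grid_point m) T"
  by (auto simp: inj_on_def grid_point_def dyadic_def prod_eq_iff)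

lemma dyadic_index_grid:
  "u \<in> unit_square \<Longrightarrow> (dyadic_index m (fst u), dyadic_index m (snd u)) \<in> grid_index m"
  using dyadic_index_bounds(1) by (auto simp: grid_index_def)

lemma step_grid_values:
  "x \<in> {0..1} \<Longrightarrow> y \<in> {0..1} \<Longrightarrow> step_fun m (grid_values m b) (x, y) = b (dyadic_round m x, dyadic_round m y)"
  using dyadic_index_grid[of "(x, y)" m] by (simp add: step_fun_def grid_values_def grid_point_def)

lemma dyadic_round_close:
  assumes "x \<in> {0..1}"
  shows "dyadic_round m x \<in> {0..1}" "\<bar>x - dyadic_round m x\<bar> \<le> 1 / 2 ^ m"
proof -
  note b = dyadic_index_bounds[OF assms, of m]
  show "dyadic_round m x \<in> {0..1}" by (rule dyadic_in[OF b(1)])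
  have "dyadic m (Suc (dyadic_index m x)) = dyadic_round m x + 1 / 2 ^ m"
    by (simp add: dyadic_def add_divide_distrib)
  then show "\<bar>x - dyadic_round m x\<bar> \<le> 1 / 2 ^ m" using b(2,3) by simp
qed

lemma step_fun_modulus:
  assumes mod: "modulus_le (1 / 2 ^ m0) \<eta> b" and m: "m0 \<le> m" and xy: "x \<in> {0..1}" "y \<in> {0..1}"
  shows "\<bar>b (x, y) - step_fun m (grid_values m b) (x, y)\<bar> \<le> \<eta>"
  unfolding step_grid_values[OF xy]
proof (rule modulus_leD[OF mod xy dyadic_round_close(1)[OF xy(1)] dyadic_round_close(1)[OF xy(2)]])
  have "(1::real) / 2 ^ m \<le> 1 / 2 ^ m0" using m by (intro divide_left_mono power_increasing) auto
  then show "\<bar>x - dyadic_round m x\<bar> \<le> 1 / 2 ^ m0" "\<bar>y - dyadic_round m y\<bar> \<le> 1 / 2 ^ m0"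
    using dyadic_round_close(2)[OF xy(1), of m] dyadic_round_close(2)[OF xy(2), of m] by linarith+
qed

context smooth_copula
begin

lemma G_path_lipschitz:
  assumes "\<And>u. u \<in> unit_square \<Longrightarrow> \<bar>b u - b' u\<bar> \<le> e" and xy: "x \<in> {0..1}" "y \<in> {0..1}"
  shows "\<bar>G_path C b (x, y) - G_path C b' (x, y)\<bar> \<le> 3 * e"
proof -
  have "\<bar>partial1 C (x, y) * (b (x, 1) - b' (x, 1))\<bar> \<le> e"
    by (rule order_trans[OF mult_partial_le(1)]) (use assms in auto)
  moreover have "\<bar>partial2 C (x, y) * (b (1, y) - b' (1, y))\<bar> \<le> e"
    by (rule order_trans[OF mult_partial_le(2)]) (use assms in auto)
  moreover have "\<bar>b (x, y) - b' (x, y)\<bar> \<le> e" using assms by auto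
  ultimately show ?thesis by (simp add: G_path_def algebra_simps)
qed

text \<open>Four values of \<open>G_path\<close>, each changing by at most \<open>3 * e\<close> and
  weighted by at most 1. Since no continuity of \<open>b\<close> is involved, step functions may be
  inserted.\<close>

lemma H_path_lipschitz:
  assumes b: "\<And>u. u \<in> unit_square \<Longrightarrow> \<bar>b u - b' u\<bar> \<le> e" and u: "u \<in> unit_cube"
  shows "\<bar>H_path C b u - H_path C b' u\<bar> \<le> 12 * e"
proof -
  obtain x y z where xyz: "u = (x, y, z)" "x \<in> {0..1}" "y \<in> {0..1}" "z \<in> {0..1}" using u by (cases u) auto
  note G = G_path_lipschitz[of b b' e, OF b]
  have Cyz: "C (y, z) \<in> {0..1}" and Cxy: "C (x, y) \<in> {0..1}" using range01 xyz by blast+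
  let ?d = "\<lambda>v. G_path C b v - G_path C b' v"
  have "\<bar>?d (x, C (y, z))\<bar> \<le> 3 * e" "\<bar>?d (C (x, y), z)\<bar> \<le> 3 * e"
    using xyz Cyz Cxy by (intro G; simp)+
  moreover have "\<bar>partial2 C (x, C (y, z)) * ?d (y, z)\<bar> \<le> 3 * e"
    by (rule order_trans[OF mult_partial_le(2) G]) (use xyz Cyz in auto)
  moreover have "\<bar>partial1 C (C (x, y), z) * ?d (x, y)\<bar> \<le> 3 * e"
    by (rule order_trans[OF mult_partial_le(1) G]) (use xyz Cxy in auto)
  moreover have "H_path C b u - H_path C b' u = ?d (x, C (y, z)) - ?d (C (x, y), z)
      + partial2 C (x, C (y, z)) * ?d (y, z) - partial1 C (C (x, y), z) * ?d (x, y)"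
    using u by (simp add: H_path_def Let_def xyz(1) algebra_simps)
  ultimately show ?thesis by linarith
qed

lemma H_path_in_linf:
  assumes "\<And>u. u \<in> unit_square \<Longrightarrow> \<bar>b u\<bar> \<le> K"
  shows "H_path C b \<in> mspace (linf unit_cube)"
proof -
  have z: "H_path C (\<lambda>_. 0) u = 0" if "u \<in> unit_cube" for u
    using that by (auto simp: H_path_def G_path_def Let_def)
  have "\<bar>H_path C b u\<bar> \<le> 12 * K" if "u \<in> unit_cube" for u
    using H_path_lipschitz[of b "\<lambda>_. 0" K u] assms that z[OF that] by simp
  then show ?thesis unfolding mspace_linf by (auto simp: H_path_def Let_def)
qed

lemma mdist_H_path_le:
  assumes "\<And>u. u \<in> unit_square \<Longrightarrow> \<bar>b u\<bar> \<le> K" "\<And>u. u \<in> unit_square \<Longrightarrow> \<bar>b' u\<bar> \<le> K'"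
    and "\<And>u. u \<in> unit_square \<Longrightarrow> \<bar>b u - b' u\<bar> \<le> e"
  shows "mdist (linf unit_cube) (H_path C b) (H_path C b') \<le> 12 * e"
  by (rule mdist_linf_le[OF H_path_in_linf[OF assms(1)] H_path_in_linf[OF assms(2)]])
    (use H_path_lipschitz[OF assms(3)] in auto)

lemma step_fun_bounded:
  assumes "u \<in> unit_square"
  shows "\<bar>step_fun m z u\<bar> \<le> (\<Sum>t\<in>grid_index m. \<bar>z t\<bar>)"
  unfolding step_fun_def
  using member_le_sum[OF dyadic_index_grid[OF assms, of m], of "\<lambda>t. \<bar>z t\<bar>"] by simp

text \<open>Turns a Lipschitz test function on the function space into a continuous function of
  finitely many real coordinates, the form that \<open>cramer_wold_convergence\<close>
  accepts.\<close>

lemma lipschitz_step_functional: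
  assumes f: "\<And>x y. x \<in> mspace (linf unit_cube) \<Longrightarrow> y \<in> mspace (linf unit_cube) \<Longrightarrow>
      \<bar>f x - f y\<bar> \<le> K * mdist (linf unit_cube) x y" and K: "0 \<le> K"
  shows "\<bar>f (H_path C (step_fun m z)) - f (H_path C (step_fun m z'))\<bar> \<le> K * (12 * (\<Sum>t\<in>grid_index m. \<bar>z t - z' t\<bar>))"
proof -
  have "mdist (linf unit_cube) (H_path C (step_fun m z)) (H_path C (step_fun m z')) \<le> 12 * (\<Sum>t\<in>grid_index m. \<bar>z t - z' t\<bar>)"
  proof (rule mdist_H_path_le[OF step_fun_bounded step_fun_bounded])
    fix u :: "real \<times> real" assume "u \<in> unit_square"
    then show "\<bar>step_fun m z u - step_fun m z' u\<bar> \<le> (\<Sum>t\<in>grid_index m. \<bar>z t - z' t\<bar>)"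
      using step_fun_bounded[of u m "\<lambda>t. z t - z' t"] by (simp add: step_fun_def)
  qed
  moreover have "H_path C (step_fun m z) \<in> mspace (linf unit_cube)" for z
    by (rule H_path_in_linf[OF step_fun_bounded])
  ultimately show ?thesis using f K by (meson mult_left_mono order_trans)
qed

lemma continuous_step_functional:
  assumes f: "\<And>x y. x \<in> mspace (linf unit_cube) \<Longrightarrow> y \<in> mspace (linf unit_cube) \<Longrightarrow>
      \<bar>f x - f y\<bar> \<le> K * mdist (linf unit_cube) x y" and K: "0 \<le> K"
  shows "continuous_on UNIV (\<lambda>z. f (H_path C (step_fun m z)) :: real)"
  unfolding continuous_on_def
proof (intro ballI)
  fix z :: "nat \<times> nat \<Rightarrow> real"
  have "continuous_on UNIV (\<lambda>z'. K * (12 * (\<Sum>t\<in>grid_index m. \<bar>z' t - z t\<bar>)))"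
    by (intro continuous_intros continuous_on_product_coordinates)
  then have "((\<lambda>z'. K * (12 * (\<Sum>t\<in>grid_index m. \<bar>z' t - z t\<bar>))) \<longlongrightarrow> K * (12 * (\<Sum>t\<in>grid_index m. \<bar>z t - z t\<bar>))) (at z within UNIV)"
    unfolding continuous_on_def by blast
  then have "((\<lambda>z'. K * (12 * (\<Sum>t\<in>grid_index m. \<bar>z' t - z t\<bar>))) \<longlongrightarrow> 0) (at z within UNIV)" by simp
  then have "((\<lambda>z'. f (H_path C (step_fun m z')) - f (H_path C (step_fun m z))) \<longlongrightarrow> 0) (at z within UNIV)"
    by (rule Lim_null_comparison[rotated])
      (use lipschitz_step_functional[OF f K] in \<open>auto intro!: always_eventually\<close>)
  then show "((\<lambda>z'. f (H_path C (step_fun m z'))) \<longlongrightarrow> f (H_path C (step_fun m z))) (at z within UNIV)"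
    by (rule LIM_zero_cancel)
qed

end

lemma continuous_modulus_le:
  assumes "continuous_on unit_square b" "0 < e"
  obtains m where "modulus_le (1 / 2 ^ m) e b"
proof -
  have "compact unit_square" by (intro compact_Times compact_Icc)
  then have "uniformly_continuous_on unit_square b" by (rule compact_uniformly_continuous[OF assms(1)])
  then obtain d where d: "0 < d" "\<And>u u'. u \<in> unit_square \<Longrightarrow> u' \<in> unit_square \<Longrightarrow> dist u' u < d \<Longrightarrow> dist (b u') (b u) < e"
    unfolding uniformly_continuous_on_def using assms(2) by meson
  obtain m where m: "(1 / 2) ^ m < d / 2"
    using real_arch_pow_inv[of "d / 2" "1 / 2"] d(1) by auto
  show thesis
  proof (rule that[of m], unfold modulus_le_def, intro ballI impI)
    fix x y x' y' :: real
    assume xy: "x \<in> {0..1}" "y \<in> {0..1}" "x' \<in> {0..1}" "y' \<in> {0..1}"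
      and cl: "\<bar>x - x'\<bar> \<le> 1 / 2 ^ m \<and> \<bar>y - y'\<bar> \<le> 1 / 2 ^ m"
    have "dist (x, y) (x', y') \<le> \<bar>x - x'\<bar> + \<bar>y - y'\<bar>"
      using sqrt_sum_squares_le_sum_abs[of "x - x'" "y - y'"] by (simp add: dist_Pair_Pair dist_real_def)
    also have "\<dots> < d" using cl m by (simp add: power_one_over)
    finally have "dist (b (x, y)) (b (x', y')) < e" using xy by (intro d(2)) auto
    then show "\<bar>b (x, y) - b (x', y')\<bar> \<le> e" by (simp add: dist_real_def)
  qed
qed

lemma grid_values_measurable:
  assumes "\<And>u. u \<in> unit_square \<Longrightarrow> (\<lambda>\<omega>. b \<omega> u) \<in> borel_measurable N"
  shows "(\<lambda>\<omega>. grid_values m (b \<omega>) t) \<in> borel_measurable N"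
  using assms[OF grid_point_in] by (cases "t \<in> grid_index m") (simp_all add: grid_values_def)

context smooth_copula
begin

lemma step_functional_LIMSEQ:
  assumes f: "\<And>x y. x \<in> mspace (linf unit_cube) \<Longrightarrow> y \<in> mspace (linf unit_cube) \<Longrightarrow>
      \<bar>f x - f y\<bar> \<le> K * mdist (linf unit_cube) x y" and K: "0 \<le> K"
    and b: "continuous_on unit_square b"
  shows "(\<lambda>m. f (H_path C (step_fun m (grid_values m b))) :: real) \<longlonglongrightarrow> f (H_path C b)"
proof (rule LIMSEQ_I)
  fix r :: real assume r: "0 < r"
  \<comment> \<open>A uniform error \<open>e\<close> of the path costs \<open>12 * e\<close> after
    \<open>H_path\<close> and \<open>K * (12 * e) < r\<close> after \<open>f\<close>.\<close>
  define e where "e = r / (12 * K + 1)"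
  have e: "0 < e" "K * (12 * e) < r" using K r by (auto simp: e_def field_simps)
  obtain m0 where m0: "modulus_le (1 / 2 ^ m0) e b" by (rule continuous_modulus_le[OF b e(1)])
  have "compact (b ` unit_square)" by (intro compact_continuous_image[OF b] compact_Times compact_Icc)
  then obtain B where B: "\<And>u. u \<in> unit_square \<Longrightarrow> \<bar>b u\<bar> \<le> B"
    using compact_imp_bounded bounded_iff by (metis image_eqI real_norm_def)
  show "\<exists>m0. \<forall>m\<ge>m0. norm (f (H_path C (step_fun m (grid_values m b))) - f (H_path C b)) < r"
  proof (intro exI allI impI)
    fix m assume m: "m0 \<le> m"
    have "mdist (linf unit_cube) (H_path C (step_fun m (grid_values m b))) (H_path C b) \<le> 12 * e"
    proof (rule mdist_H_path_le[OF step_fun_bounded B])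
      fix u :: "real \<times> real" assume "u \<in> unit_square"
      then show "\<bar>step_fun m (grid_values m b) u - b u\<bar> \<le> e"
        using step_fun_modulus[OF m0 m, of "fst u" "snd u"] by (auto simp: abs_minus_commute)
    qed
    then have "K * mdist (linf unit_cube) (H_path C (step_fun m (grid_values m b))) (H_path C b) \<le> K * (12 * e)"
      using K by (rule mult_left_mono)
    moreover have "\<bar>f (H_path C (step_fun m (grid_values m b))) - f (H_path C b)\<bar>
        \<le> K * mdist (linf unit_cube) (H_path C (step_fun m (grid_values m b))) (H_path C b)"
      by (rule f[OF H_path_in_linf[OF step_fun_bounded] H_path_in_linf[OF B]])
    ultimately show "norm (f (H_path C (step_fun m (grid_values m b))) - f (H_path C b)) < r"
      using e(2) by simp
  qed
qed

lemma step_functional_measurable: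
  assumes f: "\<And>x y. x \<in> mspace (linf unit_cube) \<Longrightarrow> y \<in> mspace (linf unit_cube) \<Longrightarrow>
      \<bar>f x - f y\<bar> \<le> K * mdist (linf unit_cube) x y" and K: "0 \<le> K"
    and b: "\<And>u. u \<in> unit_square \<Longrightarrow> (\<lambda>\<omega>. b \<omega> u) \<in> borel_measurable N"
  shows "(\<lambda>\<omega>. f (H_path C (step_fun m (grid_values m (b \<omega>)))) :: real) \<in> borel_measurable N"
proof (rule measurable_compose[of "\<lambda>\<omega>. grid_values m (b \<omega>)"])
  show "(\<lambda>\<omega>. grid_values m (b \<omega>)) \<in> borel_measurable N"
    by (rule measurable_coordinatewise_then_product) (rule grid_values_measurable[OF b])
  show "(\<lambda>z. f (H_path C (step_fun m z))) \<in> borel_measurable borel"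
    by (rule borel_measurable_continuous_onI[OF continuous_step_functional[OF f K]])
qed

text \<open>Lipschitz functionals suffice, and for a continuous path each of them is the limit of
  functionals of finitely many grid values.\<close>

lemma H_path_measurable:
  assumes meas: "\<And>u. u \<in> unit_square \<Longrightarrow> (\<lambda>\<omega>. b \<omega> u) \<in> borel_measurable N"
    and cont: "\<And>\<omega>. \<omega> \<in> space N \<Longrightarrow> continuous_on unit_square (b \<omega>)"
  shows "(\<lambda>\<omega>. H_path C (b \<omega>)) \<in> N \<rightarrow>\<^sub>M borel_of_metric (linf unit_cube)"
proof (rule measurable_borel_of_metric_lipschitzI)
  show "(\<lambda>\<omega>. H_path C (b \<omega>)) \<in> space N \<rightarrow> mspace (linf unit_cube)"
  proof
    fix \<omega> assume "\<omega> \<in> space N"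
    have "compact (b \<omega> ` unit_square)"
      by (intro compact_continuous_image cont \<open>\<omega> \<in> space N\<close> compact_Times compact_Icc)
    then obtain K where "\<And>u. u \<in> unit_square \<Longrightarrow> \<bar>b \<omega> u\<bar> \<le> K"
      using compact_imp_bounded bounded_iff by (metis image_eqI real_norm_def)
    then show "H_path C (b \<omega>) \<in> mspace (linf unit_cube)" by (rule H_path_in_linf)
  qed
  fix f :: "(real \<times> real \<times> real \<Rightarrow> real) \<Rightarrow> real"
  assume f: "\<And>x y. x \<in> mspace (linf unit_cube) \<Longrightarrow> y \<in> mspace (linf unit_cube) \<Longrightarrow>
      \<bar>f x - f y\<bar> \<le> mdist (linf unit_cube) x y"
  then have f1: "\<bar>f x - f y\<bar> \<le> 1 * mdist (linf unit_cube) x y"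
    if "x \<in> mspace (linf unit_cube)" "y \<in> mspace (linf unit_cube)" for x y using that by simp
  show "(\<lambda>\<omega>. f (H_path C (b \<omega>))) \<in> borel_measurable N"
  proof (rule borel_measurable_LIMSEQ_real)
    show "(\<lambda>m. f (H_path C (step_fun m (grid_values m (b \<omega>))))) \<longlonglongrightarrow> f (H_path C (b \<omega>))" if "\<omega> \<in> space N" for \<omega>
      by (rule step_functional_LIMSEQ[OF f1 _ cont[OF that]]) auto
    show "(\<lambda>\<omega>. f (H_path C (step_fun m (grid_values m (b \<omega>))))) \<in> borel_measurable N" for m
      by (rule step_functional_measurable[OF f1 _ meas]) auto
  qed
qed

end

section \<open>Regularity of the empirical paths and convergence on a fixed grid\<close>

locale smooth_copula_sample = iid_copula_sample M C U + smooth_copula C for M :: "'a measure" and C U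
begin

lemma AE_below_zero:
  assumes "1 \<le> i" "u \<in> unit_square" "C u = 0"
  shows "AE \<omega> in M. below u (U i \<omega>) = 0"
proof -
  have "AE \<omega> in M. 0 \<le> below u (U i \<omega>)" by (simp add: below_def)
  then show ?thesis
    using integral_nonneg_eq_0_iff_AE[OF below_integrable[OF assms(1), of u]] expectation_below[OF assms(1,2)] assms(3) by simp
qed

lemma AE_below_one:
  assumes "1 \<le> i"
  shows "AE \<omega> in M. below (1, 1) (U i \<omega>) = 1"
proof -
  have int: "integrable M (\<lambda>\<omega>. 1 - below (1, 1) (U i \<omega>))" using below_integrable[OF assms] by simp
  have "AE \<omega> in M. 0 \<le> 1 - below (1, 1) (U i \<omega>)" by (simp add: below_def)
  moreover have "expectation (\<lambda>\<omega>. 1 - below (1, 1) (U i \<omega>)) = 0"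
    using below_integrable[OF assms] expectation_below[OF assms, of "(1, 1)"] by (simp add: prob_space)
  ultimately have "AE \<omega> in M. 1 - below (1, 1) (U i \<omega>) = 0"
    using integral_nonneg_eq_0_iff_AE[OF int] by simp
  then show ?thesis by eventually_elim simp
qed

text \<open>Outside one null set, no observation ever falls below a point of a countable dense
  subset of the zero set; the modulus bridges the gap to the other zeros. The points
  \<open>(0, 1)\<close> and \<open>(1, 0)\<close> are added to that subset because exact zeros are
  needed there.\<close>

lemma AE_emp_process_boundary:
  "AE \<omega> in M. \<forall>n. emp_process n \<omega> (0, 1) = 0 \<and> emp_process n \<omega> (1, 0) = 0 \<and> emp_process n \<omega> (1, 1) = 0 \<and>
     (\<forall>\<delta> \<eta> x y. 0 < \<delta> \<longrightarrow> modulus_le \<delta> \<eta> (emp_process n \<omega>) \<longrightarrow> x \<in> {0..1} \<longrightarrow> y \<in> {0..1} \<longrightarrow> C (x, y) = 0 \<longrightarrow>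
       \<bar>emp_process n \<omega> (x, y)\<bar> \<le> \<eta>)"
proof -
  define Z where "Z = {u \<in> unit_square. C u = 0}"
  obtain T where T: "countable T" "T \<subseteq> Z" "Z \<subseteq> closure T" using separable[of Z] by blast
  define Q where "Q = insert (0, 1) (insert (1, 0) T)"
  have Q: "countable Q" "Q \<subseteq> Z" using T by (auto simp: Q_def Z_def)
  have "AE \<omega> in M. \<forall>q\<in>Q. \<forall>i\<in>{1..}. below q (U i \<omega>) = 0"
  proof (intro AE_ball_countable' Q(1))
    fix q and i :: nat assume q: "q \<in> Q" and "i \<in> {1..}"
    then have "1 \<le> i" by simp
    moreover have "q \<in> unit_square" "C q = 0" using subsetD[OF Q(2) q] unfolding Z_def by simp_all
    ultimately show "AE \<omega> in M. below q (U i \<omega>) = 0" by (rule AE_below_zero)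
  qed simp
  moreover have "AE \<omega> in M. \<forall>i\<in>{1..}. below (1, 1) (U i \<omega>) = 1"
    by (intro AE_ball_countable' AE_below_one) simp_all
  ultimately show ?thesis
  proof eventually_elim
    case (elim \<omega>)
    show ?case
    proof (intro allI)
      fix n
      have zero: "emp_process n \<omega> q = 0" if q: "q \<in> Q" for q
      proof -
        have "C q = 0" using subsetD[OF Q(2) q] unfolding Z_def by simp
        moreover have "below q (U i \<omega>) = 0" if "i \<in> {1..n}" for i using bspec[OF elim(1) q] that by simp
        ultimately show ?thesis unfolding empirical_process_def by simp
      qed
      have one: "emp_process n \<omega> (1, 1) = 0"
      proof -
        have "below (1, 1) (U i \<omega>) = 1" if "i \<in> {1..n}" for i using elim(2) that by simp
        then show ?thesis unfolding empirical_process_def by simp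
      qed
      have near: "\<bar>emp_process n \<omega> (x, y)\<bar> \<le> \<eta>"
        if d: "0 < \<delta>" and mod: "modulus_le \<delta> \<eta> (emp_process n \<omega>)" and xy: "x \<in> {0..1}" "y \<in> {0..1}" and "C (x, y) = 0" for \<delta> \<eta> x y
      proof -
        have "(x, y) \<in> closure T" using that T(3) by (auto simp: Z_def)
        then obtain q where q: "q \<in> T" "dist q (x, y) < \<delta>" using d by (auto simp: closure_approachable)
        obtain x' y' where q': "q = (x', y')" by (cases q)
        have "(x', y') \<in> Z" using q(1) T(2) unfolding q' by (rule subsetD[rotated])
        then have "x' \<in> {0..1}" "y' \<in> {0..1}" unfolding Z_def by simp_all
        moreover have "dist x' x < \<delta>" "dist y' y < \<delta>"
          using dist_fst_le[of q "(x, y)"] dist_snd_le[of q "(x, y)"] q(2) unfolding q' fst_conv snd_conv by linarith+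
        then have "\<bar>x - x'\<bar> \<le> \<delta>" "\<bar>y - y'\<bar> \<le> \<delta>" by (simp_all add: dist_real_def abs_minus_commute)
        ultimately have "\<bar>emp_process n \<omega> (x, y) - emp_process n \<omega> (x', y')\<bar> \<le> \<eta>"
          using modulus_leD[OF mod xy] by blast
        moreover have "emp_process n \<omega> (x', y') = 0" using zero[of q] q(1) by (simp add: q' Q_def)
        ultimately show ?thesis by simp
      qed
      show "emp_process n \<omega> (0, 1) = 0 \<and> emp_process n \<omega> (1, 0) = 0 \<and> emp_process n \<omega> (1, 1) = 0 \<and>
         (\<forall>\<delta> \<eta> x y. 0 < \<delta> \<longrightarrow> modulus_le \<delta> \<eta> (emp_process n \<omega>) \<longrightarrow> x \<in> {0..1} \<longrightarrow> y \<in> {0..1} \<longrightarrow> C (x, y) = 0 \<longrightarrow>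
           \<bar>emp_process n \<omega> (x, y)\<bar> \<le> \<eta>)"
        using zero[of "(0, 1)"] zero[of "(1, 0)"] one near by (simp add: Q_def)
    qed
  qed
qed

text \<open>The equicontinuity event minus the null set of \<open>AE_emp_process_boundary\<close>.
  The bound \<open>K\<close> comes from \<open>modulus_le_bounded\<close>, started at the edge
  \<open>x = 0\<close> where \<open>C\<close> vanishes, and does not depend on
  \<open>n\<close>.\<close>

lemma emp_process_regular:
  assumes "0 < \<epsilon>" "0 < \<eta>"
  obtains m n0 K where "0 < K" "\<And>n. n0 \<le> n \<Longrightarrow>
    \<exists>A\<in>events. prob (space M - A) \<le> \<epsilon> \<and> (\<forall>\<omega>\<in>A. regular_path (1 / 2 ^ m) \<eta> K (emp_process n \<omega>))"
proof (rule emp_process_equicontinuous[OF assms])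
  fix m n0
  assume eq: "\<And>n. n0 \<le> n \<Longrightarrow>
    \<exists>A\<in>events. prob (space M - A) \<le> \<epsilon> \<and> (\<forall>\<omega>\<in>A. modulus_le (1 / 2 ^ m) \<eta> (emp_process n \<omega>))"
  define K where "K = (1 / (1 / 2 ^ m) + 2) * \<eta>"
  obtain N where N: "{\<omega> \<in> space M. \<not> (\<forall>n. emp_process n \<omega> (0, 1) = 0 \<and> emp_process n \<omega> (1, 0) = 0 \<and> emp_process n \<omega> (1, 1) = 0 \<and>
     (\<forall>\<delta> \<eta> x y. 0 < \<delta> \<longrightarrow> modulus_le \<delta> \<eta> (emp_process n \<omega>) \<longrightarrow> x \<in> {0..1} \<longrightarrow> y \<in> {0..1} \<longrightarrow> C (x, y) = 0 \<longrightarrow>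
       \<bar>emp_process n \<omega> (x, y)\<bar> \<le> \<eta>))} \<subseteq> N" "emeasure M N = 0" "N \<in> sets M"
    using AE_E[OF AE_emp_process_boundary] by blast
  show thesis
  proof (rule that[of K n0 m])
    show "0 < K" using assms(2) by (auto simp: K_def intro!: mult_pos_pos add_pos_pos)
    fix n assume "n0 \<le> n"
    from eq[OF this] obtain A where A: "A \<in> events" "prob (space M - A) \<le> \<epsilon>"
      "\<And>\<omega>. \<omega> \<in> A \<Longrightarrow> modulus_le (1 / 2 ^ m) \<eta> (emp_process n \<omega>)" by blast
    have "space M - (A - N) \<subseteq> (space M - A) \<union> N" by blast
    then have "prob (space M - (A - N)) \<le> prob ((space M - A) \<union> N)"
      using A(1) N(3) by (intro finite_measure_mono) auto
    also have "\<dots> \<le> prob (space M - A) + prob N"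
      using A(1) N(3) by (intro measure_subadditive) auto
    also have "prob N = 0" using N(2) by (simp add: measure_def)
    finally have pr: "prob (space M - (A - N)) \<le> \<epsilon>" using A(2) by simp
    have "regular_path (1 / 2 ^ m) \<eta> K (emp_process n \<omega>)" if w: "\<omega> \<in> A - N" for \<omega>
    proof -
      have "\<omega> \<in> space M" using w A(1) sets.sets_into_space by blast
      then have b: "emp_process n \<omega> (0, 1) = 0" "emp_process n \<omega> (1, 0) = 0" "emp_process n \<omega> (1, 1) = 0"
        "\<And>\<delta> \<eta> x y. 0 < \<delta> \<Longrightarrow> modulus_le \<delta> \<eta> (emp_process n \<omega>) \<Longrightarrow> x \<in> {0..1} \<Longrightarrow> y \<in> {0..1} \<Longrightarrow> C (x, y) = 0 \<Longrightarrow>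
           \<bar>emp_process n \<omega> (x, y)\<bar> \<le> \<eta>"
        using w N(1) by blast+
      have mod: "modulus_le (1 / 2 ^ m) \<eta> (emp_process n \<omega>)" using A(3) w by blast
      have z: "\<bar>emp_process n \<omega> (x, y)\<bar> \<le> \<eta>" if "x \<in> {0..1}" "y \<in> {0..1}" "C (x, y) = 0" for x y
        by (rule b(4)[OF _ mod that]) simp
      have "\<bar>emp_process n \<omega> (x, y)\<bar> \<le> K" if "x \<in> {0..1}" "y \<in> {0..1}" for x y
        unfolding K_def by (rule modulus_le_bounded[OF mod _ _ _ that]) (use assms(2) z in auto)
      then show ?thesis unfolding regular_path_def using mod b(1-3) z by blast
    qed
    then show "\<exists>A\<in>events. prob (space M - A) \<le> \<epsilon> \<and> (\<forall>\<omega>\<in>A. regular_path (1 / 2 ^ m) \<eta> K (emp_process n \<omega>))"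
      using pr A(1) N(3) by (intro bexI[of _ "A - N"]) auto
  qed
qed

text \<open>Empirical process and bridge have the same Gaussian exponent on the grid, and second
  moments at most 1: for the bridge the variance at \<open>u\<close> is \<open>C u\<close> minus its
  square.\<close>

lemma step_functional_weak_convergence:
  assumes N: "prob_space N" and B: "C_brownian_bridge C N B"
    and f: "\<And>x y. x \<in> mspace (linf unit_cube) \<Longrightarrow> y \<in> mspace (linf unit_cube) \<Longrightarrow>
      \<bar>f x - f y\<bar> \<le> K * mdist (linf unit_cube) x y"
    and bnd: "\<And>x. x \<in> mspace (linf unit_cube) \<Longrightarrow> \<bar>f x\<bar> \<le> K" and K: "0 \<le> K"
  shows "(\<lambda>n. \<integral>\<omega>. f (H_path C (step_fun m (grid_values m (emp_process n \<omega>)))) \<partial>M)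
    \<longlonglongrightarrow> (\<integral>\<omega>. f (H_path C (step_fun m (grid_values m (B \<omega>)))) \<partial>N)"
proof (rule cramer_wold_convergence[OF prob_space_axioms N finite_grid_index, where K=K
      and g="\<lambda>z. f (H_path C (step_fun m z))" and z="\<lambda>n \<omega>. grid_values m (emp_process n \<omega>)"
      and w="\<lambda>\<omega>. grid_values m (B \<omega>)"])
  note bm = C_brownian_bridge_moments[OF N B]
  show "(\<lambda>\<omega>. grid_values m (emp_process n \<omega>) t) \<in> borel_measurable M" for n t
    by (rule grid_values_measurable) (rule emp_process_measurable)
  show "(\<lambda>\<omega>. grid_values m (B \<omega>) t) \<in> borel_measurable N" for t
    by (rule grid_values_measurable) (rule bm(1))
  show "integrable M (\<lambda>\<omega>. (grid_values m (emp_process n \<omega>) t)\<^sup>2)"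
    "expectation (\<lambda>\<omega>. (grid_values m (emp_process n \<omega>) t)\<^sup>2) \<le> 1" if "t \<in> grid_index m" for n t
    using emp_process_second_moment[OF grid_point_in[OF that]] that by (simp_all add: grid_values_def)
  show "integrable N (\<lambda>\<omega>. (grid_values m (B \<omega>) t)\<^sup>2)" if "t \<in> grid_index m" for t
    using bm(3)[OF grid_point_in[OF that]] that by (simp add: grid_values_def)
  show "(\<integral>\<omega>. (grid_values m (B \<omega>) t)\<^sup>2 \<partial>N) \<le> 1" if "t \<in> grid_index m" for t
  proof -
    have u: "grid_point m t \<in> unit_square" by (rule grid_point_in[OF that])
    have "(\<integral>\<omega>. (B \<omega> (grid_point m t))\<^sup>2 \<partial>N) = C (grid_point m t) - (C (grid_point m t))\<^sup>2"
      using C_brownian_bridge_product[OF N B u u] by (simp add: power2_eq_square)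
    also have "\<dots> \<le> 1"
    proof -
      have "C (grid_point m t) \<le> 1"
        using u range01[of "fst (grid_point m t)" "snd (grid_point m t)"] by (simp add: mem_Times_iff)
      then show ?thesis using zero_le_power2[of "C (grid_point m t)"] by linarith
    qed
    finally show ?thesis using that by (simp add: grid_values_def)
  qed
  have eq: "(\<Sum>t\<in>grid_index m. a t * grid_values m b t) = (\<Sum>t\<in>grid_index m. a t * b (grid_point m t))" for a b
    by (intro sum.cong) (auto simp: grid_values_def)
  show "(\<lambda>n. \<integral>\<omega>. cis (\<Sum>t\<in>grid_index m. a t * grid_values m (emp_process n \<omega>) t) \<partial>M)
      \<longlonglongrightarrow> (\<integral>\<omega>. cis (\<Sum>t\<in>grid_index m. a t * grid_values m (B \<omega>) t) \<partial>N)" for a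
  proof -
    have lim: "(\<integral>\<omega>. cis (\<Sum>t\<in>grid_index m. a t * B \<omega> (grid_point m t)) \<partial>N) =
      complex_of_real (exp (- (\<Sum>s\<in>grid_index m. \<Sum>t\<in>grid_index m. a s * a t *
        (C (min (fst (grid_point m s)) (fst (grid_point m t)), min (snd (grid_point m s)) (snd (grid_point m t)))
          - C (grid_point m s) * C (grid_point m t))) / 2))"
      by (rule C_brownian_bridge_fidi_cis[OF N B finite_grid_index inj_grid_point]) (rule grid_point_in)
    show ?thesis
      unfolding eq lim by (rule emp_process_fidi_cis[OF finite_grid_index]) (rule grid_point_in)
  qed
  show "continuous_on UNIV (\<lambda>z. f (H_path C (step_fun m z)))" by (rule continuous_step_functional[OF f K])
  show "\<bar>f (H_path C (step_fun m z))\<bar> \<le> K" for z by (rule bnd[OF H_path_in_linf[OF step_fun_bounded]])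
  show "f (H_path C (step_fun m z)) = f (H_path C (step_fun m z'))" if "\<And>t. t \<in> grid_index m \<Longrightarrow> z t = z' t" for z z'
    using lipschitz_step_functional[OF f K, of m z z'] that by simp
qed

end

lemma assoc_process_in_linf: "assoc_process X n \<omega> \<in> mspace (linf unit_cube)"
proof -
  let ?c = "emp_copula n (\<lambda>i. X i \<omega>)"
  have "\<bar>assoc_process X n \<omega> (x, y, z)\<bar> \<le> sqrt (real n)" if "(x, y, z) \<in> unit_cube" for x y z
  proof -
    have "\<bar>?c u - ?c v\<bar> \<le> 1" for u v
      using emp_copula_range[of n "\<lambda>i. X i \<omega>" u] emp_copula_range[of n "\<lambda>i. X i \<omega>" v] by auto
    then have "sqrt (real n) * \<bar>?c u - ?c v\<bar> \<le> sqrt (real n) * 1" for u v by (intro mult_left_mono) auto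
    then show ?thesis using that by (simp add: assoc_process_def Let_def abs_mult)
  qed
  then have "\<forall>u\<in>unit_cube. \<bar>assoc_process X n \<omega> u\<bar> \<le> sqrt (real n)" by fastforce
  moreover have "assoc_process X n \<omega> \<in> extensional unit_cube" by (simp add: assoc_process_def Let_def)
  ultimately show ?thesis unfolding mspace_linf by blast
qed

section \<open>Squeezing the outer expectation\<close>

context smooth_copula_sample
begin

text \<open>The process itself is never integrated: it lies within the random error
  \<open>?I\<close> of a measurable functional of grid values. The budget is \<open>e / 4\<close>
  for discretising the bridge, \<open>e / 4\<close> for convergence on the grid, and
  \<open>e / 2\<close> for the mean of \<open>?I\<close>.\<close>

lemma outer_expectation_assoc_process:
  assumes N: "prob_space N" and B: "C_brownian_bridge C N B" and assoc: "associative_copula C"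
    and F1: "mono F1" "\<And>t. F1 t \<in> {0..1}" and F2: "mono F2" "\<And>t. F2 t \<in> {0..1}"
    and U: "\<And>i \<omega>. U i \<omega> = (F1 (fst (X i \<omega>)), F2 (snd (X i \<omega>)))"
    and bnd: "\<And>x. x \<in> mspace (linf unit_cube) \<Longrightarrow> \<bar>f x\<bar> \<le> K"
    and f: "\<And>x y. x \<in> mspace (linf unit_cube) \<Longrightarrow> y \<in> mspace (linf unit_cube) \<Longrightarrow>
      \<bar>f x - f y\<bar> \<le> K * mdist (linf unit_cube) x y"
    and e: "0 < e"
  shows "\<forall>\<^sub>F n in sequentially.
    ereal ((\<integral>\<omega>. f (H_path C (B \<omega>)) \<partial>N) - e) \<le> outer_expectation M (\<lambda>\<omega>. f (assoc_process X n \<omega>)) \<and>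
    outer_expectation M (\<lambda>\<omega>. f (assoc_process X n \<omega>)) \<le> ereal ((\<integral>\<omega>. f (H_path C (B \<omega>)) \<partial>N) + e)"
proof -
  interpret N: prob_space N by fact
  let ?V = "\<lambda>m b. f (H_path C (step_fun m (grid_values m b)))"
  define a where "a = (\<integral>\<omega>. f (H_path C (B \<omega>)) \<partial>N)"
  have H: "H_path C (step_fun m z) \<in> mspace (linf unit_cube)" for m z
    by (rule H_path_in_linf[OF step_fun_bounded])
  have K: "0 \<le> K" using bnd[OF H] abs_ge_zero by (rule order_trans[rotated])
  have e4: "0 < e / 4" using e by simp
  have contB: "continuous_on unit_square (B \<omega>)" if "\<omega> \<in> space N" for \<omega>
    using B that unfolding C_brownian_bridge_def by blast
  \<comment> \<open>248 is 4 times 62, and 62 is 50 from \<open>associativity_expansion\<close> plus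
    12 from passing to the step function; the 8 below is 4 times 2. Adding 1 to \<open>K\<close>
    avoids division by 0.\<close>
  define \<eta> where "\<eta> = e / (248 * (K + 1))"
  define \<epsilon> where "\<epsilon> = e / (8 * (K + 1))"
  have \<eta>: "0 < \<eta>" "62 * K * \<eta> \<le> e / 4" using e K by (auto simp: \<eta>_def field_simps)
  have \<epsilon>: "0 < \<epsilon>" "2 * K * \<epsilon> \<le> e / 4" using e K by (auto simp: \<epsilon>_def field_simps)
  obtain m0 n0 K' where K': "0 < K'" and reg: "\<And>n. n0 \<le> n \<Longrightarrow>
    \<exists>A\<in>events. prob (space M - A) \<le> \<epsilon> \<and> (\<forall>\<omega>\<in>A. regular_path (1 / 2 ^ m0) \<eta> K' (emp_process n \<omega>))"
    by (rule emp_process_regular[OF \<epsilon>(1) \<eta>(1)]) (rule that; blast)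
  have \<delta>: "(0::real) < 1 / 2 ^ m0" by simp
  obtain R0 where R0: "0 < R0"
    "\<And>R a c u. \<lbrakk>R0 \<le> R; regular_path (1 / 2 ^ m0) \<eta> K' a; empirical_approx R \<eta> a c; u \<in> unit_cube\<rbrakk> \<Longrightarrow>
       \<bar>(case u of (x, y, z) \<Rightarrow> R * (c (x, c (y, z)) - c (c (x, y), z))) - H_path C a u\<bar> \<le> 50 * \<eta>"
    by (rule associativity_expansion[OF assoc \<delta> \<eta>(1) K']) (rule that; blast)
  have "(\<lambda>m. \<integral>\<omega>. ?V m (B \<omega>) \<partial>N) \<longlonglongrightarrow> a"
    unfolding a_def
  proof (rule integral_dominated_convergence[where w="\<lambda>_. K"])
    have lim: "(\<lambda>m. ?V m (B \<omega>)) \<longlonglongrightarrow> f (H_path C (B \<omega>))" if "\<omega> \<in> space N" for \<omega>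
      by (rule step_functional_LIMSEQ[OF f K contB[OF that]])
    show meas: "(\<lambda>\<omega>. ?V m (B \<omega>)) \<in> borel_measurable N" for m
      by (rule step_functional_measurable[OF f K C_brownian_bridge_moments(1)[OF N B]])
    show "(\<lambda>\<omega>. f (H_path C (B \<omega>))) \<in> borel_measurable N"
      by (rule borel_measurable_LIMSEQ_real[OF lim meas])
    show "AE \<omega> in N. (\<lambda>m. ?V m (B \<omega>)) \<longlonglongrightarrow> f (H_path C (B \<omega>))" using lim by (rule AE_I2)
    show "AE \<omega> in N. norm (?V m (B \<omega>)) \<le> K" for m using bnd[OF H] by (intro AE_I2) simp
  qed simp
  then have "\<forall>\<^sub>F m in sequentially. dist (\<integral>\<omega>. ?V m (B \<omega>) \<partial>N) a < e / 4"
    using e4 by (rule tendstoD)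
  then obtain m1 where m1: "\<And>m. m1 \<le> m \<Longrightarrow> dist (\<integral>\<omega>. ?V m (B \<omega>) \<partial>N) a < e / 4"
    by (auto simp: eventually_sequentially)
  \<comment> \<open>Fine enough for the modulus scale \<open>1 / 2 ^ m0\<close> of the empirical
    paths and for the discretisation of the bridge.\<close>
  define m where "m = max m0 m1"
  have m: "m0 \<le> m" "dist (\<integral>\<omega>. ?V m (B \<omega>) \<partial>N) a < e / 4" using m1[of m] by (auto simp: m_def)
  have "\<forall>\<^sub>F n in sequentially. dist (\<integral>\<omega>. ?V m (emp_process n \<omega>) \<partial>M) (\<integral>\<omega>. ?V m (B \<omega>) \<partial>N) < e / 4"
    by (rule tendstoD[OF step_functional_weak_convergence[OF N B f bnd K] e4])
  moreover have "\<forall>\<^sub>F n in sequentially. R0 \<le> sqrt (real n)"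
  proof -
    obtain n1 :: nat where n1: "R0\<^sup>2 \<le> real n1" using real_arch_simple by blast
    have "R0 \<le> sqrt (real n)" if "n1 \<le> n" for n using n1 that by (intro real_le_rsqrt) linarith
    then show ?thesis by (rule eventually_sequentiallyI)
  qed
  moreover have "\<forall>\<^sub>F n in sequentially. n0 \<le> n" by (rule eventually_ge_at_top)
  moreover have "\<forall>\<^sub>F n in sequentially. 1 \<le> n" by (rule eventually_ge_at_top)
  ultimately show ?thesis
  proof eventually_elim
    case (elim n)
    obtain A where A: "A \<in> events" "prob (space M - A) \<le> \<epsilon>"
      "\<And>\<omega>. \<omega> \<in> A \<Longrightarrow> regular_path (1 / 2 ^ m0) \<eta> K' (emp_process n \<omega>)"
      using reg[OF elim(3)] by blast
    have good: "\<bar>f (assoc_process X n \<omega>) - ?V m (emp_process n \<omega>)\<bar> \<le> 62 * K * \<eta>" if "\<omega> \<in> A" for \<omega>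
    proof -
      note r = A(3)[OF that]
      note rD = regular_pathD[OF r]
      have eU: "emp_process n \<omega> = empirical_process C n (\<lambda>i. (F1 (fst (X i \<omega>)), F2 (snd (X i \<omega>))))"
        by (simp add: U)
      have "empirical_approx (sqrt (real n)) \<eta> (emp_process n \<omega>) (emp_copula n (\<lambda>i. X i \<omega>))"
        using rD(1,4,5) \<eta>(1) unfolding eU by (intro empirical_approx_emp_copula[OF elim(4) F1 F2 _ \<delta>]) auto
      from R0(2)[OF elim(2) r this]
      have 1: "\<bar>assoc_process X n \<omega> u - H_path C (emp_process n \<omega>) u\<bar> \<le> 50 * \<eta>" if "u \<in> unit_cube" for u
        using that by (auto simp: assoc_process_def Let_def)
      have b: "\<bar>emp_process n \<omega> u\<bar> \<le> K'" if "u \<in> unit_square" for u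
        using rD(2)[of "fst u" "snd u"] that by (simp add: mem_Times_iff)
      have 2: "\<bar>H_path C (emp_process n \<omega>) u - H_path C (step_fun m (grid_values m (emp_process n \<omega>))) u\<bar> \<le> 12 * \<eta>"
        if "u \<in> unit_cube" for u
      proof (rule H_path_lipschitz[OF _ that])
        fix v :: "real \<times> real" assume "v \<in> unit_square"
        then show "\<bar>emp_process n \<omega> v - step_fun m (grid_values m (emp_process n \<omega>)) v\<bar> \<le> \<eta>"
          using step_fun_modulus[OF rD(1) m(1), of "fst v" "snd v"] by (simp add: mem_Times_iff)
      qed
      have "mdist (linf unit_cube) (assoc_process X n \<omega>) (H_path C (step_fun m (grid_values m (emp_process n \<omega>)))) \<le> 62 * \<eta>"
      proof (rule mdist_linf_le[OF assoc_process_in_linf H])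
        fix u assume u: "u \<in> unit_cube"
        show "\<bar>assoc_process X n \<omega> u - H_path C (step_fun m (grid_values m (emp_process n \<omega>))) u\<bar> \<le> 62 * \<eta>"
          using 1[OF u] 2[OF u] by linarith
      qed auto
      then have "K * mdist (linf unit_cube) (assoc_process X n \<omega>) (H_path C (step_fun m (grid_values m (emp_process n \<omega>)))) \<le> K * (62 * \<eta>)"
        using K by (rule mult_left_mono)
      then show ?thesis using f[OF assoc_process_in_linf H, of X n \<omega> m "grid_values m (emp_process n \<omega>)"] by simp
    qed
    \<comment> \<open>Uniform error on the good event \<open>A\<close>, the trivial bound
      \<open>2 * K\<close> elsewhere; unlike the process, this is measurable.\<close>
    let ?I = "\<lambda>\<omega>. 62 * K * \<eta> + 2 * K * indicator (space M - A) \<omega>"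
    have close: "\<bar>f (assoc_process X n \<omega>) - ?V m (emp_process n \<omega>)\<bar> \<le> ?I \<omega>" if "\<omega> \<in> space M" for \<omega>
    proof (cases "\<omega> \<in> A")
      case True
      then show ?thesis using good[OF True] by simp
    next
      case False
      have "0 \<le> 62 * K * \<eta>" using K \<eta>(1) by simp
      then show ?thesis
        using bnd[OF assoc_process_in_linf, of X n \<omega>] bnd[OF H, of m "grid_values m (emp_process n \<omega>)"] False that by simp
    qed
    have intV: "integrable M (\<lambda>\<omega>. ?V m (emp_process n \<omega>))"
    proof (rule integrable_const_bound[where B=K])
      show "AE \<omega> in M. norm (?V m (emp_process n \<omega>)) \<le> K" using bnd[OF H] by (intro AE_I2) simp
      show "(\<lambda>\<omega>. ?V m (emp_process n \<omega>)) \<in> borel_measurable M"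
        by (rule step_functional_measurable[OF f K emp_process_measurable])
    qed
    have A': "space M - A \<in> events" using A(1) by auto
    have intI: "integrable M ?I" using A' by (auto intro!: integrable_real_indicator simp: less_top[symmetric])
    have "expectation ?I = 62 * K * \<eta> + 2 * K * prob (space M - A)"
      using A' by (simp add: prob_space less_top[symmetric])
    also have "\<dots> \<le> e / 2"
      using \<eta>(2) \<epsilon>(2) mult_left_mono[OF A(2), of "2 * K"] K by linarith
    finally have EI: "expectation ?I \<le> e / 2" .
    have EV: "\<bar>expectation (\<lambda>\<omega>. ?V m (emp_process n \<omega>)) - a\<bar> < e / 2"
      using order.strict_trans1[OF dist_triangle add_strict_mono[OF elim(1) m(2)]] by (simp add: dist_real_def)
    have bounds: "expectation (\<lambda>\<omega>. ?V m (emp_process n \<omega>)) + expectation ?I \<le> a + e"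
      "a - e \<le> expectation (\<lambda>\<omega>. ?V m (emp_process n \<omega>)) - expectation ?I"
      using EI abs_less_iff[THEN iffD1, OF EV] by linarith+
    have "outer_expectation M (\<lambda>\<omega>. f (assoc_process X n \<omega>)) \<le> ereal (expectation (\<lambda>\<omega>. ?V m (emp_process n \<omega>) + ?I \<omega>))"
    proof (rule outer_expectation_le_integral[OF Bochner_Integration.integrable_add[OF intV intI]])
      fix \<omega> assume "\<omega> \<in> space M"
      from close[OF this] show "f (assoc_process X n \<omega>) \<le> ?V m (emp_process n \<omega>) + ?I \<omega>" by linarith
    qed
    also have "\<dots> \<le> ereal (a + e)"
      unfolding Bochner_Integration.integral_add[OF intV intI] using bounds(1) by simp
    finally have up: "outer_expectation M (\<lambda>\<omega>. f (assoc_process X n \<omega>)) \<le> ereal (a + e)" .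
    have "ereal (a - e) \<le> ereal (expectation (\<lambda>\<omega>. ?V m (emp_process n \<omega>) - ?I \<omega>))"
      unfolding Bochner_Integration.integral_diff[OF intV intI] using bounds(2) by simp
    also have "\<dots> \<le> outer_expectation M (\<lambda>\<omega>. f (assoc_process X n \<omega>))"
    proof (rule integral_le_outer_expectation[OF Bochner_Integration.integrable_diff[OF intV intI]])
      fix \<omega> assume "\<omega> \<in> space M"
      from close[OF this] show "?V m (emp_process n \<omega>) - ?I \<omega> \<le> f (assoc_process X n \<omega>)" by linarith
    qed
    finally show ?case using up unfolding a_def by blast
  qed
qed

end

theorem theorem2p2:
  fixes M :: "'a measure" and X :: "nat \<Rightarrow> 'a \<Rightarrow> real \<times> real"
    and D :: "(real \<times> real) measure"
    and C :: "real \<times> real \<Rightarrow> real"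
    and N :: "'b measure" and B :: "'b \<Rightarrow> real \<times> real \<Rightarrow> real"
  assumes "prob_space M"
    and "prob_space.indep_vars M (\<lambda>_. borel) X {1..}"
    and "\<And>i. 1 \<le> i \<Longrightarrow> distr M borel (X i) = D"
    and "continuous_on UNIV (joint_cdf D)"
    and "continuous_on UNIV (marginal_cdf1 D)"
    and "continuous_on UNIV (marginal_cdf2 D)"
    and "copula_of C D"
    and "associative_copula C"
    and "has_continuous_partials C"
    and "prob_space N"
    and "C_brownian_bridge C N B"
  shows "weakly_converges_HJ (linf unit_cube) M (assoc_process X) N (\<lambda>\<omega>. H_path C (B \<omega>))"
proof -
  interpret M: prob_space M by fact
  note N = \<open>prob_space N\<close> and B = \<open>C_brownian_bridge C N B\<close>
  let ?F1 = "marginal_cdf1 D" and ?F2 = "marginal_cdf2 D"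
  have Xm: "X i \<in> borel_measurable M" if "1 \<le> i" for i
    using assms(2) that unfolding M.indep_vars_def2 by auto
  have D1: "distr M borel (X 1) = D" by (rule assms(3)) simp
  have pD: "prob_space D" unfolding D1[symmetric] by (rule M.prob_space_distr[OF Xm]) simp
  have sD: "sets D = sets borel" unfolding D1[symmetric] by simp
  have mD: "fst \<in> borel_measurable D" "snd \<in> borel_measurable D"
    unfolding measurable_cong_sets[OF sD refl]
    by (intro borel_measurable_continuous_onI continuous_intros)+
  interpret D: prob_space D by (rule pD)
  interpret d1: real_distribution "distr D borel fst" by (rule D.real_distribution_distr[OF mD(1)])
  interpret d2: real_distribution "distr D borel snd" by (rule D.real_distribution_distr[OF mD(2)])
  have F1: "mono ?F1" "\<And>t. ?F1 t \<in> {0..1}"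
    using d1.cdf_nondecreasing d1.cdf_nonneg d1.cdf_bounded_prob by (auto simp: mono_def marginal_cdf1_def)
  have F2: "mono ?F2" "\<And>t. ?F2 t \<in> {0..1}"
    using d2.cdf_nondecreasing d2.cdf_nonneg d2.cdf_bounded_prob by (auto simp: mono_def marginal_cdf2_def)
  \<comment> \<open>The probability integral transform. Applied to the observations it yields a
    sample whose distribution function on the unit square is \<open>C\<close>, even where the
    margins have plateaus.\<close>
  define T where "T p = (?F1 (fst p), ?F2 (snd p))" for p
  have "continuous_on UNIV T"
    unfolding T_def
    by (intro continuous_on_Pair continuous_on_compose2[OF assms(5)] continuous_on_compose2[OF assms(6)] continuous_intros) auto
  then have Tm: "T \<in> borel_measurable borel" by (rule borel_measurable_continuous_onI)
  define U where "U i \<omega> = T (X i \<omega>)" for i \<omega>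
  interpret smooth_copula_sample M C U
  proof unfold_locales
    show "copula C" using assms(7) by (simp add: copula_of_def)
    show "has_continuous_partials C" by fact
    show "M.indep_vars (\<lambda>_. borel) U {1..}"
      unfolding U_def by (rule M.indep_vars_compose2[OF assms(2)]) (rule Tm)
    fix i :: nat assume i: "1 \<le> i"
    have "distr M borel (U i) = distr (distr M borel (X i)) borel T"
      unfolding U_def using distr_distr[OF Tm Xm[OF i]] by (simp add: comp_def)
    then have *: "distr M borel (U i) = distr D borel T" if "1 \<le> i" for i
      using distr_distr[OF Tm Xm[OF that]] assms(3)[OF that] unfolding U_def by (simp add: comp_def)
    show "distr M borel (U i) = distr M borel (U 1)" using *[OF i] *[of 1] by simp
    fix v w :: real assume vw: "v \<in> {0..1}" "w \<in> {0..1}"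
    let ?S = "{p. ?F1 (fst p) \<le> v \<and> ?F2 (snd p) \<le> w}"
    have "?S = T -` ({..v} \<times> {..w}) \<inter> space borel" by (auto simp: T_def)
    also have "\<dots> \<in> sets borel" by (rule measurable_sets[OF Tm]) (intro borel_closed closed_Times closed_atMost)
    finally have S: "?S \<in> sets borel" .
    have "M.prob {\<omega> \<in> space M. fst (U i \<omega>) \<le> v \<and> snd (U i \<omega>) \<le> w} = M.prob (X i -` ?S \<inter> space M)"
      by (intro arg_cong[where f="M.prob"]) (auto simp: U_def T_def)
    also have "\<dots> = measure (distr M borel (X i)) ?S" by (rule measure_distr[OF Xm[OF i] S, symmetric])
    also have "\<dots> = C (v, w)"
      unfolding assms(3)[OF i] by (rule measure_transformed_rectangle[OF pD sD assms(5,6,7) vw])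
    finally show "M.prob {\<omega> \<in> space M. fst (U i \<omega>) \<le> v \<and> snd (U i \<omega>) \<le> w} = C (v, w)" .
  qed
  have UX: "U i \<omega> = (?F1 (fst (X i \<omega>)), ?F2 (snd (X i \<omega>)))" for i \<omega> by (simp add: U_def T_def)
  show ?thesis
  proof (rule weakly_converges_HJ_lipschitzI[OF N])
    show "assoc_process X n \<in> space M \<rightarrow> mspace (linf unit_cube)" for n
      by (rule Pi_I) (rule assoc_process_in_linf)
    show "(\<lambda>\<omega>. H_path C (B \<omega>)) \<in> N \<rightarrow>\<^sub>M borel_of_metric (linf unit_cube)"
    proof (rule H_path_measurable)
      show "(\<lambda>\<omega>. B \<omega> u) \<in> borel_measurable N" if "u \<in> unit_square" for u
        by (rule C_brownian_bridge_moments(1)[OF N B that])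
      show "continuous_on unit_square (B \<omega>)" if "\<omega> \<in> space N" for \<omega>
        using B that unfolding C_brownian_bridge_def by blast
    qed
    fix f :: "(real \<times> real \<times> real \<Rightarrow> real) \<Rightarrow> real" and K
    assume bnd: "\<And>x. x \<in> mspace (linf unit_cube) \<Longrightarrow> \<bar>f x\<bar> \<le> K"
      and lip: "\<And>x y. x \<in> mspace (linf unit_cube) \<Longrightarrow> y \<in> mspace (linf unit_cube) \<Longrightarrow>
        \<bar>f x - f y\<bar> \<le> K * mdist (linf unit_cube) x y"
    have ev: "\<forall>\<^sub>F n in sequentially.
        ereal ((\<integral>\<omega>. f (H_path C (B \<omega>)) \<partial>N) - e) \<le> outer_expectation M (\<lambda>\<omega>. f (assoc_process X n \<omega>)) \<and>
        outer_expectation M (\<lambda>\<omega>. f (assoc_process X n \<omega>)) \<le> ereal ((\<integral>\<omega>. f (H_path C (B \<omega>)) \<partial>N) + e)"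
      if "0 < e" for e
      by (rule outer_expectation_assoc_process[OF N B \<open>associative_copula C\<close> F1 F2 UX bnd lip that])
    show "(\<lambda>n. outer_expectation M (\<lambda>\<omega>. f (assoc_process X n \<omega>))) \<longlonglongrightarrow> ereal (\<integral>\<omega>. f (H_path C (B \<omega>)) \<partial>N)"
    proof (rule ereal_LIMSEQ_sandwich)
      fix e :: real assume "0 < e"
      from ev[OF this]
      show "\<forall>\<^sub>F n in sequentially. ereal ((\<integral>\<omega>. f (H_path C (B \<omega>)) \<partial>N) - e) \<le> outer_expectation M (\<lambda>\<omega>. f (assoc_process X n \<omega>))"
        and "\<forall>\<^sub>F n in sequentially. outer_expectation M (\<lambda>\<omega>. f (assoc_process X n \<omega>)) \<le> ereal ((\<integral>\<omega>. f (H_path C (B \<omega>)) \<partial>N) + e)"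
        by (simp_all add: eventually_conj_iff)
    qed
  qed
qed

end
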